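(* Let $f:\mathbb R^n\to\mathbb R$ be a metric function such that each connected component of the set of critical points of $f$ is either a point or a regular surface, and each such component is isolated from the others. Then the level surfaces of $f$ (connected components of level sets) form a foliation (possibly with singularities) of one of the following types: (1) $F$ consists of parallel hyperplanes; (2) $F$ consists of concentric hyperspheres together with their common center (a point); (3) $F$ consists of concentric cylinders of the form $S^{n-k-1}\times\mathbb R^k$ together with a singular leaf $\mathbb R^k$ (the common axis), where $k$ is the minimum of the dimensions of the critical level surfaces and $1\le k\le n-2$.
   Context: A metric function on a manifold $M$ is a function $f\in C^2(M,\mathbb R)$ such that $|\operatorname{grad}f|$ is constant on each connected component of each level set of $f$. $S^m$ denotes the $m$-sphere. *)

theory Defs
  imports "HOL-Analysis.Analysis"
begin

text \<open>Continuously differentiable maps on an (open) set of a Euclidean space: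
  the derivative exists at every point of S and depends continuously on the point
  (continuity of all columns, equivalent to operator-norm continuity in finite dimension).\<close>
definition C1_on :: "'a::euclidean_space set \<Rightarrow> ('a \<Rightarrow> 'b::euclidean_space) \<Rightarrow> bool" where
  "C1_on S \<phi> \<longleftrightarrow> (\<exists>\<phi>'. (\<forall>x\<in>S. (\<phi> has_derivative \<phi>' x) (at x))
                        \<and> (\<forall>i\<in>Basis. continuous_on S (\<lambda>x. \<phi>' x i)))"

definition gradient :: "('a::euclidean_space \<Rightarrow> real) \<Rightarrow> 'a \<Rightarrow> 'a" where
  "gradient f x = (SOME D. GDERIV f x :> D)"

definition C2_fun :: "('a::euclidean_space \<Rightarrow> real) \<Rightarrow> bool" where
  "C2_fun f \<longleftrightarrow> (\<forall>x. f differentiable (at x)) \<and> C1_on UNIV (gradient f)"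

definition metric_function :: "('a::euclidean_space \<Rightarrow> real) \<Rightarrow> bool" where
  "metric_function f \<longleftrightarrow> C2_fun f \<and>
     (\<forall>c. \<forall>K \<in> components (f -` {c}). \<forall>x\<in>K. \<forall>y\<in>K. norm (gradient f x) = norm (gradient f y))"

definition critical_set :: "('a::euclidean_space \<Rightarrow> real) \<Rightarrow> 'a set" where
  "critical_set f = {x. gradient f x = 0}"

definition level_surfaces :: "('a::euclidean_space \<Rightarrow> real) \<Rightarrow> 'a set set" where
  "level_surfaces f = (\<Union>c. components (f -` {c}))"

definition regular_surface :: "nat \<Rightarrow> 'a::euclidean_space set \<Rightarrow> bool" where
  "regular_surface d M \<longleftrightarrow>
     (\<forall>p\<in>M. \<exists>U (V::'a set) \<psi> \<psi>' L. open U \<and> p \<in> U \<and> open V \<and> homeomorphism U V \<psi> \<psi>'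
        \<and> C1_on U \<psi> \<and> C1_on V \<psi>' \<and> subspace L \<and> dim L = d \<and> \<psi> ` (M \<inter> U) = V \<inter> L)"

end

theory Submission
  imports Defs
begin

text \<open>
  Call a critical component singular if its codimension is at least two.
  Along a leaf the gradient is a multiple of the unit normal \<open>N\<close> with constant factor, so \<open>N\<close> has
  straight integral curves, and points moved along these normal lines by equal amounts from one leaf
  land on one leaf again. The nearest point of a leaf to a critical point lies on such a line; hence
  every regular point sees the critical set along its own normal line at exactly the distance to it.
  Since critical components are regular surfaces, normal lines cross them straight, and the
  transport between leaves works for all times.

  A nonzero eigenvalue \<open>\<mu>\<close> of the shape operator \<open>A = DN\<close> forces the normal line to focus at time
  \<open>-1/\<mu>\<close>, which is impossible at regular points and at critical hypersurfaces. Thus without singular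
  components \<open>A = 0\<close> and the leaves are parallel hyperplanes. At a singular component the line does focus,
  and the foliation is symmetric under reflection there; two singular hits would give infinitely
  many eigenvalues of \<open>A\<close>, so every normal line has exactly one. The distance \<open>D\<close> to the singular set then
  grows at unit speed along outward rays for all times, which makes \<open>D\<close> convex; a closed convex set that
  is a regular surface is an affine subspace, and the leaves are the level sets of \<open>D\<close>.
\<close>

section \<open>Second derivatives\<close>

text \<open>\<open>f\<close> is only C2, so \<open>N\<close> is C1 and \<open>A\<close> merely
  continuous off the critical set: a Riccati equation for \<open>A\<close> along normal lines is not
  at hand. Focal times are found instead by differentiating identities such as
  \<open>N (ray z t) = N z\<close> in \<open>z\<close>, and straightness by a linear estimate for
  the deviation of \<open>N\<close> on a given line.

  The second obstacle is the crossing of critical points. There \<open>N\<close> carries no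
  information, and it may or may not flip sign at a critical hypersurface, so normals are compared
  up to sign throughout. That a line meets the critical set orthogonally and leaves it along the
  normal field is local, and rests on one estimate: short chords of a C1 surface are nearly tangent.

  At a critical hypersurface no dimension count forbids focusing. The argument there uses
  two-sidedness: points at distance \<open>\<delta>\<close> on opposite sides are at least
  \<open>2 * \<delta>\<close> apart, which limits how fast the normal can turn.

  Infinitely many eigenvalues arise because reflection in one hit moves the other hit through an
  arithmetic progression of times.

  A leaf through a critical point is at first only a component of a level set. Its shape is settled
  last, by density of the regular points.\<close>

locale c2_function =
  fixes f :: "'a::euclidean_space \<Rightarrow> real" and G :: "'a \<Rightarrow> 'a" and H :: "'a \<Rightarrow> 'a \<Rightarrow> 'a"
  assumes f_deriv: "\<And>x. (f has_derivative (\<lambda>v. G x \<bullet> v)) (at x)"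
    and G_deriv: "\<And>x. (G has_derivative H x) (at x)"
    and H_cont: "\<And>v. continuous_on UNIV (\<lambda>x. H x v)"
begin

lemma H_linear: "bounded_linear (H x)"
  using G_deriv has_derivative_bounded_linear by blast

lemma H_simps:
  "H x (u + v) = H x u + H x v" "H x (u - v) = H x u - H x v" "H x (c *\<^sub>R v) = c *\<^sub>R H x v"
  "H x 0 = 0" "H x (- v) = - H x v"
proof -
  interpret bounded_linear "H x" by (rule H_linear)
  show "H x (u + v) = H x u + H x v" "H x (u - v) = H x u - H x v" "H x (c *\<^sub>R v) = c *\<^sub>R H x v"
  "H x 0 = 0" "H x (- v) = - H x v" by (auto simp: add diff scaleR zero neg)
qed

lemma G_cont: "continuous_on S G"
  by (meson G_deriv has_derivative_continuous continuous_at_imp_continuous_on)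

lemma f_cont: "continuous_on S f"
  by (meson f_deriv has_derivative_continuous continuous_at_imp_continuous_on)

text \<open>The mean value theorem in direction \<open>u\<close> turns the second difference of
  \<open>f\<close> into a first difference of \<open>G\<close>, which is then linearised at
  \<open>x\<close>. The second difference is symmetric in \<open>u\<close> and \<open>v\<close>
  while its limit is \<open>H x v \<bullet> u\<close>, and this is the source of the symmetry of
  \<open>H\<close>.\<close>

lemma second_difference:
  assumes "e > 0"
  shows "\<exists>d>0. \<forall>h. 0 < h \<and> h < d \<longrightarrow>
    \<bar>f (x + h *\<^sub>R u + h *\<^sub>R v) - f (x + h *\<^sub>R u) - f (x + h *\<^sub>R v) + f x - h\<^sup>2 * (H x v \<bullet> u)\<bar> \<le> e * h\<^sup>2"
proof -
  define K where "K = norm u + norm v + 1"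
  have K: "K > 0" by (simp add: K_def add_nonneg_pos)
  \<comment> \<open>The two linearisation errors add up to \<open>2 * e' * (h * K)\<close>, and
    pairing with \<open>u\<close> costs one more factor \<open>norm u \<le> K\<close>; the constant
    makes the product \<open>e * h\<close>.\<close>
  define e' where "e' = e / (2 * K * K)"
  have e': "e' > 0" using assms K by (simp add: e'_def)
  obtain d where d: "d > 0" "\<And>y. norm (y - x) < d \<Longrightarrow> norm (G y - G x - H x (y - x)) \<le> e' * norm (y - x)"
    using G_deriv[of x] e' unfolding has_derivative_at_alt by blast
  show ?thesis
  proof (intro exI[of _ "d / K"] conjI allI impI)
    show "d / K > 0" using d K by simp
    fix h :: real assume h: "0 < h \<and> h < d / K"
    define \<phi> where "\<phi> = (\<lambda>s. f (x + s *\<^sub>R u + h *\<^sub>R v) - f (x + s *\<^sub>R u))"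
    have der: "(\<phi> has_real_derivative (G (x + s *\<^sub>R u + h *\<^sub>R v) - G (x + s *\<^sub>R u)) \<bullet> u) (at s)" for s
    proof -
      have "((\<lambda>s. f (x + s *\<^sub>R u + h *\<^sub>R v)) has_derivative (\<lambda>t. G (x + s *\<^sub>R u + h *\<^sub>R v) \<bullet> (t *\<^sub>R u))) (at s)"
        by (rule has_derivative_compose[OF _ f_deriv, of "\<lambda>s. x + s *\<^sub>R u + h *\<^sub>R v" "\<lambda>t. t *\<^sub>R u"])
           (auto intro!: derivative_eq_intros)
      moreover have "((\<lambda>s. f (x + s *\<^sub>R u)) has_derivative (\<lambda>t. G (x + s *\<^sub>R u) \<bullet> (t *\<^sub>R u))) (at s)"
        by (rule has_derivative_compose[OF _ f_deriv, of "\<lambda>s. x + s *\<^sub>R u" "\<lambda>t. t *\<^sub>R u"])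
           (auto intro!: derivative_eq_intros)
      ultimately have "(\<phi> has_derivative (\<lambda>t. G (x + s *\<^sub>R u + h *\<^sub>R v) \<bullet> (t *\<^sub>R u) - G (x + s *\<^sub>R u) \<bullet> (t *\<^sub>R u))) (at s)"
        unfolding \<phi>_def by (rule has_derivative_diff)
      then show ?thesis
        by (rule has_derivative_imp_has_field_derivative) (simp add: inner_diff_left algebra_simps)
    qed
    obtain \<xi> where \<xi>: "0 < \<xi>" "\<xi> < h" "\<phi> h - \<phi> 0 = h * ((G (x + \<xi> *\<^sub>R u + h *\<^sub>R v) - G (x + \<xi> *\<^sub>R u)) \<bullet> u)"
      using MVT2[of 0 h \<phi> "\<lambda>s. (G (x + s *\<^sub>R u + h *\<^sub>R v) - G (x + s *\<^sub>R u)) \<bullet> u"] der h by auto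
    let ?a = "\<xi> *\<^sub>R u + h *\<^sub>R v" and ?b = "\<xi> *\<^sub>R u"
    have na: "norm ?a \<le> h * K"
    proof -
      have "norm ?a \<le> \<xi> * norm u + h * norm v"
        using \<xi> h norm_triangle_ineq[of "\<xi> *\<^sub>R u" "h *\<^sub>R v"] by simp
      also have "\<dots> \<le> h * norm u + h * norm v" using \<xi> by (simp add: mult_right_mono)
      also have "\<dots> \<le> h * K" using h by (simp add: K_def algebra_simps)
      finally show ?thesis .
    qed
    have nb: "norm ?b \<le> h * K"
    proof -
      have "norm ?b \<le> h * norm u" using \<xi> by (simp add: mult_right_mono)
      also have "\<dots> \<le> h * K" using h by (simp add: K_def mult_left_mono)
      finally show ?thesis .
    qed
    have hK: "h * K < d" using h K by (simp add: field_simps)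
    have 1: "norm (G (x + ?a) - G x - H x ?a) \<le> e' * (h * K)"
      using d(2)[of "x + ?a"] na hK e' by (smt (verit) add_diff_cancel_left' mult_left_mono)
    have 2: "norm (G (x + ?b) - G x - H x ?b) \<le> e' * (h * K)"
      using d(2)[of "x + ?b"] nb hK e' by (smt (verit) add_diff_cancel_left' mult_left_mono)
    have eq: "(G (x + ?a) - G (x + ?b)) - h *\<^sub>R H x v = (G (x + ?a) - G x - H x ?a) - (G (x + ?b) - G x - H x ?b)"
      by (simp add: H_simps)
    have "norm ((G (x + ?a) - G (x + ?b)) - h *\<^sub>R H x v) \<le> 2 * e' * (h * K)"
      unfolding eq using 1 2 norm_triangle_ineq4[of "G (x + ?a) - G x - H x ?a" "G (x + ?b) - G x - H x ?b"] by linarith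
    then have 3: "\<bar>((G (x + ?a) - G (x + ?b)) - h *\<^sub>R H x v) \<bullet> u\<bar> \<le> 2 * e' * (h * K) * norm u"
      by (meson Cauchy_Schwarz_ineq2 mult_right_mono norm_ge_zero order_trans)
    have "\<dots> \<le> 2 * e' * (h * K) * K"
      using e' h K by (intro mult_left_mono) (auto simp: K_def)
    also have "\<dots> = e * h" using K by (simp add: e'_def field_simps)
    finally have 4: "\<bar>((G (x + ?a) - G (x + ?b)) - h *\<^sub>R H x v) \<bullet> u\<bar> \<le> e * h" using 3 by linarith
    have "f (x + h *\<^sub>R u + h *\<^sub>R v) - f (x + h *\<^sub>R u) - f (x + h *\<^sub>R v) + f x - h\<^sup>2 * (H x v \<bullet> u)
        = h * (((G (x + ?a) - G (x + ?b)) - h *\<^sub>R H x v) \<bullet> u)"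
      using \<xi>(3) unfolding \<phi>_def by (simp add: inner_diff_left power2_eq_square algebra_simps)
    then have "\<bar>f (x + h *\<^sub>R u + h *\<^sub>R v) - f (x + h *\<^sub>R u) - f (x + h *\<^sub>R v) + f x - h\<^sup>2 * (H x v \<bullet> u)\<bar>
        = h * \<bar>((G (x + ?a) - G (x + ?b)) - h *\<^sub>R H x v) \<bullet> u\<bar>"
      using h by (simp add: abs_mult)
    also have "\<dots> \<le> h * (e * h)" using 4 h by (intro mult_left_mono) auto
    finally show "\<bar>f (x + h *\<^sub>R u + h *\<^sub>R v) - f (x + h *\<^sub>R u) - f (x + h *\<^sub>R v) + f x - h\<^sup>2 * (H x v \<bullet> u)\<bar> \<le> e * h\<^sup>2"
      by (simp add: power2_eq_square mult.assoc mult.left_commute)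
  qed
qed

lemma H_symmetric: "H x u \<bullet> v = u \<bullet> H x v"
proof -
  have "\<bar>H x v \<bullet> u - H x u \<bullet> v\<bar> \<le> e" if e: "e > 0" for e
  proof -
    obtain d1 where d1: "d1 > 0" "\<And>h. 0 < h \<and> h < d1 \<Longrightarrow>
      \<bar>f (x + h *\<^sub>R u + h *\<^sub>R v) - f (x + h *\<^sub>R u) - f (x + h *\<^sub>R v) + f x - h\<^sup>2 * (H x v \<bullet> u)\<bar> \<le> e/2 * h\<^sup>2"
      using second_difference[of "e/2" x u v] e by auto
    obtain d2 where d2: "d2 > 0" "\<And>h. 0 < h \<and> h < d2 \<Longrightarrow>
      \<bar>f (x + h *\<^sub>R v + h *\<^sub>R u) - f (x + h *\<^sub>R v) - f (x + h *\<^sub>R u) + f x - h\<^sup>2 * (H x u \<bullet> v)\<bar> \<le> e/2 * h\<^sup>2"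
      using second_difference[of "e/2" x v u] e by auto
    define h where "h = min d1 d2 / 2"
    have h: "0 < h" "h < d1" "h < d2" using d1 d2 by (auto simp: h_def)
    have sw: "x + h *\<^sub>R v + h *\<^sub>R u = x + h *\<^sub>R u + h *\<^sub>R v" by simp
    have "\<bar>P - Q - R + S - X\<bar> \<le> m \<Longrightarrow> \<bar>P - R - Q + S - Y\<bar> \<le> m \<Longrightarrow> \<bar>X - Y\<bar> \<le> 2 * m"
      for P Q R S X Y m :: real by linarith
    from this[OF d1(2)[of h] d2(2)[of h, unfolded sw]]
    have "\<bar>h\<^sup>2 * (H x v \<bullet> u) - h\<^sup>2 * (H x u \<bullet> v)\<bar> \<le> e * h\<^sup>2"
      using h by simp
    moreover have "\<bar>h\<^sup>2 * (H x v \<bullet> u) - h\<^sup>2 * (H x u \<bullet> v)\<bar> = h\<^sup>2 * \<bar>H x v \<bullet> u - H x u \<bullet> v\<bar>"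
      unfolding right_diff_distrib[symmetric] abs_mult by simp
    ultimately have "h\<^sup>2 * \<bar>H x v \<bullet> u - H x u \<bullet> v\<bar> \<le> h\<^sup>2 * e"
      by (simp add: mult.commute)
    then show ?thesis using h by simp
  qed
  then have "H x v \<bullet> u - H x u \<bullet> v = 0" by (metis abs_le_zero_iff field_le_epsilon add_0)
  then show ?thesis by (simp add: inner_commute)
qed

end

section \<open>Leaves\<close>

text \<open>Chain rule with vanishing derivative. The derivative of \<open>\<phi>\<close> has to
  kill only the velocity of the curve, so the lemma serves for \<open>f\<close>, for
  \<open>f\<close> after a shift along normals, and for signs such as
  \<open>N (ray z u) \<bullet> N z\<close>.\<close>

lemma constant_along_path:
  fixes \<gamma> :: "real \<Rightarrow> 'a::real_normed_vector" and \<phi> :: "'a \<Rightarrow> 'b::real_normed_vector"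
  assumes "\<And>s. s \<in> {a..b} \<Longrightarrow> \<exists>\<phi>' d. (\<phi> has_derivative \<phi>') (at (\<gamma> s)) \<and> (\<gamma> has_vector_derivative d) (at s) \<and> \<phi>' d = 0"
    and "s \<in> {a..b}" "t \<in> {a..b}"
  shows "\<phi> (\<gamma> s) = \<phi> (\<gamma> t)"
proof -
  have "((\<lambda>s. \<phi> (\<gamma> s)) has_derivative (\<lambda>h. 0)) (at s within {a..b})" if s: "s \<in> {a..b}" for s
  proof -
    obtain \<phi>' d where *: "(\<phi> has_derivative \<phi>') (at (\<gamma> s))" "(\<gamma> has_derivative (\<lambda>h. h *\<^sub>R d)) (at s)" "\<phi>' d = 0"
      using assms(1)[OF s] by (auto simp: has_vector_derivative_def)
    then interpret bounded_linear \<phi>' using has_derivative_bounded_linear by blast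
    have "((\<lambda>s. \<phi> (\<gamma> s)) has_derivative (\<lambda>h. \<phi>' (h *\<^sub>R d))) (at s)"
      using has_derivative_compose[OF *(2,1)] .
    then show ?thesis using *(3) by (simp add: scaleR has_derivative_at_withinI)
  qed
  then have "\<exists>c. \<forall>x\<in>{a..b}. \<phi> (\<gamma> x) = c"
    by (intro has_derivative_zero_constant) auto
  then show ?thesis using assms by auto
qed

context c2_function
begin

text \<open>Defined at critical points too, where it is just a component of the level set and not
  yet known to be a surface.\<close>

definition leaf :: "'a \<Rightarrow> 'a set" where
  "leaf x = connected_component_set {z. f z = f x} x"

lemma leaf_refl [simp]: "x \<in> leaf x"
  by (simp add: leaf_def)

lemma leaf_f: "y \<in> leaf x \<Longrightarrow> f y = f x"
  unfolding leaf_def using connected_component_subset[of "{z. f z = f x}" x] by auto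

lemma leaf_eq: "y \<in> leaf x \<Longrightarrow> leaf y = leaf x"
proof -
  assume y: "y \<in> leaf x"
  then have "{z. f z = f y} = {z. f z = f x}" using leaf_f by simp
  moreover have "connected_component_set {z. f z = f x} y = connected_component_set {z. f z = f x} x"
    using y unfolding leaf_def by (rule connected_component_eq)
  ultimately show "leaf y = leaf x" by (simp only: leaf_def)
qed

lemma leaf_connected: "connected (leaf x)"
  by (simp add: leaf_def)

lemma leaf_closed: "closed (leaf x)"
proof -
  have "closed {z. f z = f x}" using f_cont[of UNIV] by (intro closed_Collect_eq) auto
  then show ?thesis unfolding leaf_def by (rule closed_connected_component)
qed

lemma leaf_maximal: "connected C \<Longrightarrow> x \<in> C \<Longrightarrow> (\<And>z. z \<in> C \<Longrightarrow> f z = f x) \<Longrightarrow> C \<subseteq> leaf x"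
  unfolding leaf_def by (rule connected_component_maximal) blast+

text \<open>Inverse function theorem for a map that keeps the part of \<open>z\<close> orthogonal to
  \<open>G x\<close> and stores \<open>f z\<close> in the remaining coordinate. The local inverse
  parametrises the level set by the hyperplane orthogonal to \<open>G x\<close>.\<close>

lemma level_chart:
  assumes x: "G x \<noteq> 0" and W: "open W" "x \<in> W"
  obtains \<rho> \<epsilon> g g' where "\<rho> > 0" "\<epsilon> > 0" "g 0 = x"
    "\<And>w. norm w < \<rho> \<Longrightarrow> (g has_derivative g' w) (at w)"
    "\<And>w. norm w < \<rho> \<Longrightarrow> g w \<in> W"
    "\<And>w. norm w < \<rho> \<Longrightarrow> f (g w) = f x + w \<bullet> G x"
    "\<And>v. g' 0 v = v"
    "\<And>y. y \<in> ball x \<epsilon> \<Longrightarrow> f y = f x \<Longrightarrow> \<exists>w. norm w < \<rho> \<and> w \<bullet> G x = 0 \<and> g w = y"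
proof -
  define n where "n = G x"
  have n: "n \<bullet> n \<noteq> 0" using x by (simp add: n_def)
  \<comment> \<open>The correction is scaled so that \<open>\<Psi> z \<bullet> n = f z\<close>.
    Since \<open>n = G x\<close>, the derivative at \<open>x\<close> is the identity, and so is the
    derivative of the inverse at the centre.\<close>
  define \<Psi> where "\<Psi> = (\<lambda>z. z + ((f z - z \<bullet> n) / (n \<bullet> n)) *\<^sub>R n)"
  define F where "F = (\<lambda>z. id_blinfun + (blinfun_scaleR_left ((1 / (n \<bullet> n)) *\<^sub>R n) o\<^sub>L blinfun_inner_left (G z - n)))"
  have F: "blinfun_apply (F z) v = v + (((G z - n) \<bullet> v) / (n \<bullet> n)) *\<^sub>R n" for z v
    by (simp add: F_def plus_blinfun.rep_eq inner_commute)
  have \<Psi>n: "\<Psi> z \<bullet> n = f z" for z using n by (simp add: \<Psi>_def inner_add_left)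
  have D1: "(\<Psi> has_derivative blinfun_apply (F z)) (at z)" for z
    unfolding F \<Psi>_def
    apply (rule derivative_eq_intros f_deriv refl)+
    using n by (auto simp: inner_diff_left inner_diff_right inner_commute diff_divide_distrib)
  have D2: "continuous_on W F"
    unfolding F_def by (intro continuous_intros G_cont)
  have D3: "id_blinfun o\<^sub>L F x = id_blinfun"
    by (rule blinfun_eqI) (simp add: F n_def)
  show ?thesis
  proof (rule inverse_function_theorem[OF W(1) D1 D2 W(2) D3])
    fix U V g g' assume U: "open U" "U \<subseteq> W" "x \<in> U" "open V" "\<Psi> x \<in> V" "homeomorphism U V \<Psi> g"
      "\<And>y. y \<in> V \<Longrightarrow> (g has_derivative (g' y)) (at y)"
      "\<And>y. y \<in> V \<Longrightarrow> g' y = inv (blinfun_apply (F (g y)))"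
    obtain \<rho> where \<rho>: "\<rho> > 0" "ball (\<Psi> x) \<rho> \<subseteq> V" using U(4,5) open_contains_ball by blast
    have gU: "g (\<Psi> z) = z" if "z \<in> U" for z using U(6) that by (auto simp: homeomorphism_def)
    have gV: "g y \<in> U \<and> \<Psi> (g y) = y" if "y \<in> V" for y using U(6) that by (auto simp: homeomorphism_def)
    have inV: "\<Psi> x + w \<in> V" if "norm w < \<rho>" for w
      using \<rho>(2) that by (auto simp: subset_eq dist_norm)
    have "isCont \<Psi> x" unfolding \<Psi>_def using f_cont[of UNIV]
      by (intro continuous_intros) (use n in \<open>auto simp: continuous_on_eq_continuous_at\<close>)
    then obtain \<epsilon>1 where \<epsilon>1: "\<epsilon>1 > 0" "\<And>y. dist y x < \<epsilon>1 \<Longrightarrow> dist (\<Psi> y) (\<Psi> x) < \<rho>"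
      using \<rho>(1) unfolding continuous_at_eps_delta by blast
    obtain \<epsilon>2 where \<epsilon>2: "\<epsilon>2 > 0" "ball x \<epsilon>2 \<subseteq> U" using U(1,3) open_contains_ball by blast
    show ?thesis
    proof (rule that[of \<rho> "min \<epsilon>1 \<epsilon>2" "\<lambda>w. g (\<Psi> x + w)" "\<lambda>w. g' (\<Psi> x + w)"])
      show "\<rho> > 0" "min \<epsilon>1 \<epsilon>2 > 0" "g (\<Psi> x + 0) = x" using \<rho> \<epsilon>1 \<epsilon>2 gU U by auto
      fix w :: 'a assume w: "norm w < \<rho>"
      show "((\<lambda>w. g (\<Psi> x + w)) has_derivative g' (\<Psi> x + w)) (at w)"
        by (rule has_derivative_compose[of "\<lambda>w::'a. \<Psi> x + w" "\<lambda>v. v" w UNIV g, OF _ U(7)[OF inV[OF w]]])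
           (auto intro!: derivative_eq_intros)
      show "g (\<Psi> x + w) \<in> W" using gV inV w U(2) by blast
      show "f (g (\<Psi> x + w)) = f x + w \<bullet> G x"
        using gV[OF inV[OF w]] \<Psi>n by (metis inner_add_left n_def)
    next
      fix v :: 'a
      have "blinfun_apply (F x) = (\<lambda>v. v)" by (auto simp: F n_def)
      then show "g' (\<Psi> x + 0) v = v" using U(8)[of "\<Psi> x"] U gU by (simp add: inv_f_eq)
    next
      fix y assume y: "y \<in> ball x (min \<epsilon>1 \<epsilon>2)" "f y = f x"
      then have "y \<in> U" "norm (\<Psi> y - \<Psi> x) < \<rho>" using \<epsilon>1(2)[of y] \<epsilon>2 by (auto simp: dist_norm norm_minus_commute)
      moreover have "(\<Psi> y - \<Psi> x) \<bullet> G x = 0" using \<Psi>n y by (simp add: inner_diff_left n_def)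
      ultimately show "\<exists>w. norm w < \<rho> \<and> w \<bullet> G x = 0 \<and> g (\<Psi> x + w) = y"
        using gU by (intro exI[of _ "\<Psi> y - \<Psi> x"]) auto
    qed
  qed
qed

text \<open>The chart image of a segment. A leaf is only known to be connected, so conservation laws
  are first proved along these short differentiable curves and then propagated by
  connectedness.\<close>

lemma level_path:
  assumes x: "G x \<noteq> 0" and W: "open W" "x \<in> W"
  obtains \<epsilon> where "\<epsilon> > 0"
    "\<And>y. y \<in> ball x \<epsilon> \<Longrightarrow> f y = f x \<Longrightarrow> \<exists>\<gamma>. \<gamma> 0 = x \<and> \<gamma> 1 = y \<and>
       (\<forall>s\<in>{0..1::real}. \<gamma> s \<in> W \<and> f (\<gamma> s) = f x \<and> (\<exists>d. (\<gamma> has_vector_derivative d) (at s) \<and> G (\<gamma> s) \<bullet> d = 0))"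
proof (rule level_chart[OF x W])
  fix \<rho> \<epsilon> g g' assume c: "\<rho> > 0" "\<epsilon> > 0" "g 0 = x"
    "\<And>w. norm w < \<rho> \<Longrightarrow> (g has_derivative g' w) (at w)"
    "\<And>w. norm w < \<rho> \<Longrightarrow> g w \<in> W"
    "\<And>w. norm w < \<rho> \<Longrightarrow> f (g w) = f x + w \<bullet> G x"
    "\<And>v. g' 0 v = v"
    "\<And>y. y \<in> ball x \<epsilon> \<Longrightarrow> f y = f x \<Longrightarrow> \<exists>w. norm w < \<rho> \<and> w \<bullet> G x = 0 \<and> g w = y"
  show ?thesis
  proof (rule that[OF c(2)])
    fix y assume "y \<in> ball x \<epsilon>" "f y = f x"
    then obtain w where w: "norm w < \<rho>" "w \<bullet> G x = 0" "g w = y" using c(8) by blast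
    define \<gamma> where "\<gamma> = (\<lambda>s::real. g (s *\<^sub>R w))"
    have "\<gamma> s \<in> W \<and> f (\<gamma> s) = f x \<and> (\<exists>d. (\<gamma> has_vector_derivative d) (at s) \<and> G (\<gamma> s) \<bullet> d = 0)"
      if s: "s \<in> {0..1}" for s
    proof -
      have sw: "norm (s *\<^sub>R w) < \<rho>" using s w(1) by (simp add: order_le_less_trans[OF mult_left_le_one_le])
      have dg: "(\<gamma> has_vector_derivative g' (s *\<^sub>R w) w) (at s)"
      proof -
        interpret L: bounded_linear "g' (s *\<^sub>R w)" using c(4)[OF sw] has_derivative_bounded_linear by blast
        have "(\<gamma> has_derivative (\<lambda>h. g' (s *\<^sub>R w) (h *\<^sub>R w))) (at s)"
          unfolding \<gamma>_def by (rule has_derivative_compose[of "\<lambda>s. s *\<^sub>R w" "\<lambda>h. h *\<^sub>R w" s UNIV g, OF _ c(4)[OF sw]]) (auto intro!: derivative_eq_intros)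
        then show ?thesis by (simp add: has_vector_derivative_def L.scaleR)
      qed
      have "((\<lambda>s. f (\<gamma> s)) has_derivative (\<lambda>h. G (\<gamma> s) \<bullet> (h *\<^sub>R g' (s *\<^sub>R w) w))) (at s)"
        using has_derivative_compose[OF dg[unfolded has_vector_derivative_def] f_deriv] .
      moreover have "((\<lambda>s. f (\<gamma> s)) has_derivative (\<lambda>h. 0)) (at s)"
      proof (rule has_derivative_transform_within_open[OF has_derivative_const])
        show "open {s. norm (s *\<^sub>R w) < \<rho>}" by (intro open_Collect_less continuous_intros)
        show "s \<in> {s. norm (s *\<^sub>R w) < \<rho>}" using sw by simp
        show "f x = f (\<gamma> s)" if "s \<in> {s. norm (s *\<^sub>R w) < \<rho>}" for s
          using c(6)[of "s *\<^sub>R w"] that w(2) by (simp add: \<gamma>_def)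
      qed
      ultimately have "(\<lambda>h. G (\<gamma> s) \<bullet> (h *\<^sub>R g' (s *\<^sub>R w) w)) = (\<lambda>h. 0)"
        by (rule has_derivative_unique)
      from fun_cong[OF this, of 1] have "G (\<gamma> s) \<bullet> g' (s *\<^sub>R w) w = 0" by simp
      then show ?thesis using dg c(5,6)[OF sw] w(2) by (auto simp: \<gamma>_def)
    qed
    then show "\<exists>\<gamma>. \<gamma> 0 = x \<and> \<gamma> 1 = y \<and>
       (\<forall>s\<in>{0..1::real}. \<gamma> s \<in> W \<and> f (\<gamma> s) = f x \<and> (\<exists>d. (\<gamma> has_vector_derivative d) (at s) \<and> G (\<gamma> s) \<bullet> d = 0))"
      by (intro exI[of _ \<gamma>]) (auto simp: \<gamma>_def c(3) w(3))
  qed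
qed

lemma path_in_leaf:
  assumes "\<And>s. s \<in> {a..b::real} \<Longrightarrow> f (\<gamma> s) = f (\<gamma> a) \<and> isCont \<gamma> s" "s \<in> {a..b}" "t \<in> {a..b}"
  shows "\<gamma> s \<in> leaf (\<gamma> t)"
proof -
  have "continuous_on {a..b} \<gamma>"
    using assms(1) continuous_at_imp_continuous_on by blast
  then have conn: "connected (\<gamma> ` {a..b})"
    by (rule connected_continuous_image) (rule connected_Icc)
  have lev: "f z = f (\<gamma> t)" if z: "z \<in> \<gamma> ` {a..b}" for z
  proof -
    obtain u where "u \<in> {a..b}" "z = \<gamma> u" using z by blast
    then show ?thesis using assms(1)[of u] assms(1)[OF assms(3)] by metis
  qed
  have "\<gamma> ` {a..b} \<subseteq> leaf (\<gamma> t)"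
    by (rule leaf_maximal[OF conn imageI[OF assms(3)] lev])
  then show ?thesis using assms(2) by blast
qed

text \<open>The chart image of a line; since the chart has identity derivative at its centre, the
  initial velocity is exactly \<open>v\<close>. First-variation arguments on leaves start from this
  curve.\<close>

lemma level_curve:
  assumes x: "G x \<noteq> 0" and v: "v \<bullet> G x = 0" and W: "open W" "x \<in> W"
  obtains \<gamma> \<delta> where "\<delta> > 0" "\<gamma> 0 = x" "(\<gamma> has_vector_derivative v) (at 0)"
    "\<And>s. \<bar>s\<bar> < \<delta> \<Longrightarrow> \<gamma> s \<in> W \<and> \<gamma> s \<in> leaf x \<and> isCont \<gamma> s"
proof (rule level_chart[OF x W])
  fix \<rho> \<epsilon> g g' assume c: "\<rho> > 0" "\<epsilon> > 0" "g 0 = x"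
    "\<And>w. norm w < \<rho> \<Longrightarrow> (g has_derivative g' w) (at w)"
    "\<And>w. norm w < \<rho> \<Longrightarrow> g w \<in> W"
    "\<And>w. norm w < \<rho> \<Longrightarrow> f (g w) = f x + w \<bullet> G x"
    "\<And>v. g' 0 v = v"
    "\<And>y. y \<in> ball x \<epsilon> \<Longrightarrow> f y = f x \<Longrightarrow> \<exists>w. norm w < \<rho> \<and> w \<bullet> G x = 0 \<and> g w = y"
  define \<gamma> where "\<gamma> = (\<lambda>s::real. g (s *\<^sub>R v))"
  define \<delta> where "\<delta> = \<rho> / (norm v + 1)"
  have \<delta>: "\<delta> > 0" using c(1) by (simp add: \<delta>_def add_nonneg_pos)
  have small: "norm (s *\<^sub>R v) < \<rho>" if "\<bar>s\<bar> < \<delta>" for s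
  proof -
    have "\<bar>s\<bar> * norm v \<le> \<bar>s\<bar> * (norm v + 1)" by (simp add: mult_left_mono)
    also have "\<dots> < \<rho>" using that by (simp add: \<delta>_def pos_less_divide_eq add_nonneg_pos)
    finally show ?thesis by simp
  qed
  have cont: "isCont \<gamma> s" if "\<bar>s\<bar> < \<delta>" for s
    unfolding \<gamma>_def using has_derivative_continuous[OF c(4)[OF small[OF that]]]
    by (intro isCont_o2[where f="\<lambda>s. s *\<^sub>R v" and g=g]) (auto intro!: continuous_intros)
  have lev: "f (\<gamma> s) = f x" if "\<bar>s\<bar> < \<delta>" for s using c(6)[OF small[OF that]] v by (simp add: \<gamma>_def)
  have "\<gamma> s \<in> leaf x" if s: "\<bar>s\<bar> < \<delta>" for s
  proof -
    have "\<gamma> s \<in> leaf (\<gamma> 0)"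
    proof (rule path_in_leaf[where \<gamma>=\<gamma> and s=s and t=0 and a="-\<bar>s\<bar>" and b="\<bar>s\<bar>"])
      fix u assume "u \<in> {-\<bar>s\<bar>..\<bar>s\<bar>}"
      then have "\<bar>u\<bar> < \<delta>" using s by auto
      moreover have "\<bar>-\<bar>s\<bar>\<bar> < \<delta>" using s by auto
      ultimately show "f (\<gamma> u) = f (\<gamma> (-\<bar>s\<bar>)) \<and> isCont \<gamma> u" using lev cont by metis
    qed auto
    then show ?thesis by (simp add: \<gamma>_def c(3))
  qed
  moreover have "(\<gamma> has_vector_derivative v) (at 0)"
  proof -
    have d0: "(g has_derivative g' 0) (at (0 *\<^sub>R v))" using c(4)[of 0] c(1) by simp
    have "(\<gamma> has_derivative (\<lambda>h. g' 0 (h *\<^sub>R v))) (at 0)"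
      unfolding \<gamma>_def by (rule has_derivative_compose[of "\<lambda>s. s *\<^sub>R v" "\<lambda>h. h *\<^sub>R v" 0 UNIV g, OF _ d0]) (auto intro!: derivative_eq_intros)
    then show ?thesis by (simp add: has_vector_derivative_def c(7))
  qed
  moreover have "\<gamma> 0 = x" "\<And>s. \<bar>s\<bar> < \<delta> \<Longrightarrow> \<gamma> s \<in> W" using c(3,5) small by (auto simp: \<gamma>_def)
  ultimately show ?thesis using cont by (intro that[OF \<delta>, of \<gamma>]) auto
qed

end

section \<open>Normal lines of a metric function\<close>

locale c2_metric_function = c2_function +
  assumes metric: "y \<in> leaf x \<Longrightarrow> norm (G y) = norm (G x)"
begin

text \<open>At a critical point \<open>sgn\<close> gives \<open>0\<close>, so \<open>ray x\<close>
  is constant there; statements about normals therefore carry \<open>G x \<noteq> 0\<close>.\<close>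

definition N :: "'a \<Rightarrow> 'a" where
  "N x = sgn (G x)"

text \<open>The shape operator, written through the Hessian so that it can be seen to be continuous;
  \<open>N_deriv\<close> identifies it as the derivative of \<open>N\<close>. It acts on the whole
  space and kills \<open>N x\<close> at regular points.\<close>

definition A :: "'a \<Rightarrow> 'a \<Rightarrow> 'a" where
  "A x v = (1 / norm (G x)) *\<^sub>R (H x v - (H x v \<bullet> N x) *\<^sub>R N x)"

definition ray :: "'a \<Rightarrow> real \<Rightarrow> 'a" where
  "ray x t = x + t *\<^sub>R N x"

lemma norm_N [simp]: "G x \<noteq> 0 \<Longrightarrow> norm (N x) = 1"
  by (simp add: N_def norm_sgn)

lemma N_N [simp]: "G x \<noteq> 0 \<Longrightarrow> N x \<bullet> N x = 1"
  using norm_N norm_eq_1 by blast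

lemma G_eq_N: "G x = norm (G x) *\<^sub>R N x"
  by (cases "G x = 0") (auto simp: N_def sgn_div_norm)

lemma perp_N_iff: "G x \<noteq> 0 \<Longrightarrow> v \<bullet> N x = 0 \<longleftrightarrow> v \<bullet> G x = 0"
  by (simp add: N_def sgn_div_norm)

lemma N_ne_0 [simp]: "G x \<noteq> 0 \<Longrightarrow> N x \<noteq> 0"
  by (simp add: N_def sgn_zero_iff)

lemma open_reg: "open {x. G x \<noteq> 0}"
  by (intro open_Collect_neq G_cont continuous_on_const)

lemma leaf_reg: "y \<in> leaf x \<Longrightarrow> G y \<noteq> 0 \<longleftrightarrow> G x \<noteq> 0"
  by (metis metric norm_eq_zero)

text \<open>The metric hypothesis in infinitesimal form: \<open>G \<bullet> G\<close> is constant
  along a level curve with velocity \<open>v\<close>, and its derivative there is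
  \<open>2 * (H x v \<bullet> G x)\<close>.\<close>

lemma H_tangential:
  assumes x: "G x \<noteq> 0" and v: "v \<bullet> G x = 0"
  shows "H x v \<bullet> G x = 0"
proof (rule level_curve[OF x v open_UNIV UNIV_I])
  fix \<delta> \<gamma> assume \<delta>: "(0::real) < \<delta>" and \<gamma>: "\<gamma> 0 = x" "(\<gamma> has_vector_derivative v) (at 0)"
    "\<And>s. \<bar>s\<bar> < \<delta> \<Longrightarrow> \<gamma> s \<in> UNIV \<and> \<gamma> s \<in> leaf x \<and> isCont \<gamma> s"
  have d: "((\<lambda>s. G (\<gamma> s)) has_derivative (\<lambda>h. H x (h *\<^sub>R v))) (at 0)"
    using has_derivative_compose[OF \<gamma>(2)[unfolded has_vector_derivative_def] G_deriv] \<gamma>(1) by simp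
  have "((\<lambda>s. G (\<gamma> s) \<bullet> G (\<gamma> s)) has_derivative (\<lambda>h. G (\<gamma> 0) \<bullet> H x (h *\<^sub>R v) + H x (h *\<^sub>R v) \<bullet> G (\<gamma> 0))) (at 0)"
    by (rule has_derivative_inner[OF d d])
  moreover have "((\<lambda>s. G (\<gamma> s) \<bullet> G (\<gamma> s)) has_derivative (\<lambda>h. 0)) (at 0)"
  proof (rule has_derivative_transform_within_open[OF has_derivative_const])
    show "open {-\<delta><..<\<delta>}" "0 \<in> {-\<delta><..<\<delta>}" using \<delta> by auto
    show "G x \<bullet> G x = G (\<gamma> s) \<bullet> G (\<gamma> s)" if "s \<in> {-\<delta><..<\<delta>}" for s
      using metric[of "\<gamma> s" x] \<gamma>(3)[of s] that by (simp add: norm_eq abs_less_iff)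
  qed
  ultimately have "(\<lambda>h. G (\<gamma> 0) \<bullet> H x (h *\<^sub>R v) + H x (h *\<^sub>R v) \<bullet> G (\<gamma> 0)) = (\<lambda>h. 0)"
    by (rule has_derivative_unique)
  from fun_cong[OF this, of 1] show ?thesis using \<gamma>(1) by (simp add: inner_commute)
qed

text \<open>For tangential \<open>w\<close>, symmetry gives
  \<open>w \<bullet> H x (N x) = H x w \<bullet> N x = 0\<close>. The normal is thus an eigenvector
  of the Hessian, which is why \<open>N\<close> does not turn in its own direction.\<close>

lemma H_N: 
  assumes x: "G x \<noteq> 0"
  shows "H x (N x) = (H x (N x) \<bullet> N x) *\<^sub>R N x"
proof -
  define w where "w = H x (N x) - (H x (N x) \<bullet> N x) *\<^sub>R N x"
  have w: "w \<bullet> N x = 0" using x by (simp add: w_def inner_diff_left)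
  then have "w \<bullet> G x = 0" using x perp_N_iff by blast
  then have "H x w \<bullet> N x = 0" using H_tangential[OF x] x perp_N_iff by blast
  then have "w \<bullet> H x (N x) = 0" by (simp add: H_symmetric)
  then have "w \<bullet> w = 0" using w by (subst (2) w_def) (simp add: inner_diff_right)
  then show ?thesis by (simp add: w_def)
qed

lemma A_linear: "bounded_linear (A x)"
proof -
  interpret bounded_linear "H x" by (rule H_linear)
  show ?thesis unfolding A_def
    by (intro bounded_linear_const_scaleR bounded_linear_sub bounded_linear_scaleR_const bounded_linear_inner_left_comp bounded_linear_axioms)
qed

lemma A_simps:
  "A x (u + v) = A x u + A x v" "A x (u - v) = A x u - A x v" "A x (c *\<^sub>R v) = c *\<^sub>R A x v"
  "A x 0 = 0" "A x (- v) = - A x v"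
  by (simp_all add: A_def H_simps inner_simps algebra_simps scaleR_diff_right)

lemma A_perp: "G x \<noteq> 0 \<Longrightarrow> A x v \<bullet> N x = 0"
  by (simp add: A_def inner_diff_left)

lemma A_N: "G x \<noteq> 0 \<Longrightarrow> A x (N x) = 0"
  using H_N by (simp add: A_def)

lemma A_symmetric:
  assumes "G x \<noteq> 0" shows "A x u \<bullet> v = u \<bullet> A x v"
proof -
  define \<mu> where "\<mu> = H x (N x) \<bullet> N x"
  have HN: "H x w \<bullet> N x = \<mu> * (w \<bullet> N x)" for w
    using H_N[OF assms] by (metis H_symmetric inner_scaleR_right \<mu>_def)
  have "(H x u - (H x u \<bullet> N x) *\<^sub>R N x) \<bullet> v = H x u \<bullet> v - \<mu> * (u \<bullet> N x) * (v \<bullet> N x)"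
    unfolding HN inner_diff_left inner_scaleR_left inner_commute[of "N x" v] by simp
  also have "\<dots> = u \<bullet> (H x v - (H x v \<bullet> N x) *\<^sub>R N x)"
    by (simp add: HN inner_diff_right H_symmetric[of x u v])
  finally have "(H x u - (H x u \<bullet> N x) *\<^sub>R N x) \<bullet> v = u \<bullet> (H x v - (H x v \<bullet> N x) *\<^sub>R N x)" .
  then show ?thesis by (simp add: A_def)
qed

lemma N_deriv: 
  assumes "G x \<noteq> 0" shows "(N has_derivative A x) (at x)"
proof -
  have D1: "((\<lambda>x. norm (G x)) has_derivative (\<lambda>v. H x v \<bullet> N x)) (at x)"
    unfolding N_def by (rule has_derivative_compose[OF G_deriv has_derivative_norm[OF assms]])
  have D2: "((\<lambda>x. inverse (norm (G x))) has_derivative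
      (\<lambda>v. - (inverse (norm (G x)) * (H x v \<bullet> N x) * inverse (norm (G x))))) (at x)"
    using assms by (intro Deriv.has_derivative_inverse[OF _ D1]) auto
  have "N = (\<lambda>x. inverse (norm (G x)) *\<^sub>R G x)" by (auto simp: N_def sgn_div_norm)
  moreover have "(\<lambda>v. inverse (norm (G x)) *\<^sub>R H x v +
      (- (inverse (norm (G x)) * (H x v \<bullet> N x) * inverse (norm (G x)))) *\<^sub>R G x) = A x"
    by (rule ext) (simp add: A_def N_def sgn_div_norm divide_inverse scaleR_diff_right)
  ultimately show ?thesis using has_derivative_scaleR[OF D2 G_deriv] by simp
qed

lemma N_isCont: "G x \<noteq> 0 \<Longrightarrow> isCont N x"
  using N_deriv has_derivative_continuous by blast

lemma A_cont: "continuous_on {x. G x \<noteq> 0} (\<lambda>x. A x v)"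
proof -
  have "continuous_on {x. G x \<noteq> 0} N"
    using N_isCont by (auto intro: continuous_at_imp_continuous_on)
  then show ?thesis unfolding A_def
    by (intro continuous_intros continuous_on_subset[OF H_cont] G_cont) auto
qed

lemma ray_deriv: "G x \<noteq> 0 \<Longrightarrow> ((\<lambda>z. ray z t) has_derivative (\<lambda>v. v + t *\<^sub>R A x v)) (at x)"
  unfolding ray_def by (rule derivative_eq_intros N_deriv refl | assumption)+ simp

lemma ray_isCont: "G x \<noteq> 0 \<Longrightarrow> isCont (\<lambda>z. ray z t) x"
  using ray_deriv has_derivative_continuous by blast

end

section \<open>Straightness of the normal lines\<close>

lemma gronwall_zero:
  fixes \<phi> :: "real \<Rightarrow> real"
  assumes "\<And>u. 0 \<le> u \<Longrightarrow> u \<le> 1 \<Longrightarrow> (\<phi> has_real_derivative \<phi>' u) (at u)"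
    and "\<And>u. 0 \<le> u \<Longrightarrow> u \<le> 1 \<Longrightarrow> \<phi>' u \<le> K * \<phi> u" "\<phi> 0 = 0" "0 \<le> u" "u \<le> 1"
  shows "\<phi> u \<le> 0"
proof -
  have "\<phi> u * exp (- K * u) \<le> \<phi> 0 * exp (- K * 0)"
  proof (rule DERIV_nonpos_imp_nonincreasing[OF assms(4)])
    fix v assume v: "0 \<le> v" "v \<le> u"
    then have "((\<lambda>u. \<phi> u * exp (- K * u)) has_real_derivative (\<phi>' v - K * \<phi> v) * exp (- K * v)) (at v)"
      using assms(5) by (auto intro!: derivative_eq_intros assms(1) simp: algebra_simps)
    moreover have "(\<phi>' v - K * \<phi> v) * exp (- K * v) \<le> 0"
      using assms(2)[of v] v assms(5) by (intro mult_nonpos_nonneg) auto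
    ultimately show "\<exists>y. ((\<lambda>u. \<phi> u * exp (- K * u)) has_real_derivative y) (at v) \<and> y \<le> 0" by blast
  qed
  then show ?thesis using assms(3) by (simp add: mult_le_0_iff)
qed

context c2_metric_function
begin

text \<open>Supplies the constant for the Gronwall estimate along a regular segment.\<close>

lemma A_bound_on_compact:
  assumes "compact S" "\<And>x. x \<in> S \<Longrightarrow> G x \<noteq> 0"
  shows "\<exists>C. \<forall>x\<in>S. \<forall>v. norm (A x v) \<le> C * norm v"
proof -
  have "continuous_on S (\<lambda>x. A x b)" for b
    using A_cont continuous_on_subset assms(2) by blast
  then have "continuous_on S (\<lambda>x. \<Sum>b\<in>Basis. norm (A x b))"
    by (intro continuous_intros)
  then have "compact ((\<lambda>x. \<Sum>b\<in>Basis. norm (A x b)) ` S)"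
    using assms(1) compact_continuous_image by blast
  then have "bounded ((\<lambda>x. \<Sum>b\<in>Basis. norm (A x b)) ` S)" by (rule compact_imp_bounded)
  then obtain C where "\<forall>r\<in>(\<lambda>x. \<Sum>b\<in>Basis. norm (A x b)) ` S. norm r \<le> C" unfolding bounded_iff by blast
  then have C: "(\<Sum>b\<in>Basis. norm (A x b)) \<le> C" if "x \<in> S" for x
    using that by fastforce
  have "norm (A x v) \<le> C * norm v" if "x \<in> S" for x v
  proof -
    have "A x v = A x (\<Sum>b\<in>Basis. (v \<bullet> b) *\<^sub>R b)" by (simp add: euclidean_representation)
    also have "\<dots> = (\<Sum>b\<in>Basis. A x ((v \<bullet> b) *\<^sub>R b))"
      by (rule linear_sum[OF bounded_linear.linear[OF A_linear]])
    also have "\<dots> = (\<Sum>b\<in>Basis. (v \<bullet> b) *\<^sub>R A x b)" by (simp only: A_simps(3))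
    finally have "A x v = (\<Sum>b\<in>Basis. (v \<bullet> b) *\<^sub>R A x b)" .
    then have "norm (A x v) \<le> (\<Sum>b\<in>Basis. norm ((v \<bullet> b) *\<^sub>R A x b))" by (metis norm_sum)
    also have "\<dots> \<le> (\<Sum>b\<in>Basis. norm v * norm (A x b))"
      by (intro sum_mono) (auto intro!: mult_right_mono Basis_le_norm)
    also have "\<dots> = norm v * (\<Sum>b\<in>Basis. norm (A x b))" by (simp add: sum_distrib_left)
    also have "\<dots> \<le> norm v * C" using C[OF that] by (intro mult_left_mono) auto
    finally show ?thesis by (simp add: mult.commute)
  qed
  then show ?thesis by blast
qed

text \<open>On the candidate line the error \<open>e = N (c u) - N x\<close> solves a homogeneous
  linear equation: \<open>A (c u)\<close> kills \<open>N (c u)\<close>, so applying it to the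
  velocity \<open>t *\<^sub>R N x\<close> gives \<open>- t *\<^sub>R A (c u) (e u)\<close>. As
  \<open>e 0 = 0\<close>, it vanishes. Working on the given line avoids constructing integral curves
  of \<open>N\<close>. Scaling time to \<open>0..1\<close> treats both signs of \<open>t\<close> at
  once.\<close>

lemma straight_unit:
  assumes reg: "\<And>u. 0 \<le> u \<Longrightarrow> u \<le> 1 \<Longrightarrow> G (ray x (u * t)) \<noteq> 0"
    and u: "0 \<le> u" "u \<le> 1"
  shows "N (ray x (u * t)) = N x"
proof -
  define c where "c = (\<lambda>u. ray x (u * t))"
  have x: "G x \<noteq> 0" using reg[of 0] by (simp add: ray_def)
  have creg: "\<And>z. z \<in> c ` {0..1} \<Longrightarrow> G z \<noteq> 0" using reg by (auto simp: c_def)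
  have "compact (c ` {0..1})"
    unfolding c_def ray_def by (intro compact_continuous_image continuous_intros) auto
  from A_bound_on_compact[OF this creg]
  obtain C where C: "\<forall>z\<in>c ` {0..1}. \<forall>v. norm (A z v) \<le> C * norm v" ..
  define e where "e = (\<lambda>u. N (c u) - N x)"
  have ed: "(e has_derivative (\<lambda>h. h *\<^sub>R (- t *\<^sub>R A (c u) (e u)))) (at u)" if "0 \<le> u" "u \<le> 1" for u
  proof -
    have r: "G (c u) \<noteq> 0" using reg that by (simp add: c_def)
    have "(c has_derivative (\<lambda>h. h *\<^sub>R (t *\<^sub>R N x))) (at u)"
      unfolding c_def ray_def by (auto intro!: derivative_eq_intros)
    from has_derivative_compose[OF this N_deriv[OF r]]
    have "((\<lambda>u. N (c u)) has_derivative (\<lambda>h. A (c u) (h *\<^sub>R (t *\<^sub>R N x)))) (at u)" .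
    moreover have "A (c u) (h *\<^sub>R (t *\<^sub>R N x)) = h *\<^sub>R (- t *\<^sub>R A (c u) (e u))" for h
      using A_N[OF r] by (simp add: e_def A_simps)
    ultimately show ?thesis unfolding e_def by (auto intro!: derivative_eq_intros)
  qed
  define \<phi> where "\<phi> = (\<lambda>u. e u \<bullet> e u)"
  define \<phi>' where "\<phi>' = (\<lambda>u. 2 * (e u \<bullet> (- t *\<^sub>R A (c u) (e u))))"
  have "\<phi> u \<le> 0"
  proof (rule gronwall_zero[of \<phi> \<phi>' "2 * \<bar>t\<bar> * C"])
    fix u :: real assume u: "0 \<le> u" "u \<le> 1"
    have "(\<phi> has_derivative (\<lambda>h. e u \<bullet> (h *\<^sub>R (- t *\<^sub>R A (c u) (e u))) + (h *\<^sub>R (- t *\<^sub>R A (c u) (e u))) \<bullet> e u)) (at u)"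
      unfolding \<phi>_def by (rule has_derivative_inner[OF ed[OF u] ed[OF u]])
    then show "(\<phi> has_real_derivative \<phi>' u) (at u)"
      by (rule has_derivative_imp_has_field_derivative) (simp add: \<phi>'_def inner_commute)
    have "\<phi>' u \<le> 2 * (norm (e u) * norm (- t *\<^sub>R A (c u) (e u)))"
      unfolding \<phi>'_def by (intro mult_left_mono norm_cauchy_schwarz) auto
    also have "\<dots> = 2 * \<bar>t\<bar> * (norm (e u) * norm (A (c u) (e u)))" by simp
    also have "\<dots> \<le> 2 * \<bar>t\<bar> * (norm (e u) * (C * norm (e u)))"
      using C u by (intro mult_left_mono) auto
    also have "\<dots> = 2 * \<bar>t\<bar> * C * \<phi> u" by (simp add: \<phi>_def dot_square_norm power2_eq_square)
    finally show "\<phi>' u \<le> 2 * \<bar>t\<bar> * C * \<phi> u" .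
  next
    show "\<phi> 0 = 0" by (simp add: \<phi>_def e_def c_def ray_def)
  qed (use u in auto)
  then have "e u = 0" unfolding \<phi>_def using inner_ge_zero[of "e u"] by (metis antisym inner_eq_zero_iff)
  then show ?thesis by (simp add: e_def c_def)
qed

lemma straight:
  assumes reg: "\<And>u. u \<in> closed_segment 0 t \<Longrightarrow> G (ray x u) \<noteq> 0"
    and u: "u \<in> closed_segment 0 t"
  shows "N (ray x u) = N x"
proof -
  obtain w where w: "0 \<le> w" "w \<le> 1" "u = w * t" using u by (auto simp: in_segment)
  show ?thesis unfolding w(3)
    by (rule straight_unit[OF _ w(1,2)]) (auto intro!: reg simp: in_segment)
qed

end

section \<open>Transport along normal lines\<close>

text \<open>The clopen argument in epsilon form, used on leaves, where no global curves are
  available, and on the time axis of a normal line.\<close>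

lemma connected_clopen_induct:
  fixes S :: "'a::metric_space set"
  assumes S: "connected S" and x: "x \<in> S" "P x" and y: "y \<in> S"
    and op: "\<And>y. y \<in> S \<Longrightarrow> P y \<Longrightarrow> \<exists>\<epsilon>>0. \<forall>z\<in>S. dist z y < \<epsilon> \<longrightarrow> P z"
    and cl: "\<And>y. y \<in> S \<Longrightarrow> (\<And>\<epsilon>. \<epsilon> > 0 \<Longrightarrow> \<exists>z\<in>S. P z \<and> dist z y < \<epsilon>) \<Longrightarrow> P y"
  shows "P y"
proof -
  let ?T = "{y \<in> S. P y}"
  have "openin (top_of_set S) ?T"
    unfolding openin_euclidean_subtopology_iff using op by fastforce
  moreover have "openin (top_of_set S) (S - ?T)"
    unfolding openin_euclidean_subtopology_iff using cl by fastforce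
  then have "closedin (top_of_set S) ?T"
    unfolding closedin_def by auto
  ultimately have "?T = {} \<or> ?T = S" using S connected_clopen by blast
  then show ?thesis using x y by blast
qed

context c2_metric_function
begin

text \<open>The derivative of \<open>ray z u\<close> in \<open>z\<close> sends a tangential
  \<open>d\<close> to \<open>d + u *\<^sub>R A z d\<close>, which is again orthogonal to
  \<open>N z\<close>. If the normal at \<open>ray z u\<close> is parallel to \<open>N z\<close>, the
  derivative of \<open>f (ray z u)\<close> vanishes, and so does that of the sign
  \<open>N (ray z u) \<bullet> N z\<close>. The set \<open>J\<close> of times is kept abstract: it
  is a whole segment as long as critical points cannot be crossed, and a single time
  afterwards.\<close>

lemma transport_local:
  assumes SJ: "\<forall>z. G z \<noteq> 0 \<and> (\<forall>u\<in>J. G (ray z u) \<noteq> 0) \<longrightarrow> (\<forall>u\<in>J. N (ray z u) = N z \<or> N (ray z u) = - N z)"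
    and Wo: "open W" and WJ: "W \<subseteq> {z. G z \<noteq> 0 \<and> (\<forall>u\<in>J. G (ray z u) \<noteq> 0)}"
    and x: "x \<in> W"
  shows "\<exists>\<epsilon>>0. \<forall>y. dist y x < \<epsilon> \<and> f y = f x \<longrightarrow>
    (\<forall>u\<in>J. G (ray y u) \<noteq> 0 \<and> ray y u \<in> leaf (ray x u) \<and> N (ray y u) \<bullet> N y = N (ray x u) \<bullet> N x)"
proof -
  have W: "open W" "\<And>z. z \<in> W \<Longrightarrow> G z \<noteq> 0" "\<And>z u. z \<in> W \<Longrightarrow> u \<in> J \<Longrightarrow> G (ray z u) \<noteq> 0"
    using Wo WJ by blast+
  show ?thesis
  proof (rule level_path[OF W(2)[OF x] W(1) x])
    fix \<epsilon> :: real
    assume e: "\<epsilon> > 0" "\<And>y. y \<in> ball x \<epsilon> \<Longrightarrow> f y = f x \<Longrightarrow> \<exists>\<gamma>. \<gamma> 0 = x \<and> \<gamma> 1 = y \<and>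
         (\<forall>s\<in>{0..1::real}. \<gamma> s \<in> W \<and> f (\<gamma> s) = f x \<and> (\<exists>d. (\<gamma> has_vector_derivative d) (at s) \<and> G (\<gamma> s) \<bullet> d = 0))"
    show ?thesis
    proof (intro exI[of _ \<epsilon>] conjI[OF e(1)] allI impI ballI)
      fix y u assume "dist y x < \<epsilon> \<and> f y = f x" and u: "u \<in> J"
      then have "y \<in> ball x \<epsilon>" "f y = f x" by (auto simp: dist_commute)
      from e(2)[OF this] obtain \<gamma> where \<gamma>01: "\<gamma> 0 = x" "\<gamma> 1 = y"
         and \<gamma>': "\<forall>s\<in>{0..1::real}. \<gamma> s \<in> W \<and> f (\<gamma> s) = f x \<and> (\<exists>d. (\<gamma> has_vector_derivative d) (at s) \<and> G (\<gamma> s) \<bullet> d = 0)"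
        by (elim exE conjE)
      note \<gamma> = \<gamma>01 \<gamma>'[rule_format]
      have "y \<in> W" using \<gamma>'[rule_format, of 1] \<gamma>01 by simp
      then have G1: "G (ray y u) \<noteq> 0" using W(3) u by blast
      have const: "f (ray (\<gamma> s) u) = f (ray (\<gamma> 0) u)" if s: "s \<in> {0..1}" for s
      proof (rule constant_along_path[where \<gamma>=\<gamma> and \<phi>="\<lambda>z. f (ray z u)", OF _ s])
        fix s :: real assume "s \<in> {0..1}"
        from \<gamma>(3)[OF this] obtain d where d: "\<gamma> s \<in> W" "(\<gamma> has_vector_derivative d) (at s)" "G (\<gamma> s) \<bullet> d = 0" by blast
        let ?z = "\<gamma> s"
        have z: "G ?z \<noteq> 0" and r: "G (ray ?z u) \<noteq> 0" using W d(1) u by blast+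
        have "N (ray ?z u) = N ?z \<or> N (ray ?z u) = - N ?z"
          using SJ z W(3)[OF d(1)] u by blast
        moreover have "N ?z \<bullet> d = 0" using perp_N_iff[OF z, of d] d(3) by (simp add: inner_commute)
        ultimately have "N (ray ?z u) \<bullet> (d + u *\<^sub>R A ?z d) = 0"
          using A_perp[OF z, of d] by (auto simp: inner_add_right inner_commute)
        then have "G (ray ?z u) \<bullet> (d + u *\<^sub>R A ?z d) = 0" by (subst G_eq_N) simp
        moreover have "((\<lambda>z. f (ray z u)) has_derivative (\<lambda>v. G (ray ?z u) \<bullet> (v + u *\<^sub>R A ?z v))) (at ?z)"
          by (rule has_derivative_compose[OF ray_deriv[OF z] f_deriv])
        ultimately show "\<exists>\<phi>' d. ((\<lambda>z. f (ray z u)) has_derivative \<phi>') (at ?z) \<and> (\<gamma> has_vector_derivative d) (at s) \<and> \<phi>' d = 0"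
          using d(2) by blast
      qed auto
      have cont: "isCont (\<lambda>s. ray (\<gamma> s) u) s" if s: "s \<in> {0..1}" for s
      proof -
        from \<gamma>(3)[OF s] obtain d where d: "\<gamma> s \<in> W" "(\<gamma> has_vector_derivative d) (at s)" by blast
        show ?thesis using isCont_o2[OF has_vector_derivative_continuous[OF d(2)] ray_isCont] W(2)[OF d(1)] by blast
      qed
      have "(\<lambda>s. ray (\<gamma> s) u) 1 \<in> leaf ((\<lambda>s. ray (\<gamma> s) u) 0)"
        by (rule path_in_leaf[where a=0 and b=1 and s=1 and t=0 and \<gamma>="\<lambda>s. ray (\<gamma> s) u"]) (use const cont in blast, auto)
      then have L: "ray y u \<in> leaf (ray x u)" using \<gamma>01 by simp
      have "(\<lambda>z. N (ray z u) \<bullet> N z) (\<gamma> 1) = (\<lambda>z. N (ray z u) \<bullet> N z) (\<gamma> 0)"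
      proof (rule constant_along_path[where \<gamma>=\<gamma> and \<phi>="\<lambda>z. N (ray z u) \<bullet> N z" and a=0 and b=1])
        fix s :: real assume "s \<in> {0..1}"
        from \<gamma>(3)[OF this] obtain d where d: "\<gamma> s \<in> W" "(\<gamma> has_vector_derivative d) (at s)" "G (\<gamma> s) \<bullet> d = 0" by blast
        let ?z = "\<gamma> s"
        have z: "G ?z \<noteq> 0" and r: "G (ray ?z u) \<noteq> 0" using W d(1) u by blast+
        have eq: "N (ray ?z u) = N ?z \<or> N (ray ?z u) = - N ?z"
          using SJ z W(3)[OF d(1)] u by blast
        have D: "((\<lambda>z. N (ray z u) \<bullet> N z) has_derivative
            (\<lambda>v. N (ray ?z u) \<bullet> A ?z v + A (ray ?z u) (v + u *\<^sub>R A ?z v) \<bullet> N ?z)) (at ?z)"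
          by (rule has_derivative_inner[OF has_derivative_compose[OF ray_deriv[OF z] N_deriv[OF r]] N_deriv[OF z]])
        have a: "A (ray ?z u) w \<bullet> N ?z = 0" for w
          using A_perp[OF r, of w] eq by (metis add.inverse_inverse inner_minus_right neg_equal_0_iff_equal)
        have b: "N (ray ?z u) \<bullet> A ?z d = 0"
          using A_perp[OF z, of d] eq by (auto simp: inner_commute)
        show "\<exists>\<phi>' d. ((\<lambda>z. N (ray z u) \<bullet> N z) has_derivative \<phi>') (at ?z) \<and> (\<gamma> has_vector_derivative d) (at s) \<and> \<phi>' d = 0"
          using D d(2) a b by (intro exI[of _ "\<lambda>v. N (ray ?z u) \<bullet> A ?z v + A (ray ?z u) (v + u *\<^sub>R A ?z v) \<bullet> N ?z"] exI[of _ d]) auto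
      qed auto
      then show "G (ray y u) \<noteq> 0 \<and> ray y u \<in> leaf (ray x u) \<and> N (ray y u) \<bullet> N y = N (ray x u) \<bullet> N x"
        using \<gamma>01 G1 L by simp
    qed
  qed
qed

lemma open_ray_reg:
  assumes "compact J"
  shows "open {z. G z \<noteq> 0 \<and> (\<forall>u\<in>J. G (ray z u) \<noteq> 0)}"
proof (subst open_subopen, rule ballI)
  fix x assume x: "x \<in> {z. G z \<noteq> 0 \<and> (\<forall>u\<in>J. G (ray z u) \<noteq> 0)}"
  let ?R = "{z. G z \<noteq> 0}"
  have cN: "continuous_on ?R N" using N_isCont by (auto intro: continuous_at_imp_continuous_on)
  have "continuous_on (?R \<times> UNIV) (\<lambda>p. ray (fst p) (snd p))" unfolding ray_def
    by (intro continuous_intros continuous_on_compose2[OF cN]) auto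
  then have "continuous_on (?R \<times> UNIV) (\<lambda>p. G (ray (fst p) (snd p)))"
    by (intro continuous_on_compose2[OF G_cont[of UNIV]]) auto
  then have "open ((?R \<times> UNIV) \<inter> (\<lambda>p. G (ray (fst p) (snd p))) -` (- {0}))"
    by (intro continuous_open_preimage open_Times open_reg open_UNIV) auto
  moreover have "{x} \<times> J \<subseteq> (?R \<times> UNIV) \<inter> (\<lambda>p. G (ray (fst p) (snd p))) -` (- {0})" using x by auto
  ultimately have ex: "\<exists>X0. x \<in> X0 \<and> open X0 \<and> X0 \<times> J \<subseteq> (?R \<times> UNIV) \<inter> (\<lambda>p. G (ray (fst p) (snd p))) -` (- {0})"
    by (rule Elementary_Topology.tube_lemma[OF assms])
  from ex obtain X where X: "x \<in> X" "open X" "X \<times> J \<subseteq> (?R \<times> UNIV) \<inter> (\<lambda>p. G (ray (fst p) (snd p))) -` (- {0})"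
    by blast
  show "\<exists>T. open T \<and> x \<in> T \<and> T \<subseteq> {z. G z \<noteq> 0 \<and> (\<forall>u\<in>J. G (ray z u) \<noteq> 0)}"
    by (rule exI[of _ "X \<inter> ?R"]) (use X x open_reg in auto)
qed

text \<open>Openness along the leaf is the local statement. Closedness comes from the metric
  property: \<open>norm (G (ray y u))\<close> equals \<open>norm (G (ray x u))\<close> wherever
  transport works, so it cannot tend to zero at a limit point.\<close>

lemma transport:
  assumes J: "compact J"
    and SJ: "\<forall>z. G z \<noteq> 0 \<and> (\<forall>u\<in>J. G (ray z u) \<noteq> 0) \<longrightarrow> (\<forall>u\<in>J. N (ray z u) = N z \<or> N (ray z u) = - N z)"
    and x: "G x \<noteq> 0" "\<And>u. u \<in> J \<Longrightarrow> G (ray x u) \<noteq> 0" and y: "y \<in> leaf x"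
  shows "\<forall>u\<in>J. G (ray y u) \<noteq> 0 \<and> ray y u \<in> leaf (ray x u) \<and> N (ray y u) \<bullet> N y = N (ray x u) \<bullet> N x"
proof -
  define W where "W = {z. G z \<noteq> 0 \<and> (\<forall>u\<in>J. G (ray z u) \<noteq> 0)}"
  have W: "open W" "\<And>z. z \<in> W \<Longrightarrow> G z \<noteq> 0" "\<And>z u. z \<in> W \<Longrightarrow> u \<in> J \<Longrightarrow> G (ray z u) \<noteq> 0"
    using open_ray_reg[OF J] by (auto simp: W_def)
  have WJ: "W \<subseteq> {z. G z \<noteq> 0 \<and> (\<forall>u\<in>J. G (ray z u) \<noteq> 0)}" by (simp add: W_def)
  define P where "P = (\<lambda>y. \<forall>u\<in>J. G (ray y u) \<noteq> 0 \<and> ray y u \<in> leaf (ray x u) \<and> N (ray y u) \<bullet> N y = N (ray x u) \<bullet> N x)"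
  have PW: "z \<in> W" if "z \<in> leaf x" "P z" for z using that leaf_reg[of z x] x by (auto simp: P_def W_def)
  have "P y"
  proof (rule connected_clopen_induct[OF leaf_connected[of x] leaf_refl _ y])
    show "P x" using x by (simp add: P_def)
  next
    fix z assume z: "z \<in> leaf x" "P z"
    from transport_local[OF SJ W(1) WJ PW[OF z]] obtain \<epsilon> where e0: "\<epsilon> > 0" "\<forall>y. dist y z < \<epsilon> \<and> f y = f z \<longrightarrow>
      (\<forall>u\<in>J. G (ray y u) \<noteq> 0 \<and> ray y u \<in> leaf (ray z u) \<and> N (ray y u) \<bullet> N y = N (ray z u) \<bullet> N z)"
      by (elim exE conjE)
    note e = e0(1) e0(2)[rule_format, OF conjI]
    show "\<exists>\<epsilon>>0. \<forall>y\<in>leaf x. dist y z < \<epsilon> \<longrightarrow> P y"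
    proof (intro exI[of _ \<epsilon>] conjI ballI impI e(1))
      fix y assume y: "y \<in> leaf x" "dist y z < \<epsilon>"
      then have feq: "f y = f z" using leaf_f z(1) by metis
      have loc: "G (ray y u) \<noteq> 0 \<and> ray y u \<in> leaf (ray z u) \<and> N (ray y u) \<bullet> N y = N (ray z u) \<bullet> N z"
        if "u \<in> J" for u using e(2)[OF y(2) feq that] .
      then show "P y" using z(2) leaf_eq unfolding P_def by metis
    qed
  next
    fix z assume z: "z \<in> leaf x" and cl: "\<And>\<epsilon>. \<epsilon> > 0 \<Longrightarrow> \<exists>y\<in>leaf x. P y \<and> dist y z < \<epsilon>"
    have Gz: "G z \<noteq> 0" using z leaf_reg x by blast
    have "G (ray z u) \<noteq> 0" if u: "u \<in> J" for u
    proof -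
      have "isCont (\<lambda>z. norm (G (ray z u))) z"
      proof -
        have "isCont G (ray z u)" using G_deriv has_derivative_continuous by blast
        then show ?thesis using isCont_o2[OF ray_isCont[OF Gz]] by (intro continuous_intros) blast
      qed
      moreover have "norm (G (ray x u)) / 2 > 0" using x u by simp
      ultimately obtain d where d: "d > 0" "\<And>y. dist y z < d \<Longrightarrow> dist (norm (G (ray y u))) (norm (G (ray z u))) < norm (G (ray x u)) / 2"
        unfolding continuous_at_eps_delta by blast
      obtain y where y: "y \<in> leaf x" "P y" "dist y z < d" using cl[OF d(1)] by blast
      have "norm (G (ray y u)) = norm (G (ray x u))" using y(2) u metric by (auto simp: P_def)
      moreover have "norm (G (ray x u)) > 0" using x(2)[OF u] by simp
      ultimately have "norm (G (ray z u)) > 0" using d(2)[OF y(3)] unfolding dist_real_def by linarith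
      then show ?thesis by simp
    qed
    then have zW: "z \<in> W" using Gz by (simp add: W_def)
    from transport_local[OF SJ W(1) WJ zW] obtain \<epsilon> where e0: "\<epsilon> > 0" "\<forall>y. dist y z < \<epsilon> \<and> f y = f z \<longrightarrow>
      (\<forall>u\<in>J. G (ray y u) \<noteq> 0 \<and> ray y u \<in> leaf (ray z u) \<and> N (ray y u) \<bullet> N y = N (ray z u) \<bullet> N z)"
      by (elim exE conjE)
    note e = e0(1) e0(2)[rule_format, OF conjI]
    obtain y where y: "y \<in> leaf x" "P y" "dist y z < \<epsilon>" using cl[OF e(1)] by blast
    then have "f y = f z" using leaf_f z by metis
    from e(2)[OF y(3) this] have loc: "G (ray y u) \<noteq> 0 \<and> ray y u \<in> leaf (ray z u) \<and> N (ray y u) \<bullet> N y = N (ray z u) \<bullet> N z"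
      if "u \<in> J" for u using that .
    then show "P z"
      using y(2) unfolding P_def using \<open>\<And>u. u \<in> J \<Longrightarrow> G (ray z u) \<noteq> 0\<close> leaf_eq leaf_refl by metis
  qed
  then show ?thesis by (simp add: P_def)
qed

lemma transport_segment:
  assumes "\<And>u. u \<in> closed_segment 0 t \<Longrightarrow> G (ray x u) \<noteq> 0" "y \<in> leaf x"
  shows "G (ray y t) \<noteq> 0 \<and> ray y t \<in> leaf (ray x t)"
proof -
  have "G x \<noteq> 0" using assms(1)[of 0] by (simp add: ray_def)
  moreover have "\<forall>z. G z \<noteq> 0 \<and> (\<forall>u\<in>closed_segment 0 t. G (ray z u) \<noteq> 0) \<longrightarrow>
      (\<forall>u\<in>closed_segment 0 t. N (ray z u) = N z \<or> N (ray z u) = - N z)"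
    using straight by blast
  ultimately have "\<forall>u\<in>closed_segment 0 t. G (ray y u) \<noteq> 0 \<and> ray y u \<in> leaf (ray x u) \<and> N (ray y u) \<bullet> N y = N (ray x u) \<bullet> N x"
    using assms by (intro transport) auto
  then show ?thesis by auto
qed

text \<open>First variation at a point of \<open>leaf y\<close> nearest to \<open>z\<close>: the
  vector to \<open>z\<close> is orthogonal to all tangent vectors, hence a multiple of the normal.
  Any point of the space is thus reached from any regular leaf along a normal line.\<close>

lemma foot_on_leaf:
  assumes y: "G y \<noteq> 0"
  obtains x a where "x \<in> leaf y" "z = ray x a" "\<bar>a\<bar> \<le> dist z y"
proof -
  have "leaf y \<noteq> {}" using leaf_refl by blast
  then obtain x where x: "x \<in> leaf y" "\<And>w. w \<in> leaf y \<Longrightarrow> dist z x \<le> dist z w"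
    using distance_attains_inf[OF leaf_closed[of y]] by blast
  have Gx: "G x \<noteq> 0" using leaf_reg x y by blast
  have perp: "(z - x) \<bullet> v = 0" if v: "v \<bullet> G x = 0" for v
  proof (rule level_curve[OF Gx v open_UNIV UNIV_I])
    fix \<delta> \<gamma> assume \<delta>: "(0::real) < \<delta>" and \<gamma>: "\<gamma> 0 = x" "(\<gamma> has_vector_derivative v) (at 0)"
      "\<And>s. \<bar>s\<bar> < \<delta> \<Longrightarrow> \<gamma> s \<in> UNIV \<and> \<gamma> s \<in> leaf x \<and> isCont \<gamma> s"
    have d: "((\<lambda>s. z - \<gamma> s) has_derivative (\<lambda>h. - (h *\<^sub>R v))) (at 0)"
      using has_derivative_diff[OF has_derivative_const \<gamma>(2)[unfolded has_vector_derivative_def], of z] by simp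
    have "(\<lambda>h. (z - \<gamma> 0) \<bullet> - (h *\<^sub>R v) + - (h *\<^sub>R v) \<bullet> (z - \<gamma> 0)) = (\<lambda>h. 0)"
    proof (rule differential_zero_maxmin[OF _ _ has_derivative_inner[OF d d]])
      show "0 \<in> {-\<delta><..<\<delta>}" "open {-\<delta><..<\<delta>}" using \<delta> by auto
      have "(z - \<gamma> 0) \<bullet> (z - \<gamma> 0) \<le> (z - \<gamma> s) \<bullet> (z - \<gamma> s)" if "s \<in> {-\<delta><..<\<delta>}" for s
      proof -
        have "\<gamma> s \<in> leaf y" using \<gamma>(3)[of s] that x(1) leaf_eq by auto
        then show ?thesis using x(2)[of "\<gamma> s"] \<gamma>(1) by (simp add: dist_norm norm_le)
      qed
      then show "(\<forall>y\<in>{- \<delta><..<\<delta>}. (z - \<gamma> y) \<bullet> (z - \<gamma> y) \<le> (z - \<gamma> 0) \<bullet> (z - \<gamma> 0)) \<or>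
         (\<forall>y\<in>{- \<delta><..<\<delta>}. (z - \<gamma> 0) \<bullet> (z - \<gamma> 0) \<le> (z - \<gamma> y) \<bullet> (z - \<gamma> y))" by blast
    qed
    from fun_cong[OF this, of 1] show ?thesis using \<gamma>(1) by (simp add: inner_commute)
  qed
  define a where "a = (z - x) \<bullet> N x"
  define w where "w = (z - x) - a *\<^sub>R N x"
  have wN: "w \<bullet> N x = 0" using Gx by (simp add: w_def a_def inner_diff_left)
  then have "(z - x) \<bullet> w = 0" using perp perp_N_iff[OF Gx] by blast
  moreover have "w \<bullet> w = (z - x) \<bullet> w - a * (w \<bullet> N x)"
    unfolding w_def by (simp add: inner_diff_left inner_commute)
  ultimately have "w \<bullet> w = 0" using wN by simp
  then have "w = 0" by simp
  then have eq: "z = ray x a" by (simp add: w_def ray_def algebra_simps)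
  have "\<bar>a\<bar> = dist z x" using Gx by (simp add: eq ray_def dist_norm)
  then show ?thesis using that[OF x(1) eq] x(2)[of y] by simp
qed

text \<open>If the normal line of \<open>y\<close> were regular between the times \<open>0\<close>
  and \<open>a\<close>, transport would make \<open>ray x a\<close> regular for the foot
  \<open>x\<close> of \<open>z\<close>; but that point is \<open>z\<close>. A critical point far off
  the normal line thus forces one on the line at no greater distance.\<close>

lemma critical_on_ray:
  assumes y: "G y \<noteq> 0" and z: "G z = 0"
  obtains u where "\<bar>u\<bar> \<le> dist z y" "G (ray y u) = 0"
proof -
  obtain x a where x: "x \<in> leaf y" "z = ray x a" "\<bar>a\<bar> \<le> dist z y" by (rule foot_on_leaf[OF y])
  have "\<exists>u\<in>closed_segment 0 a. G (ray y u) = 0"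
    using transport_segment[of a y x] x z by auto
  then obtain u where u: "u \<in> closed_segment 0 a" "G (ray y u) = 0" by blast
  then have "\<bar>u\<bar> \<le> \<bar>a\<bar>" by (auto simp: closed_segment_eq_real_ivl split: if_splits)
  with that[OF _ u(2)] x(3) show ?thesis by linarith
qed

end

section \<open>Tangent vectors of regular surfaces\<close>

text \<open>Curves need a derivative only at \<open>0\<close> and have to stay in \<open>S\<close>
  only for small times, of both signs. For a regular surface this is the tangent space.\<close>

definition tang :: "'a::real_normed_vector set \<Rightarrow> 'a \<Rightarrow> 'a set" where
  "tang S q = {e. \<exists>\<gamma>::real \<Rightarrow> 'a. \<gamma> 0 = q \<and> (\<gamma> has_vector_derivative e) (at 0) \<and> (\<forall>\<^sub>F s in at 0. \<gamma> s \<in> S)}"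

lemma tang_subset_local:
  assumes U: "open U" "q \<in> U" and sub: "S \<inter> U \<subseteq> S'"
  shows "tang S q \<subseteq> tang S' q"
proof
  fix e assume "e \<in> tang S q"
  then obtain \<gamma> :: "real \<Rightarrow> 'a" where g: "\<gamma> 0 = q" "(\<gamma> has_vector_derivative e) (at 0)" "\<forall>\<^sub>F s in at 0. \<gamma> s \<in> S"
    unfolding tang_def by blast
  have "(\<gamma> \<longlongrightarrow> \<gamma> 0) (at 0)" using has_vector_derivative_continuous[OF g(2)] by (simp add: isCont_def)
  then have "\<forall>\<^sub>F s in at 0. \<gamma> s \<in> U" using U g(1) by (simp add: topological_tendstoD)
  then have "\<forall>\<^sub>F s in at 0. \<gamma> s \<in> S'" using g(3) by eventually_elim (use sub in blast)
  then show "e \<in> tang S' q" unfolding tang_def using g by blast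
qed

lemma tang_eq_local: "open U \<Longrightarrow> q \<in> U \<Longrightarrow> S \<inter> U = S' \<inter> U \<Longrightarrow> tang S q = tang S' q"
  by (rule subset_antisym; rule tang_subset_local[of U]) auto

text \<open>Mean value inequality for \<open>\<phi> - D x\<close> on a ball where the columns of
  \<open>D\<close> vary little. The base point \<open>x\<close> may move through the ball, which
  pointwise differentiability would not give.\<close>

lemma C1_uniform_strict:
  fixes \<phi> :: "'a::euclidean_space \<Rightarrow> 'b::euclidean_space"
  assumes V: "open V" "a \<in> V" and D: "\<And>x. x \<in> V \<Longrightarrow> (\<phi> has_derivative D x) (at x)"
    and cont: "\<And>i. i \<in> Basis \<Longrightarrow> continuous_on V (\<lambda>x. D x i)" and e: "\<eta> > 0"
  shows "\<exists>\<rho>>0. ball a \<rho> \<subseteq> V \<and> (\<forall>x\<in>ball a \<rho>. \<forall>v. norm (D x v - D a v) \<le> \<eta> * norm v) \<and>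
    (\<forall>x\<in>ball a \<rho>. \<forall>y\<in>ball a \<rho>. norm (\<phi> y - \<phi> x - D x (y - x)) \<le> \<eta> * norm (y - x))"
proof -
  have lin: "bounded_linear (D x)" if "x \<in> V" for x using D[OF that] has_derivative_bounded_linear by blast
  let ?s = "\<lambda>x. \<Sum>i\<in>Basis. norm (D x i - D a i)"
  have "continuous_on V ?s" by (intro continuous_intros cont)
  then have "isCont ?s a" using V continuous_on_eq_continuous_at by blast
  then obtain d where d: "d > 0" "\<And>x. dist x a < d \<Longrightarrow> dist (?s x) (?s a) < \<eta> / 2"
    unfolding continuous_at_eps_delta using e half_gt_zero by blast
  obtain d' where d': "d' > 0" "ball a d' \<subseteq> V" using V open_contains_ball by blast
  define \<rho> where "\<rho> = min d d'"
  have \<rho>: "\<rho> > 0" "ball a \<rho> \<subseteq> V" using d d' by (auto simp: \<rho>_def)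
  have half: "norm (D x v - D a v) \<le> \<eta> / 2 * norm v" if x: "x \<in> ball a \<rho>" for x v
  proof -
    have xV: "x \<in> V" using x \<rho> by blast
    have "linear (\<lambda>v. D x v - D a v)"
      using lin[OF xV] lin[OF V(2)] by (intro linear_compose_sub bounded_linear.linear)
    note T = this
    have "D x v - D a v = (\<lambda>v. D x v - D a v) (\<Sum>i\<in>Basis. (v \<bullet> i) *\<^sub>R i)" by (simp add: euclidean_representation)
    also have "\<dots> = (\<Sum>i\<in>Basis. (\<lambda>v. D x v - D a v) ((v \<bullet> i) *\<^sub>R i))" by (rule linear_sum[OF T])
    also have "\<dots> = (\<Sum>i\<in>Basis. (v \<bullet> i) *\<^sub>R (D x i - D a i))"
      by (intro sum.cong refl) (rule linear_cmul[OF T])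
    finally have "D x v - D a v = (\<Sum>i\<in>Basis. (v \<bullet> i) *\<^sub>R (D x i - D a i))" .
    then have "norm (D x v - D a v) \<le> (\<Sum>i\<in>Basis. norm ((v \<bullet> i) *\<^sub>R (D x i - D a i)))" by (metis norm_sum)
    also have "\<dots> \<le> (\<Sum>i\<in>Basis. norm v * norm (D x i - D a i))"
      by (intro sum_mono) (auto intro!: mult_right_mono Basis_le_norm)
    also have "\<dots> = norm v * ?s x" by (simp add: sum_distrib_left)
    also have "\<dots> \<le> norm v * (\<eta> / 2)"
    proof -
      have "dist (?s x) (?s a) < \<eta> / 2" using d(2)[of x] x by (simp add: \<rho>_def dist_commute)
      then show ?thesis by (intro mult_left_mono) (auto simp: dist_real_def)
    qed
    finally show ?thesis by (simp add: mult.commute)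
  qed
  have "norm (\<phi> y - \<phi> x - D x (y - x)) \<le> \<eta> * norm (y - x)" if x: "x \<in> ball a \<rho>" and y: "y \<in> ball a \<rho>" for x y
  proof -
    have xV: "x \<in> V" using x \<rho> by blast
    interpret L: bounded_linear "D x" by (rule lin[OF xV])
    have "norm ((\<phi> y - D x y) - (\<phi> x - D x x)) \<le> \<eta> * norm (y - x)"
    proof (rule differentiable_bound[of "ball a \<rho>" "\<lambda>z. \<phi> z - D x z" "\<lambda>z v. D z v - D x v"])
      fix z assume z: "z \<in> ball a \<rho>"
      show "((\<lambda>z. \<phi> z - D x z) has_derivative (\<lambda>v. D z v - D x v)) (at z within ball a \<rho>)"
      proof (rule has_derivative_at_withinI[OF has_derivative_diff])
        show "(\<phi> has_derivative D z) (at z)" using D z \<rho>(2) by blast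
        show "(D x has_derivative D x) (at z)" by (rule bounded_linear_imp_has_derivative[OF lin[OF xV]])
      qed
      show "onorm (\<lambda>v. D z v - D x v) \<le> \<eta>"
      proof (rule onorm_le)
        fix v
        have "norm ((D z v - D a v) - (D x v - D a v)) \<le> \<eta> / 2 * norm v + \<eta> / 2 * norm v"
          using half[OF z, of v] half[OF x, of v] norm_triangle_ineq4[of "D z v - D a v" "D x v - D a v"] by linarith
        then show "norm (D z v - D x v) \<le> \<eta> * norm v" by simp
      qed
    qed (use x y in auto)
    then show ?thesis by (simp add: L.diff algebra_simps)
  qed
  moreover have "norm (D x v - D a v) \<le> \<eta> * norm v" if x: "x \<in> ball a \<rho>" for x v
  proof -
    have "0 \<le> \<eta> * norm v" using e by simp
    then show ?thesis using half[OF x, of v] by linarith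
  qed
  ultimately show ?thesis using \<rho> by blast
qed

text \<open>Names the data behind the existential quantifiers of \<open>regular_surface\<close>,
  including the two derivatives, and replaces equality of sets by a pointwise test for membership in
  \<open>S\<close>.\<close>

definition surface_chart :: "'a::euclidean_space set \<Rightarrow> nat \<Rightarrow> 'a set \<Rightarrow> 'a set \<Rightarrow> ('a \<Rightarrow> 'a) \<Rightarrow> ('a \<Rightarrow> 'a) \<Rightarrow> 'a set \<Rightarrow>
    ('a \<Rightarrow> 'a \<Rightarrow> 'a) \<Rightarrow> ('a \<Rightarrow> 'a \<Rightarrow> 'a) \<Rightarrow> bool" where
  "surface_chart S d U V \<psi> \<psi>' L D D' \<longleftrightarrow> open U \<and> open V \<and> (\<forall>x\<in>U. \<psi> x \<in> V \<and> \<psi>' (\<psi> x) = x) \<and>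
    (\<forall>y\<in>V. \<psi>' y \<in> U \<and> \<psi> (\<psi>' y) = y) \<and>
    (\<forall>x\<in>U. (\<psi> has_derivative D x) (at x)) \<and> (\<forall>i\<in>Basis. continuous_on U (\<lambda>x. D x i)) \<and>
    (\<forall>y\<in>V. (\<psi>' has_derivative D' y) (at y)) \<and> (\<forall>i\<in>Basis. continuous_on V (\<lambda>y. D' y i)) \<and>
    subspace L \<and> dim L = d \<and> (\<forall>x\<in>U. x \<in> S \<longleftrightarrow> \<psi> x \<in> L)"

lemma surface_chart_exists:
  fixes S :: "'a::euclidean_space set"
  assumes "regular_surface d S" "q \<in> S"
  obtains U and V :: "'a set" and \<psi> \<psi>' L D D' where "surface_chart S d U V \<psi> \<psi>' L D D'" "q \<in> U"
proof -
  from assms obtain U and V :: "'a set" and \<psi> \<psi>' L where *: "open U" "q \<in> U" "open V" "homeomorphism U V \<psi> \<psi>'"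
        "C1_on U \<psi>" "C1_on V \<psi>'" "subspace L" "dim L = d" "\<psi> ` (S \<inter> U) = V \<inter> L"
    unfolding regular_surface_def by metis
  obtain D where D: "\<forall>x\<in>U. (\<psi> has_derivative D x) (at x)" "\<forall>i\<in>Basis. continuous_on U (\<lambda>x. D x i)"
    using *(5) unfolding C1_on_def by blast
  obtain D' where D': "\<forall>x\<in>V. (\<psi>' has_derivative D' x) (at x)" "\<forall>i\<in>Basis. continuous_on V (\<lambda>x. D' x i)"
    using *(6) unfolding C1_on_def by blast
  have h: "\<forall>x\<in>U. \<psi> x \<in> V \<and> \<psi>' (\<psi> x) = x" "\<forall>y\<in>V. \<psi>' y \<in> U \<and> \<psi> (\<psi>' y) = y"
    using *(4) unfolding homeomorphism_def by auto
  have "x \<in> S \<longleftrightarrow> \<psi> x \<in> L" if x: "x \<in> U" for x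
  proof
    show "x \<in> S \<Longrightarrow> \<psi> x \<in> L" using *(9) x by blast
    assume "\<psi> x \<in> L"
    then have "\<psi> x \<in> \<psi> ` (S \<inter> U)" using *(9) h x by blast
    then obtain z where "z \<in> S" "z \<in> U" "\<psi> x = \<psi> z" by blast
    then show "x \<in> S" using h(1) x by metis
  qed
  then have "surface_chart S d U V \<psi> \<psi>' L D D'" unfolding surface_chart_def using * D D' h by blast
  then show ?thesis using that *(2) by blast
qed

lemma inverse_derivatives:
  assumes "open U" "x \<in> U" "\<And>z. z \<in> U \<Longrightarrow> \<psi>' (\<psi> z) = z"
    "(\<psi> has_derivative D) (at x)" "(\<psi>' has_derivative D') (at (\<psi> x))"
  shows "D' (D v) = v"
proof -
  have "((\<lambda>z. \<psi>' (\<psi> z)) has_derivative (\<lambda>v. D' (D v))) (at x)"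
    by (rule has_derivative_compose[OF assms(4,5)])
  then have "((\<lambda>z. z) has_derivative (\<lambda>v. D' (D v))) (at x)"
    by (rule has_derivative_transform_within_open[OF _ assms(1,2)]) (rule assms(3))
  then have "(\<lambda>v. D' (D v)) = (\<lambda>v. v)" using has_derivative_unique[OF _ has_derivative_ident] by blast
  then show ?thesis by metis
qed

lemma surface_chart_inverse:
  assumes "surface_chart S d U V \<psi> \<psi>' L D D'" "x \<in> U"
  shows "D' (\<psi> x) (D x v) = v" "D x (D' (\<psi> x) v) = v"
proof -
  have U: "open U" "open V" "\<And>z. z \<in> U \<Longrightarrow> \<psi>' (\<psi> z) = z" "\<And>y. y \<in> V \<Longrightarrow> \<psi> (\<psi>' y) = y" "\<psi> x \<in> V"
    and D: "(\<psi> has_derivative D x) (at x)" "(\<psi>' has_derivative D' (\<psi> x)) (at (\<psi> x))"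
    using assms unfolding surface_chart_def by blast+
  show "D' (\<psi> x) (D x v) = v" by (rule inverse_derivatives[OF U(1) assms(2) U(3) D])
  have "(\<psi> has_derivative D x) (at (\<psi>' (\<psi> x)))" using D(1) U(3)[OF assms(2)] by simp
  from inverse_derivatives[OF U(2,5,4) D(2) this]
  show "D x (D' (\<psi> x) v) = v" .
qed

text \<open>The difference quotients lie in \<open>L\<close>, and a subspace is closed.\<close>

lemma vector_derivative_in_subspace:
  fixes \<gamma> :: "real \<Rightarrow> 'a::euclidean_space"
  assumes L: "subspace L" and d: "(\<gamma> has_vector_derivative e) (at 0)" and ev: "\<forall>\<^sub>F s in at 0. \<gamma> s \<in> L"
    and 0: "\<gamma> 0 \<in> L"
  shows "e \<in> L"
proof -
  have "((\<lambda>s. (1 / norm (s - 0)) *\<^sub>R (\<gamma> s - (\<gamma> 0 + (s - 0) *\<^sub>R e))) \<longlongrightarrow> 0) (at 0)"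
    using d unfolding has_vector_derivative_def has_derivative_within by blast
  then have "((\<lambda>s. norm ((1 / norm (s - 0)) *\<^sub>R (\<gamma> s - (\<gamma> 0 + (s - 0) *\<^sub>R e)))) \<longlongrightarrow> 0) (at 0)"
    by (rule tendsto_norm_zero)
  moreover have "\<forall>\<^sub>F s in at 0. norm ((1 / norm (s - 0)) *\<^sub>R (\<gamma> s - (\<gamma> 0 + (s - 0) *\<^sub>R e))) = norm ((\<gamma> s - \<gamma> 0) /\<^sub>R s - e)"
    unfolding eventually_at_filter
  proof (rule always_eventually, intro allI impI)
    fix s :: real assume s: "s \<noteq> 0"
    have "\<gamma> s - (\<gamma> 0 + (s - 0) *\<^sub>R e) = s *\<^sub>R ((\<gamma> s - \<gamma> 0) /\<^sub>R s - e)"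
      using s by (simp add: scaleR_diff_right)
    then show "norm ((1 / norm (s - 0)) *\<^sub>R (\<gamma> s - (\<gamma> 0 + (s - 0) *\<^sub>R e))) = norm ((\<gamma> s - \<gamma> 0) /\<^sub>R s - e)"
      using s by simp
  qed
  ultimately have "((\<lambda>s. norm ((\<gamma> s - \<gamma> 0) /\<^sub>R s - e)) \<longlongrightarrow> 0) (at 0)"
    by (rule Lim_transform_eventually)
  then have lim: "((\<lambda>s. (\<gamma> s - \<gamma> 0) /\<^sub>R s) \<longlongrightarrow> e) (at 0)"
    by (rule LIM_zero_cancel[OF tendsto_norm_zero_cancel])
  have "\<forall>\<^sub>F s in at 0. (\<gamma> s - \<gamma> 0) /\<^sub>R s \<in> L"
    using ev by eventually_elim (rule subspace_scale[OF L subspace_diff[OF L _ 0]])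
  then show ?thesis by (rule Lim_in_closed_set[OF closed_subspace[OF L] _ trivial_limit_at lim])
qed

text \<open>Lines in \<open>L\<close> pull back to curves in \<open>S\<close>, and curves in
  \<open>S\<close> push forward to curves in \<open>L\<close>. The image of \<open>L\<close> under
  an injective linear map then has the expected dimension.\<close>

lemma chart_tang:
  assumes c: "surface_chart S d U V \<psi> \<psi>' L D D'" and x: "x \<in> U" "x \<in> S"
  shows "tang S x = D' (\<psi> x) ` L"
proof
  note cs = c[unfolded surface_chart_def]
  have D': "(\<psi>' has_derivative D' (\<psi> x)) (at (\<psi> x))" and D: "(\<psi> has_derivative D x) (at x)" using cs x by auto
  show "D' (\<psi> x) ` L \<subseteq> tang S x"
  proof clarify
    fix l assume l: "l \<in> L"
    interpret B: bounded_linear "D' (\<psi> x)" using D' has_derivative_bounded_linear by blast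
    define \<gamma> where "\<gamma> = (\<lambda>s::real. \<psi>' (\<psi> x + s *\<^sub>R l))"
    have "((\<lambda>s::real. \<psi> x + s *\<^sub>R l) has_derivative (\<lambda>h. h *\<^sub>R l)) (at 0)" by (auto intro!: derivative_eq_intros)
    from has_derivative_compose[OF this, of \<psi>' "D' (\<psi> x)"] D'
    have "(\<gamma> has_vector_derivative D' (\<psi> x) l) (at 0)" by (simp add: \<gamma>_def has_vector_derivative_def B.scaleR)
    moreover have "\<gamma> 0 = x" using cs x by (simp add: \<gamma>_def)
    moreover have "\<forall>\<^sub>F s in at (0::real). \<psi> x + s *\<^sub>R l \<in> V"
    proof -
      have "((\<lambda>s::real. \<psi> x + s *\<^sub>R l) \<longlongrightarrow> \<psi> x + 0 *\<^sub>R l) (at 0)" by (intro tendsto_intros)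
      then show ?thesis using cs x by (intro topological_tendstoD) auto
    qed
    then have "\<forall>\<^sub>F s in at 0. \<gamma> s \<in> S"
    proof eventually_elim
      case (elim s)
      have "\<psi> x + s *\<^sub>R l \<in> L" using cs x l by (auto intro!: subspace_add subspace_scale)
      then show ?case using cs elim unfolding \<gamma>_def by metis
    qed
    ultimately show "D' (\<psi> x) l \<in> tang S x" unfolding tang_def by blast
  qed
  show "tang S x \<subseteq> D' (\<psi> x) ` L"
  proof
    fix e assume "e \<in> tang S x"
    then obtain \<gamma> where g: "\<gamma> 0 = x" "(\<gamma> has_vector_derivative e) (at 0)" "\<forall>\<^sub>F s in at (0::real). \<gamma> s \<in> S"
      unfolding tang_def by blast
    interpret B: bounded_linear "D x" using D has_derivative_bounded_linear by blast
    have "((\<lambda>s. \<psi> (\<gamma> s)) has_derivative (\<lambda>h. D x (h *\<^sub>R e))) (at 0)"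
      using has_derivative_compose[OF g(2)[unfolded has_vector_derivative_def]] D g(1) by metis
    then have d: "((\<lambda>s. \<psi> (\<gamma> s)) has_vector_derivative D x e) (at 0)"
      by (simp add: has_vector_derivative_def B.scaleR)
    have "(\<gamma> \<longlongrightarrow> x) (at 0)" using has_vector_derivative_continuous[OF g(2)] g(1) by (simp add: isCont_def)
    then have "\<forall>\<^sub>F s in at 0. \<gamma> s \<in> U" using cs x by (intro topological_tendstoD) auto
    then have "\<forall>\<^sub>F s in at 0. \<psi> (\<gamma> s) \<in> L" using g(3) by eventually_elim (use cs in blast)
    then have "D x e \<in> L" using vector_derivative_in_subspace[OF _ d] cs x g(1) by blast
    then show "e \<in> D' (\<psi> x) ` L" using surface_chart_inverse(1)[OF c x(1)] by (metis imageI)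
  qed
qed

lemma surface_tang:
  fixes S :: "'a::euclidean_space set"
  assumes "regular_surface d S" "q \<in> S"
  shows "subspace (tang S q)" "dim (tang S q) = d"
proof -
  obtain U and V :: "'a set" and \<psi> \<psi>' L D D' where c: "surface_chart S d U V \<psi> \<psi>' L D D'" "q \<in> U"
    by (rule surface_chart_exists[OF assms])
  note cs = c(1)[unfolded surface_chart_def]
  have lin: "linear (D' (\<psi> q))"
    using cs c(2) has_derivative_bounded_linear bounded_linear.linear by blast
  show "subspace (tang S q)" unfolding chart_tang[OF c assms(2)] using cs lin by (intro linear_subspace_image) auto
  have "inj_on (D' (\<psi> q)) (span L)"
    using surface_chart_inverse(2)[OF c] by (metis inj_onI)
  then show "dim (tang S q) = d" unfolding chart_tang[OF c assms(2)] using dim_image_eq[OF lin] cs by metis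
qed

text \<open>In the chart, chords lie in \<open>L\<close> exactly. Strict differentiability of
  \<open>\<psi>'\<close> carries this back with a small relative error, uniformly in both end
  points; the tangent space is the one at \<open>a\<close>, not at the centre
  \<open>q\<close>.\<close>

lemma surface_chord:
  fixes S :: "'a::euclidean_space set"
  assumes "regular_surface d S" "q \<in> S" "\<eta> > 0"
  shows "\<exists>\<rho>>0. \<forall>a\<in>S \<inter> ball q \<rho>. \<forall>b\<in>S \<inter> ball q \<rho>. \<exists>t\<in>tang S a. norm (b - a - t) \<le> \<eta> * norm (b - a)"
proof -
  obtain U and V :: "'a set" and \<psi> \<psi>' L D D' where c: "surface_chart S d U V \<psi> \<psi>' L D D'" "q \<in> U"
    by (rule surface_chart_exists[OF assms(1,2)])
  note cs = c(1)[unfolded surface_chart_def]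
  obtain \<rho>1 where r1: "\<rho>1 > 0" "ball q \<rho>1 \<subseteq> U" "\<forall>x\<in>ball q \<rho>1. \<forall>v. norm (D x v - D q v) \<le> 1 * norm v"
    "\<forall>x\<in>ball q \<rho>1. \<forall>y\<in>ball q \<rho>1. norm (\<psi> y - \<psi> x - D x (y - x)) \<le> 1 * norm (y - x)"
    using C1_uniform_strict[of U q \<psi> D 1] cs c(2) by auto
  have blq: "bounded_linear (D q)" using cs c(2) has_derivative_bounded_linear by blast
  \<comment> \<open>A Lipschitz constant of \<open>\<psi>\<close> near \<open>q\<close>: one unit
    for the remainder, one for the variation of the derivative, and its norm at
    \<open>q\<close>.\<close>
  define C where "C = onorm (D q) + 2"
  have C: "C > 0" using onorm_pos_le[OF blq] by (simp add: C_def)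
  have lip: "norm (\<psi> y - \<psi> x) \<le> C * norm (y - x)" if "x \<in> ball q \<rho>1" "y \<in> ball q \<rho>1" for x y
  proof -
    have "norm (\<psi> y - \<psi> x - D x (y - x)) \<le> norm (y - x)" "norm (D x (y - x) - D q (y - x)) \<le> norm (y - x)"
      using r1 that by auto
    moreover have "norm (D q (y - x)) \<le> onorm (D q) * norm (y - x)" by (rule onorm[OF blq])
    moreover have "norm (\<psi> y - \<psi> x) \<le> norm (\<psi> y - \<psi> x - D x (y - x)) + (norm (D x (y - x) - D q (y - x)) + norm (D q (y - x)))"
      by (smt (verit) diff_add_cancel norm_triangle_ineq)
    ultimately show ?thesis by (simp add: C_def distrib_right)
  qed
  have "\<psi> q \<in> V" using cs c(2) by blast
  then obtain \<rho>2 where r2: "\<rho>2 > 0" "ball (\<psi> q) \<rho>2 \<subseteq> V"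
    "\<forall>x\<in>ball (\<psi> q) \<rho>2. \<forall>y\<in>ball (\<psi> q) \<rho>2. norm (\<psi>' y - \<psi>' x - D' x (y - x)) \<le> \<eta> / C * norm (y - x)"
    using C1_uniform_strict[of V "\<psi> q" \<psi>' D' "\<eta> / C"] cs C assms(3) by auto
  define \<rho> where "\<rho> = min \<rho>1 (\<rho>2 / C)"
  have "\<rho> > 0" using r1 r2 C by (simp add: \<rho>_def)
  moreover have "\<exists>t\<in>tang S a. norm (b - a - t) \<le> \<eta> * norm (b - a)" if a: "a \<in> S \<inter> ball q \<rho>" and b: "b \<in> S \<inter> ball q \<rho>" for a b
  proof -
    have in1: "x \<in> ball q \<rho>1" "x \<in> U" if "x \<in> ball q \<rho>" for x using that r1(2) by (auto simp: \<rho>_def)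
    have in2: "\<psi> x \<in> ball (\<psi> q) \<rho>2" if "x \<in> ball q \<rho>" for x
    proof -
      have "norm (\<psi> x - \<psi> q) \<le> C * norm (x - q)" using lip[of q x] in1[OF that] r1(1) by simp
      also have "\<dots> < \<rho>2" using that C by (simp add: \<rho>_def dist_norm norm_minus_commute field_simps)
      finally show ?thesis by (simp add: dist_norm norm_minus_commute)
    qed
    have aS: "a \<in> S" "a \<in> U" "b \<in> S" "b \<in> U" using a b in1 by auto
    have "\<psi> b - \<psi> a \<in> L" using cs aS by (metis subspace_diff)
    then have "D' (\<psi> a) (\<psi> b - \<psi> a) \<in> tang S a" using chart_tang[OF c(1) aS(2,1)] by blast
    moreover have "norm (\<psi>' (\<psi> b) - \<psi>' (\<psi> a) - D' (\<psi> a) (\<psi> b - \<psi> a)) \<le> \<eta> / C * norm (\<psi> b - \<psi> a)"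
      using r2(3) in2 a b by blast
    then have "norm (b - a - D' (\<psi> a) (\<psi> b - \<psi> a)) \<le> \<eta> / C * norm (\<psi> b - \<psi> a)" using cs aS by metis
    moreover have "\<eta> / C * norm (\<psi> b - \<psi> a) \<le> \<eta> / C * (C * norm (b - a))"
      using lip[of a b] in1 a b C assms(3) by (intro mult_left_mono) auto
    ultimately show ?thesis using C by (intro bexI[of _ "D' (\<psi> a) (\<psi> b - \<psi> a)"]) auto
  qed
  ultimately show ?thesis by blast
qed

text \<open>In the chart the surface is a hyperplane with normal \<open>n\<close>, so
  \<open>n \<bullet> \<psi> x\<close> vanishes exactly on it and its sign tells the sides apart. A
  direction outside the tangent space crosses from one side to the other.\<close>

lemma hypersurface_side:
  fixes S :: "'a::euclidean_space set"
  assumes "regular_surface (DIM('a) - 1) S" "q \<in> S" "e \<notin> tang S q"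
  obtains U \<xi> \<xi>' where "open U" "q \<in> U" "continuous_on U \<xi>" "\<And>x. x \<in> U \<Longrightarrow> (\<xi> x = (0::real)) = (x \<in> S)"
    "(\<xi> has_derivative \<xi>') (at q)" "\<xi>' e \<noteq> 0"
proof -
  obtain U and V :: "'a set" and \<psi> \<psi>' L D D' where c: "surface_chart S (DIM('a) - 1) U V \<psi> \<psi>' L D D'" "q \<in> U"
    by (rule surface_chart_exists[OF assms(1,2)])
  note cs = c(1)[unfolded surface_chart_def]
  have "dim L = DIM('a) - 1" using cs by blast
  then obtain n where n: "n \<noteq> 0" "span L = {x. n \<bullet> x = 0}" using dim_eq_hyperplane by blast
  have L: "x \<in> L \<longleftrightarrow> n \<bullet> x = 0" for x using n(2) cs span_eq_iff by blast
  have cont: "continuous_on U \<psi>"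
    using cs by (meson has_derivative_continuous continuous_at_imp_continuous_on)
  show ?thesis
  proof (rule that[of U "\<lambda>x. n \<bullet> \<psi> x" "\<lambda>v. n \<bullet> D q v"])
    show "continuous_on U (\<lambda>x. n \<bullet> \<psi> x)" by (intro continuous_intros cont)
    show "((\<lambda>x. n \<bullet> \<psi> x) has_derivative (\<lambda>v. n \<bullet> D q v)) (at q)"
      using cs c(2) by (intro has_derivative_inner_right) blast
    show "n \<bullet> D q e \<noteq> 0"
    proof
      assume "n \<bullet> D q e = 0"
      then have "D' (\<psi> q) (D q e) \<in> D' (\<psi> q) ` L" using L by blast
      then show False using surface_chart_inverse(1)[OF c] chart_tang[OF c assms(2)] assms(3) by metis
    qed
  qed (use cs c(2) L in auto)
qed

section \<open>Tubes around critical components\<close>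

text \<open>An isolated critical point counts as a surface of dimension \<open>0\<close>, which
  merges the two alternatives for critical components.\<close>

locale metric_critical = c2_metric_function +
  assumes surf: "G x = 0 \<Longrightarrow> \<exists>d<DIM('a). regular_surface d (connected_component_set {z. G z = 0} x)"
    and isolated: "G x = 0 \<Longrightarrow> \<exists>U. open U \<and> connected_component_set {z. G z = 0} x \<subseteq> U \<and>
      U \<inter> {z. G z = 0} \<subseteq> connected_component_set {z. G z = 0} x"
begin

definition crit :: "'a set" where "crit = {z. G z = 0}"

definition ccomp :: "'a \<Rightarrow> 'a set" where "ccomp x = connected_component_set crit x"

lemma crit_iff [simp]: "x \<in> crit \<longleftrightarrow> G x = 0"
  by (simp add: crit_def)

lemma closed_crit: "closed crit"
  unfolding crit_def by (intro closed_Collect_eq G_cont continuous_on_const)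

lemma comp_refl: "G x = 0 \<Longrightarrow> x \<in> ccomp x"
  by (simp add: ccomp_def)

lemma comp_subset: "ccomp x \<subseteq> crit"
  by (simp add: ccomp_def connected_component_subset)

lemma comp_eq: "y \<in> ccomp x \<Longrightarrow> ccomp y = ccomp x"
  unfolding ccomp_def by (rule connected_component_eq)

lemma comp_local:
  assumes "G x = 0"
  obtains U where "open U" "ccomp x \<subseteq> U" "U \<inter> crit = ccomp x"
proof -
  from isolated[OF assms] obtain U where "open U" "ccomp x \<subseteq> U" "U \<inter> crit \<subseteq> ccomp x"
    unfolding ccomp_def crit_def by (elim exE conjE)
  then show ?thesis using that comp_subset by blast
qed

lemma comp_near:
  assumes "G x = 0"
  obtains \<epsilon> where "\<epsilon> > 0" "\<And>y. dist y x < \<epsilon> \<Longrightarrow> G y = 0 \<Longrightarrow> y \<in> ccomp x"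
proof -
  obtain U where U: "open U" "ccomp x \<subseteq> U" "U \<inter> crit = ccomp x" by (rule comp_local[OF assms])
  have "x \<in> U" using U(2) comp_refl[OF assms] by blast
  then obtain \<epsilon> where e: "\<epsilon> > 0" "ball x \<epsilon> \<subseteq> U" using U(1) open_contains_ball by blast
  show ?thesis
  proof (rule that[OF e(1)])
    fix y assume "dist y x < \<epsilon>" "G y = 0"
    then have "y \<in> U \<inter> crit" using e(2) by (auto simp: dist_commute)
    then show "y \<in> ccomp x" using U(3) by blast
  qed
qed

text \<open>Isolation makes \<open>crit\<close> and the component agree near \<open>x\<close>, so
  tangent vectors can be taken to \<open>crit\<close> without naming a component.\<close>

lemma tang_crit:
  assumes "G x = 0" shows "tang crit x = tang (ccomp x) x"
proof -
  obtain U where U: "open U" "ccomp x \<subseteq> U" "U \<inter> crit = ccomp x" by (rule comp_local[OF assms])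
  then have "x \<in> U" using comp_refl[OF assms] by blast
  then show ?thesis using U by (intro tang_eq_local[of U]) auto
qed

lemma comp_surface:
  assumes "G x = 0"
  obtains d where "d < DIM('a)" "regular_surface d (ccomp x)"
  using surf[OF assms] that by (auto simp: ccomp_def crit_def)

lemma crit_chord:
  assumes q: "G q = 0" and e: "\<eta> > 0"
  obtains \<rho> where "\<rho> > 0" "\<And>a b. G a = 0 \<Longrightarrow> G b = 0 \<Longrightarrow> dist a q < \<rho> \<Longrightarrow> dist b q < \<rho> \<Longrightarrow>
    \<exists>t\<in>tang crit a. norm (b - a - t) \<le> \<eta> * norm (b - a)"
proof -
  obtain d where d: "regular_surface d (ccomp q)" using comp_surface[OF q] by blast
  obtain \<epsilon> where n: "\<epsilon> > 0" "\<And>y. dist y q < \<epsilon> \<Longrightarrow> G y = 0 \<Longrightarrow> y \<in> ccomp q" using comp_near[OF q] by blast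
  from surface_chord[OF d comp_refl[OF q] e] obtain \<rho> where r: "\<rho> > 0"
    "\<forall>a\<in>ccomp q \<inter> ball q \<rho>. \<forall>b\<in>ccomp q \<inter> ball q \<rho>. \<exists>t\<in>tang (ccomp q) a. norm (b - a - t) \<le> \<eta> * norm (b - a)"
    by (elim exE conjE)
  show ?thesis
  proof (rule that[of "min \<rho> \<epsilon>"])
    show "min \<rho> \<epsilon> > 0" using r n by simp
    fix a b assume ab: "G a = 0" "G b = 0" "dist a q < min \<rho> \<epsilon>" "dist b q < min \<rho> \<epsilon>"
    then have "a \<in> ccomp q" "b \<in> ccomp q" "a \<in> ball q \<rho>" "b \<in> ball q \<rho>"
      using n(2) by (auto simp: dist_commute)
    moreover have "tang (ccomp q) a = tang crit a" using tang_crit[OF ab(1)] comp_eq[OF \<open>a \<in> ccomp q\<close>] by simp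
    ultimately show "\<exists>t\<in>tang crit a. norm (b - a - t) \<le> \<eta> * norm (b - a)"
      using r(2)[rule_format, OF IntI IntI, of a b] by simp
  qed
qed

text \<open>The ball of radius \<open>s\<close> about \<open>a + s *\<^sub>R e\<close> has no
  critical point inside and touches the critical set at \<open>a\<close>, so along a curve in
  \<open>crit\<close> the squared distance to its centre has a local minimum at
  \<open>a\<close>.\<close>

lemma ball_perp_tang:
  assumes a: "G a = 0" and s: "s > 0" "\<And>z. G z = 0 \<Longrightarrow> s \<le> dist (a + s *\<^sub>R e) z" and e: "norm e = 1"
    and v: "v \<in> tang crit a"
  shows "v \<bullet> e = 0"
proof -
  obtain \<gamma> where g: "\<gamma> 0 = a" "(\<gamma> has_vector_derivative v) (at 0)" "\<forall>\<^sub>F r in at (0::real). \<gamma> r \<in> crit"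
    using v unfolding tang_def by blast
  let ?c = "a + s *\<^sub>R e"
  have d: "((\<lambda>r. \<gamma> r - ?c) has_derivative (\<lambda>h. h *\<^sub>R v)) (at 0)"
    using has_derivative_diff[OF g(2)[unfolded has_vector_derivative_def] has_derivative_const, of ?c] by simp
  have "(\<lambda>h. (\<gamma> 0 - ?c) \<bullet> (h *\<^sub>R v) + (h *\<^sub>R v) \<bullet> (\<gamma> 0 - ?c)) = (\<lambda>h. 0)"
  proof (rule has_derivative_local_min[OF has_derivative_inner[OF d d]])
    show "\<forall>\<^sub>F r in at 0. (\<gamma> 0 - ?c) \<bullet> (\<gamma> 0 - ?c) \<le> (\<gamma> r - ?c) \<bullet> (\<gamma> r - ?c)"
      using g(3)
    proof eventually_elim
      case (elim r)
      then have "s \<le> norm (\<gamma> r - ?c)" using s(2)[of "\<gamma> r"] by (simp add: dist_norm norm_minus_commute)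
      moreover have "norm (\<gamma> 0 - ?c) = s" using g(1) e s(1) by simp
      ultimately show ?case by (simp add: norm_le[symmetric])
    qed
  qed
  from fun_cong[OF this, of 1] show ?thesis using g(1) s(1) by (simp add: inner_commute)
qed

text \<open>\<open>critical_on_ray\<close> applied to a nearest critical point: the hit it provides
  on the line of \<open>y\<close> is no farther, and being critical it is no nearer.\<close>

lemma nearest_critical:
  assumes y: "G y \<noteq> 0" and ne: "crit \<noteq> {}"
  obtains u where "\<bar>u\<bar> = infdist y crit" "G (ray y u) = 0"
proof -
  obtain z where z: "z \<in> crit" "infdist y crit = dist y z"
    using infdist_attains_inf[OF closed_crit ne] by blast
  have Gz: "G z = 0" using z by simp
  obtain u where u: "\<bar>u\<bar> \<le> dist z y" "G (ray y u) = 0" by (rule critical_on_ray[OF y Gz])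
  have "infdist y crit \<le> dist y (ray y u)" using u(2) by (intro infdist_le) auto
  also have "\<dots> = \<bar>u\<bar>" using y by (simp add: ray_def dist_norm)
  finally show ?thesis using that[OF _ u(2)] u(1) z(2) by (simp add: dist_commute)
qed

definition single_hit :: "'a \<Rightarrow> real \<Rightarrow> bool" where
  "single_hit q \<rho> \<longleftrightarrow> 0 < \<rho> \<and> (\<forall>a \<nu> t. G a = 0 \<longrightarrow> dist a q < \<rho> \<longrightarrow> norm \<nu> = 1 \<longrightarrow>
    (\<forall>v\<in>tang crit a. v \<bullet> \<nu> = 0) \<longrightarrow> G (a + t *\<^sub>R \<nu>) = 0 \<longrightarrow> dist (a + t *\<^sub>R \<nu>) q < \<rho> \<longrightarrow> t = 0)"

lemma single_hitD:
  assumes "single_hit q \<rho>"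
  shows "\<rho> > 0" "\<And>a \<nu> t. G a = 0 \<Longrightarrow> dist a q < \<rho> \<Longrightarrow> norm \<nu> = 1 \<Longrightarrow> (\<And>v. v \<in> tang crit a \<Longrightarrow> v \<bullet> \<nu> = 0) \<Longrightarrow>
    G (a + t *\<^sub>R \<nu>) = 0 \<Longrightarrow> dist (a + t *\<^sub>R \<nu>) q < \<rho> \<Longrightarrow> t = 0"
  using assms unfolding single_hit_def by blast+

text \<open>A second hit would give a chord \<open>t *\<^sub>R \<nu>\<close> that is normal to the
  surface and yet within half its length of a tangent vector, so \<open>\<bar>t\<bar>\<close> is at
  most half of itself.\<close>

lemma unique_hit:
  assumes q: "G q = 0"
  obtains \<rho> where "single_hit q \<rho>"
proof (rule crit_chord[OF q, of "1/2"])
  fix \<rho> assume r: "\<rho> > 0" "\<And>a b. G a = 0 \<Longrightarrow> G b = 0 \<Longrightarrow> dist a q < \<rho> \<Longrightarrow> dist b q < \<rho> \<Longrightarrow>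
    \<exists>t\<in>tang crit a. norm (b - a - t) \<le> 1/2 * norm (b - a)"
  have "t = 0" if h: "G a = 0" "dist a q < \<rho>" "norm \<nu> = 1" "\<And>v. v \<in> tang crit a \<Longrightarrow> v \<bullet> \<nu> = 0"
      "G (a + t *\<^sub>R \<nu>) = 0" "dist (a + t *\<^sub>R \<nu>) q < \<rho>" for a \<nu> t
  proof -
    obtain v where v: "v \<in> tang crit a" "norm (t *\<^sub>R \<nu> - v) \<le> 1/2 * norm (t *\<^sub>R \<nu>)"
      using r(2)[OF h(1,5,2,6)] by auto
    have nn: "\<nu> \<bullet> \<nu> = 1" using h(3) norm_eq_1 by blast
    have "t = (t *\<^sub>R \<nu> - v) \<bullet> \<nu>" using h(4)[OF v(1)] nn by (simp add: inner_diff_left)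
    then have "\<bar>t\<bar> \<le> norm (t *\<^sub>R \<nu> - v) * norm \<nu>" using Cauchy_Schwarz_ineq2 by metis
    then show "t = 0" using v(2) h(3) by simp
  qed
  then have "single_hit q \<rho>" using r(1) unfolding single_hit_def by blast
  then show ?thesis by (rule that)
qed simp

text \<open>The nearest critical point \<open>p\<close> lies on the line of \<open>y\<close> and is
  met orthogonally. When the point slides along this line, its nearest critical point again lies on
  the same line, and \<open>single_hit\<close> leaves only \<open>p\<close>. The bounds by
  \<open>\<rho> / 4\<close> keep every competing hit within distance \<open>\<rho>\<close> of
  \<open>q\<close>.\<close>

lemma foot:
  assumes q: "G q = 0" and single: "single_hit q \<rho>"
    and y: "G y \<noteq> 0" "dist y q < \<rho> / 4"
  obtains p \<nu> s where "G p = 0" "norm \<nu> = 1" "\<And>v. v \<in> tang crit p \<Longrightarrow> v \<bullet> \<nu> = 0" "s > 0" "s = infdist y crit"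
    "y = p + s *\<^sub>R \<nu>" "\<And>t. 0 < t \<Longrightarrow> t \<le> \<rho> / 4 \<Longrightarrow> infdist (p + t *\<^sub>R \<nu>) crit = t" "N y = \<nu> \<or> N y = - \<nu>"
proof -
  note \<rho> = single_hitD[OF single]
  have ne: "crit \<noteq> {}" using q by auto
  define s where "s = infdist y crit"
  obtain u where u: "\<bar>u\<bar> = s" "G (ray y u) = 0" unfolding s_def by (rule nearest_critical[OF y(1) ne])
  have "s \<noteq> 0" using closed_crit ne y(1) in_closed_iff_infdist_zero[of crit y] by (simp add: s_def)
  then have s: "s > 0" using infdist_nonneg[of y crit] by (simp add: s_def)
  have s4: "s < \<rho> / 4" using infdist_le[of q crit y] q y(2) by (simp add: s_def)
  define p where "p = ray y u"
  \<comment> \<open>This sign makes \<open>\<nu>\<close> point from \<open>p\<close> towards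
    \<open>y\<close>, whichever way \<open>N y\<close> points.\<close>
  define \<sigma> where "\<sigma> = - sgn u"
  define \<nu> where "\<nu> = \<sigma> *\<^sub>R N y"
  have u0: "u \<noteq> 0" using u s by auto
  have \<sigma>: "\<sigma> = 1 \<or> \<sigma> = -1" "\<sigma> * \<sigma> = 1" "\<sigma> * u = - s" using u0 u(1) by (auto simp: \<sigma>_def sgn_if)
  have us: "u = - (\<sigma> * s)" using \<sigma> by (metis mult.assoc mult.left_neutral mult_minus_right add.inverse_inverse)
  have \<nu>: "norm \<nu> = 1" using y(1) \<sigma>(1) by (auto simp: \<nu>_def)
  have Ny: "N y = \<sigma> *\<^sub>R \<nu>" using \<sigma>(2) by (simp add: \<nu>_def)
  have s\<sigma>: "s * \<sigma> = - u" using us by (simp add: mult.commute)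
  have yp: "y = p + s *\<^sub>R \<nu>" by (simp add: p_def ray_def \<nu>_def s\<sigma>)
  have Gp: "G p = 0" using u by (simp add: p_def)
  have dpq: "dist p q < \<rho> / 2"
  proof -
    have "dist p y = s" using \<nu> s by (simp add: yp dist_norm)
    then show ?thesis using dist_triangle[of p q y] y(2) s4 by simp
  qed
  have perp: "v \<bullet> \<nu> = 0" if "v \<in> tang crit p" for v
  proof (rule ball_perp_tang[OF Gp s _ \<nu> that])
    fix z assume "G z = 0"
    then have "infdist y crit \<le> dist y z" by (intro infdist_le) auto
    then show "s \<le> dist (p + s *\<^sub>R \<nu>) z" using yp s_def by metis
  qed
  have dist_t: "dist (p + t *\<^sub>R \<nu>) q < \<rho>" if "\<bar>t\<bar> \<le> \<rho> / 2" for t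
  proof -
    have "dist (p + t *\<^sub>R \<nu>) p = \<bar>t\<bar>" using \<nu> by (simp add: dist_norm)
    then show ?thesis using dist_triangle[of "p + t *\<^sub>R \<nu>" q p] dpq that by simp
  qed
  have uniq: "t = 0" if "G (p + t *\<^sub>R \<nu>) = 0" "\<bar>t\<bar> \<le> \<rho> / 2" for t
    using \<rho>(2)[OF Gp _ \<nu> perp that(1) dist_t[OF that(2)]] dpq \<rho>(1) by simp
  have ray_eq: "ray y w = p + (s + \<sigma> * w) *\<^sub>R \<nu>" for w
    unfolding ray_def Ny by (subst yp) (simp add: scaleR_add_left mult.commute)
  have inf: "infdist (p + t *\<^sub>R \<nu>) crit = t" if t: "0 < t" "t \<le> \<rho> / 4" for t
  proof -
    define w where "w = \<sigma> * (t - s)"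
    have y': "ray y w = p + t *\<^sub>R \<nu>" using \<sigma>(2) by (simp add: ray_eq w_def mult.assoc[symmetric])
    have reg: "G (ray y w') \<noteq> 0" if w': "w' \<in> closed_segment 0 w" for w'
    proof -
      obtain k where k: "0 \<le> k" "k \<le> 1" "w' = k * w" using w' by (auto simp: in_segment)
      have eq: "s + \<sigma> * w' = (1 - k) * s + k * t" 
      proof -
        have "\<sigma> * w' = (\<sigma> * \<sigma>) * (k * (t - s))" unfolding k(3) w_def by (simp only: ac_simps)
        then show ?thesis using \<sigma>(2) by (simp add: algebra_simps)
      qed
      have "(1 - k) * s + k * t > 0" using k(1,2) s t(1) by (metis add_nonneg_pos add_pos_nonneg diff_ge_0_iff_ge less_eq_real_def mult_nonneg_nonneg mult_pos_pos mult_cancel_left2 diff_gt_0_iff_gt zero_less_one)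
      moreover have "(1 - k) * s + k * t \<le> \<rho> / 4" using k(1,2) s4 t(2) by (intro convex_bound_le) auto
      ultimately show ?thesis unfolding ray_eq eq using uniq[of "(1 - k) * s + k * t"] \<rho>(1) by force
    qed
    have Gy': "G (ray y w) \<noteq> 0" using reg by simp
    have N': "N (ray y w) = N y" using straight[of w y w] reg by simp
    obtain u' where u': "\<bar>u'\<bar> = infdist (ray y w) crit" "G (ray (ray y w) u') = 0" by (rule nearest_critical[OF Gy' ne])
    have "ray (ray y w) u' = ray y w + u' *\<^sub>R N (ray y w)" by (simp only: ray_def[of "ray y w"])
    also have "\<dots> = p + t *\<^sub>R \<nu> + u' *\<^sub>R (\<sigma> *\<^sub>R \<nu>)" unfolding N' Ny unfolding y' ..
    also have "\<dots> = p + (t + \<sigma> * u') *\<^sub>R \<nu>" by (simp add: scaleR_add_left mult.commute)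
    finally have "ray (ray y w) u' = p + (t + \<sigma> * u') *\<^sub>R \<nu>" .
    then have G': "G (p + (t + \<sigma> * u') *\<^sub>R \<nu>) = 0" using u'(2) by simp
    have "infdist (ray y w) crit \<le> dist (p + t *\<^sub>R \<nu>) p" unfolding y' using Gp by (intro infdist_le) auto
    then have ut: "\<bar>u'\<bar> \<le> t" using u'(1) \<nu> t by (simp add: dist_norm)
    then have "\<bar>t + \<sigma> * u'\<bar> \<le> \<rho> / 2" using \<sigma>(1) t by auto
    then have "t + \<sigma> * u' = 0" using uniq[OF G'] by blast
    then have "\<bar>u'\<bar> = t" using \<sigma>(1) t by auto
    then show ?thesis using u'(1) y' by simp
  qed
  show ?thesis
    by (rule that[OF Gp \<nu> perp s s_def yp inf]) (use Ny \<sigma>(1) in auto)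
qed

text \<open>Expanding one factor of \<open>w \<bullet> w\<close> by
  \<open>w = u *\<^sub>R e - s *\<^sub>R \<nu>\<close> leaves only the two small components of
  \<open>w\<close>, so \<open>w\<close> is small relative to \<open>u\<close>. Then \<open>s\<close>
  is close to \<open>u\<close>, and dividing by \<open>u\<close> compares \<open>e\<close> with
  \<open>\<nu>\<close>.\<close>

lemma chord_direction:
  assumes e: "norm e = 1" and n: "norm \<nu> = 1" and u: "0 < u" "0 \<le> s" "s \<le> u"
    and w: "w = u *\<^sub>R e - s *\<^sub>R \<nu>" and 1: "w \<bullet> e \<le> \<eta> * norm w" and 2: "- (w \<bullet> \<nu>) \<le> \<eta> * norm w" and \<eta>: "\<eta> > 0"
  shows "norm w \<le> 2 * \<eta> * u" "norm (e - \<nu>) \<le> 4 * \<eta>"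
proof -
  have "norm w * norm w = w \<bullet> w" by (simp add: dot_square_norm power2_eq_square)
  also have "\<dots> = u * (w \<bullet> e) + s * (- (w \<bullet> \<nu>))" by (subst (2) w) (simp add: inner_diff_right)
  also have "\<dots> \<le> u * (\<eta> * norm w) + s * (\<eta> * norm w)" using 1 2 u by (intro add_mono mult_left_mono) auto
  also have "\<dots> \<le> u * (\<eta> * norm w) + u * (\<eta> * norm w)" using u \<eta> by (intro add_mono mult_right_mono) auto
  finally have "norm w * norm w \<le> (2 * \<eta> * u) * norm w" by simp
  then show A: "norm w \<le> 2 * \<eta> * u" using \<eta> u by (cases "w = 0") auto
  have "\<bar>u - s\<bar> \<le> norm w" using norm_triangle_ineq3[of "u *\<^sub>R e" "s *\<^sub>R \<nu>"] e n u by (simp add: w)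
  then have "norm ((s - u) *\<^sub>R \<nu>) \<le> 2 * \<eta> * u" using A n by (simp add: abs_minus_commute)
  moreover have "u *\<^sub>R (e - \<nu>) = w + (s - u) *\<^sub>R \<nu>" by (simp add: w algebra_simps)
  ultimately have "norm (u *\<^sub>R (e - \<nu>)) \<le> 4 * \<eta> * u"
  proof -
    assume "norm ((s - u) *\<^sub>R \<nu>) \<le> 2 * \<eta> * u" and eq: "u *\<^sub>R (e - \<nu>) = w + (s - u) *\<^sub>R \<nu>"
    then show ?thesis unfolding eq using A norm_triangle_ineq[of w "(s - u) *\<^sub>R \<nu>"] by linarith
  qed
  then have "u * norm (e - \<nu>) \<le> u * (4 * \<eta>)" using u by (simp add: mult.commute)
  then show "norm (e - \<nu>) \<le> 4 * \<eta>" using u by simp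
qed

text \<open>\<open>foot\<close> describes only normals that occur at feet, while here every unit
  normal \<open>e\<close> is needed. The point \<open>q1 + u *\<^sub>R e\<close> has some foot
  \<open>p\<close> with direction \<open>\<nu>\<close>; the chord \<open>p - q1\<close> is nearly
  tangent at both ends, so \<open>p\<close> and \<open>\<nu>\<close> differ from \<open>q1\<close>
  and \<open>e\<close> by a multiple of \<open>\<eta>\<close>, and \<open>\<eta>\<close> is
  arbitrary.\<close>

lemma tube:
  assumes q: "G q = 0"
  obtains \<epsilon> where "\<epsilon> > 0" "\<And>q1 e t. G q1 = 0 \<Longrightarrow> dist q1 q < \<epsilon> \<Longrightarrow> norm e = 1 \<Longrightarrow>
    (\<And>v. v \<in> tang crit q1 \<Longrightarrow> v \<bullet> e = 0) \<Longrightarrow> 0 < t \<Longrightarrow> t \<le> \<epsilon> \<Longrightarrow> infdist (q1 + t *\<^sub>R e) crit = t"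
proof (rule unique_hit[OF q])
  fix \<rho> assume single: "single_hit q \<rho>"
  note \<rho> = single_hitD[OF single]
  show ?thesis
  proof (rule that[of "\<rho> / 8"])
    show "\<rho> / 8 > 0" using \<rho> by simp
    fix q1 e t assume h: "G q1 = 0" "dist q1 q < \<rho> / 8" "norm e = 1"
      "\<And>v. v \<in> tang crit q1 \<Longrightarrow> v \<bullet> e = 0" "0 < t" "t \<le> \<rho> / 8"
    have "\<bar>infdist (q1 + t *\<^sub>R e) crit - t\<bar> \<le> \<eta> * (2 + 4 * t)" if \<eta>: "\<eta> > 0" for \<eta>
    proof (rule crit_chord[OF h(1) \<eta>])
      fix r assume r: "r > 0" "\<And>a b. G a = 0 \<Longrightarrow> G b = 0 \<Longrightarrow> dist a q1 < r \<Longrightarrow> dist b q1 < r \<Longrightarrow>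
        \<exists>t\<in>tang crit a. norm (b - a - t) \<le> \<eta> * norm (b - a)"
      \<comment> \<open>\<open>2 * u < r\<close> puts \<open>p\<close> within the chord radius of
        \<open>q1\<close>, \<open>u < \<rho> / 8\<close> keeps \<open>y\<close> within
        \<open>\<rho> / 4\<close> of \<open>q\<close>, and \<open>u \<le> 1\<close> removes
        \<open>u\<close> from the final bound.\<close>
      define u where "u = min 1 (min (\<rho> / 16) (r / 4))"
      have u: "0 < u" "u \<le> 1" "u < \<rho> / 8" "2 * u < r" using \<rho>(1) r(1) by (auto simp: u_def)
      define y where "y = q1 + u *\<^sub>R e"
      have dy1: "dist y q1 = u" using h(3) u by (simp add: y_def dist_norm)
      have dy: "dist y q < \<rho> / 4" using dist_triangle[of y q q1] dy1 u h(2) by simp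
      have Gy: "G y \<noteq> 0"
      proof
        assume "G y = 0"
        then have "u = 0"
          using \<rho>(2)[OF h(1) _ h(3,4), of u] h(2) dy \<rho>(1) by (simp add: y_def)
        then show False using u by simp
      qed
      show ?thesis
      proof (rule foot[OF q single Gy dy])
        fix p \<nu> s assume f: "G p = 0" "norm \<nu> = 1" "\<And>v. v \<in> tang crit p \<Longrightarrow> v \<bullet> \<nu> = 0" "s > 0" "s = infdist y crit"
          "y = p + s *\<^sub>R \<nu>" "\<And>t. 0 < t \<Longrightarrow> t \<le> \<rho> / 4 \<Longrightarrow> infdist (p + t *\<^sub>R \<nu>) crit = t"
        have su: "s \<le> u" unfolding f(5) dy1[symmetric] using h(1) by (intro infdist_le) auto
        define w where "w = p - q1"
        have w: "w = u *\<^sub>R e - s *\<^sub>R \<nu>" using f(6) by (simp add: w_def y_def algebra_simps)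
        have "norm w \<le> 2 * u" using norm_triangle_ineq4[of "u *\<^sub>R e" "s *\<^sub>R \<nu>"] h(3) f(2,4) u su by (simp add: w)
        then have dp: "dist p q1 < r" using u by (simp add: w_def dist_norm)
        obtain t1 where t1: "t1 \<in> tang crit q1" "norm (w - t1) \<le> \<eta> * norm w"
          using r(2)[OF h(1) f(1) _ dp] r(1) unfolding w_def by auto
        obtain t2 where t2: "t2 \<in> tang crit p" "norm (- w - t2) \<le> \<eta> * norm w"
          using r(2)[OF f(1) h(1) dp] r(1) unfolding w_def by (auto simp: norm_minus_commute)
        have 1: "w \<bullet> e \<le> \<eta> * norm w"
          using h(4)[OF t1(1)] t1(2) norm_cauchy_schwarz[of "w - t1" e] h(3) by (simp add: inner_diff_left)
        have 2: "- (w \<bullet> \<nu>) \<le> \<eta> * norm w"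
          using f(3)[OF t2(1)] t2(2) norm_cauchy_schwarz[of "- w - t2" \<nu>] f(2) by (simp add: inner_diff_left)
        note cd = chord_direction[OF h(3) f(2) u(1) _ su w 1 2 \<eta>]
        have A: "norm w \<le> 2 * \<eta>" 
        proof -
          have "2 * \<eta> * u \<le> 2 * \<eta> * 1" using u \<eta> by (intro mult_left_mono) auto
          then show ?thesis using cd(1) f(4) by simp
        qed
        have B: "norm (e - \<nu>) \<le> 4 * \<eta>" using cd(2) f(4) by simp
        have "dist (q1 + t *\<^sub>R e) (p + t *\<^sub>R \<nu>) = norm (t *\<^sub>R (e - \<nu>) - w)"
          by (simp add: dist_norm w_def algebra_simps)
        also have "\<dots> \<le> t * norm (e - \<nu>) + norm w" using norm_triangle_ineq4[of "t *\<^sub>R (e - \<nu>)" w] h(5) by simp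
        also have "\<dots> \<le> t * (4 * \<eta>) + 2 * \<eta>" using A B h(5) by (intro add_mono mult_left_mono) auto
        finally have "dist (q1 + t *\<^sub>R e) (p + t *\<^sub>R \<nu>) \<le> \<eta> * (2 + 4 * t)" by (simp add: algebra_simps)
        moreover have "infdist (p + t *\<^sub>R \<nu>) crit = t" using f(7) h(5,6) \<rho>(1) by simp
        ultimately show ?thesis
          using infdist_triangle_abs[of "q1 + t *\<^sub>R e" crit "p + t *\<^sub>R \<nu>"] by simp
      qed
    qed
    then have "\<bar>infdist (q1 + t *\<^sub>R e) crit - t\<bar> \<le> 0 + \<epsilon>" if "\<epsilon> > 0" for \<epsilon>
      using that h(5) by (metis (no_types) add.left_neutral add_pos_pos divide_pos_pos mult_pos_pos nonzero_eq_divide_eq order_less_irrefl zero_less_numeral)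
    then have "\<bar>infdist (q1 + t *\<^sub>R e) crit - t\<bar> \<le> 0" by (rule field_le_epsilon)
    then show "infdist (q1 + t *\<^sub>R e) crit = t" by simp
  qed
qed

end

section \<open>Crossing the critical set\<close>

text \<open>Equality case of the triangle inequality: a shortest broken path has no corner.\<close>

lemma unit_eq_of_norm_add:
  fixes a b :: "'a::real_inner"
  assumes "norm a = 1" "norm b = 1" "0 < s" "0 < t" "s + t \<le> norm (s *\<^sub>R a + t *\<^sub>R b)"
  shows "a = b"
proof -
  have ab: "a \<bullet> a = 1" "b \<bullet> b = 1" using assms(1,2) norm_eq_1 by blast+
  have "(s + t)\<^sup>2 \<le> (norm (s *\<^sub>R a + t *\<^sub>R b))\<^sup>2" using assms(3-5) by (intro power_mono) auto
  also have "\<dots> = s\<^sup>2 + 2 * (s * t) * (a \<bullet> b) + t\<^sup>2"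
    unfolding power2_norm_eq_inner
    by (simp add: inner_add_left inner_add_right ab inner_commute[of b a] power2_eq_square algebra_simps)
  finally have "2 * (s * t) * 1 \<le> 2 * (s * t) * (a \<bullet> b)" by (simp add: power2_sum)
  then have "1 \<le> a \<bullet> b" using assms(3,4) by simp
  then have "(a - b) \<bullet> (a - b) \<le> 0" by (simp add: inner_diff_left inner_diff_right ab inner_commute[of b a])
  then show ?thesis using inner_ge_zero[of "a - b"] by (metis antisym inner_eq_zero_iff right_minus_eq)
qed

lemma isCont_near_in_open:
  fixes g :: "'a::metric_space \<Rightarrow> 'b::topological_space"
  assumes "isCont g t" "open S" "g t \<in> S"
  obtains d where "d > 0" "\<And>s. dist s t < d \<Longrightarrow> g s \<in> S"
proof -
  have "(g \<longlongrightarrow> g t) (nhds t)" using assms(1) by (simp add: isCont_def tendsto_at_iff_tendsto_nhds)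
  then have "\<forall>\<^sub>F s in nhds t. g s \<in> S" using assms(2,3) by (rule topological_tendstoD)
  then show ?thesis using that unfolding eventually_nhds_metric by blast
qed

context metric_critical
begin

text \<open>The point before the hit has a foot \<open>p\<close> on its own normal line, which also
  contains \<open>q\<close>. Uniqueness of hits forces \<open>p = q\<close>, and feet are
  orthogonal.\<close>

lemma hit_is_normal:
  assumes q: "G q = 0"
  obtains \<epsilon> where "\<epsilon> > 0" "\<And>e u v. norm e = 1 \<Longrightarrow> 0 < u \<Longrightarrow> u < \<epsilon> \<Longrightarrow> G (q - u *\<^sub>R e) \<noteq> 0 \<Longrightarrow>
    N (q - u *\<^sub>R e) = e \<or> N (q - u *\<^sub>R e) = - e \<Longrightarrow> v \<in> tang crit q \<Longrightarrow> v \<bullet> e = 0"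
proof (rule unique_hit[OF q])
  fix \<rho> assume single: "single_hit q \<rho>"
  note \<rho> = single_hitD[OF single]
  show ?thesis
  proof (rule that[of "\<rho> / 4"])
    show "\<rho> / 4 > 0" using \<rho> by simp
    fix e u v assume h: "norm e = 1" "0 < u" "u < \<rho> / 4" "G (q - u *\<^sub>R e) \<noteq> 0"
      "N (q - u *\<^sub>R e) = e \<or> N (q - u *\<^sub>R e) = - e" "v \<in> tang crit q"
    define y where "y = q - u *\<^sub>R e"
    have dy: "dist y q = u" using h by (simp add: y_def dist_norm)
    have Gy: "G y \<noteq> 0" and dy4: "dist y q < \<rho> / 4" using h dy by (auto simp: y_def)
    show "v \<bullet> e = 0"
    proof (rule foot[OF q single Gy dy4])
      fix p \<nu> s assume f: "G p = 0" "norm \<nu> = 1" "\<And>v. v \<in> tang crit p \<Longrightarrow> v \<bullet> \<nu> = 0" "s > 0" "s = infdist y crit"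
          "y = p + s *\<^sub>R \<nu>" "N y = \<nu> \<or> N y = - \<nu>"
      have su: "s \<le> u" unfolding f(5) dy[symmetric] using q by (intro infdist_le) auto
      have e\<nu>: "e = \<nu> \<or> e = - \<nu>" using f(7) h(5) unfolding y_def[symmetric] by auto
      then obtain \<sigma> :: real where \<sigma>: "e = \<sigma> *\<^sub>R \<nu>" "\<sigma> = 1 \<or> \<sigma> = -1" by (metis scaleR_minus1_left scaleR_one)
      have "q = y + u *\<^sub>R e" by (simp add: y_def)
      also have "\<dots> = p + (s + u * \<sigma>) *\<^sub>R \<nu>" by (simp add: \<sigma>(1) f(6) scaleR_add_left)
      finally have qp: "p + (s + u * \<sigma>) *\<^sub>R \<nu> = q" by simp
      have "dist p y = s" using f(2,4) by (simp add: f(6) dist_norm)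
      then have "dist p q < \<rho>" using dist_triangle[of p q y] dy su h(3) \<rho>(1) by simp
      then have "s + u * \<sigma> = 0" using \<rho>(2)[OF f(1) _ f(2,3), of "s + u * \<sigma>"] qp q \<rho>(1) by simp
      then have "p = q" using qp by simp
      then show ?thesis using f(3) h(6) \<sigma>(1) by simp
    qed
  qed
qed

text \<open>The tube is two-sided in \<open>t\<close>. The sign of \<open>N\<close> is left open,
  since it may differ between the two sides of a critical hypersurface.\<close>

definition tubular :: "'a \<Rightarrow> real \<Rightarrow> bool" where
  "tubular q \<epsilon> \<longleftrightarrow> 0 < \<epsilon> \<and> (\<forall>q1 e t. G q1 = 0 \<longrightarrow> dist q1 q < \<epsilon> \<longrightarrow> norm e = 1 \<longrightarrow>
    (\<forall>v\<in>tang crit q1. v \<bullet> e = 0) \<longrightarrow> 0 < \<bar>t\<bar> \<longrightarrow> \<bar>t\<bar> < \<epsilon> \<longrightarrow>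
    infdist (q1 + t *\<^sub>R e) crit = \<bar>t\<bar> \<and> G (q1 + t *\<^sub>R e) \<noteq> 0 \<and> (N (q1 + t *\<^sub>R e) = e \<or> N (q1 + t *\<^sub>R e) = - e))"

lemma tubularD:
  assumes "tubular q \<epsilon>"
  shows "0 < \<epsilon>" "\<And>q1 e t. G q1 = 0 \<Longrightarrow> dist q1 q < \<epsilon> \<Longrightarrow> norm e = 1 \<Longrightarrow>
    (\<And>v. v \<in> tang crit q1 \<Longrightarrow> v \<bullet> e = 0) \<Longrightarrow> 0 < \<bar>t\<bar> \<Longrightarrow> \<bar>t\<bar> < \<epsilon> \<Longrightarrow>
    infdist (q1 + t *\<^sub>R e) crit = \<bar>t\<bar> \<and> G (q1 + t *\<^sub>R e) \<noteq> 0 \<and> (N (q1 + t *\<^sub>R e) = e \<or> N (q1 + t *\<^sub>R e) = - e)"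
  using assms unfolding tubular_def by blast+

text \<open>The point \<open>y = q1 + t *\<^sub>R e\<close> has a critical point
  \<open>y - t *\<^sub>R n\<close> on its own normal line. Walking from
  \<open>q1 + \<epsilon> *\<^sub>R e\<close> to \<open>y\<close> and on to that point has total
  length \<open>\<epsilon>\<close>, and no critical point is nearer than \<open>\<epsilon>\<close>.
  The walk is therefore straight, so \<open>n = e\<close> and \<open>N y\<close> is parallel to
  \<open>e\<close>.\<close>

lemma tubular_exists:
  assumes q: "G q = 0"
  obtains \<epsilon> where "tubular q \<epsilon>"
proof (rule tube[OF q])
  fix \<epsilon> assume \<epsilon>: "\<epsilon> > 0" "\<And>q1 e t. G q1 = 0 \<Longrightarrow> dist q1 q < \<epsilon> \<Longrightarrow> norm e = 1 \<Longrightarrow>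
    (\<And>v. v \<in> tang crit q1 \<Longrightarrow> v \<bullet> e = 0) \<Longrightarrow> 0 < t \<Longrightarrow> t \<le> \<epsilon> \<Longrightarrow> infdist (q1 + t *\<^sub>R e) crit = t"
  have ne: "crit \<noteq> {}" using q by auto
  have pos: "infdist (q1 + t *\<^sub>R e) crit = t \<and> G (q1 + t *\<^sub>R e) \<noteq> 0 \<and> (N (q1 + t *\<^sub>R e) = e \<or> N (q1 + t *\<^sub>R e) = - e)"
    if h: "G q1 = 0" "dist q1 q < \<epsilon>" "norm e = 1" "\<And>v. v \<in> tang crit q1 \<Longrightarrow> v \<bullet> e = 0" "0 < t" "t < \<epsilon>" for q1 e t
  proof -
    define y where "y = q1 + t *\<^sub>R e"
    have inf: "infdist y crit = t" unfolding y_def by (rule \<epsilon>(2)[OF h(1-5)]) (use h in auto)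
    have Gy: "G y \<noteq> 0"
    proof
      assume "G y = 0"
      then have "infdist y crit = 0" by simp
      then show False using inf h by simp
    qed
    obtain u where u: "\<bar>u\<bar> = infdist y crit" "G (ray y u) = 0" by (rule nearest_critical[OF Gy ne])
    define n where "n = - (sgn u) *\<^sub>R N y"
    have u0: "u \<noteq> 0" using u(1) inf h(5) by auto
    have n: "norm n = 1" using Gy u0 by (simp add: n_def)
    have tn: "t *\<^sub>R n = - (u *\<^sub>R N y)" using u(1) inf u0 unfolding n_def
      by (metis abs_mult_sgn mult_minus_right scaleR_minus_left scaleR_scaleR)
    have "infdist (q1 + \<epsilon> *\<^sub>R e) crit = \<epsilon>" by (rule \<epsilon>(2)[OF h(1-4)]) (use h in auto)
    then have "\<epsilon> \<le> dist (q1 + \<epsilon> *\<^sub>R e) (ray y u)" using infdist_le[of "ray y u" crit "q1 + \<epsilon> *\<^sub>R e"] u(2) by simp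
    also have "\<dots> = norm ((\<epsilon> - t) *\<^sub>R e + t *\<^sub>R n)"
      unfolding dist_norm tn by (simp add: ray_def, simp add: y_def algebra_simps)
    finally have "(\<epsilon> - t) + t \<le> norm ((\<epsilon> - t) *\<^sub>R e + t *\<^sub>R n)" by simp
    then have "e = n" using unit_eq_of_norm_add[OF h(3) n _ h(5), of "\<epsilon> - t"] h(6) by linarith
    then have "N y = e \<or> N y = - e" using u0 by (auto simp: n_def sgn_if)
    then show ?thesis using inf Gy unfolding y_def by blast
  qed
  have "infdist (q1 + t *\<^sub>R e) crit = \<bar>t\<bar> \<and> G (q1 + t *\<^sub>R e) \<noteq> 0 \<and> (N (q1 + t *\<^sub>R e) = e \<or> N (q1 + t *\<^sub>R e) = - e)"
    if h: "G q1 = 0" "dist q1 q < \<epsilon>" "norm e = 1" "\<And>v. v \<in> tang crit q1 \<Longrightarrow> v \<bullet> e = 0" "0 < \<bar>t\<bar>" "\<bar>t\<bar> < \<epsilon>" for q1 e t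
    proof (cases "t > 0")
      case True
      then show ?thesis using pos[OF h(1-4), of t] h(6) by simp
    next
      case False
      have "norm (- e) = 1" "\<And>v. v \<in> tang crit q1 \<Longrightarrow> v \<bullet> (- e) = 0" using h(3,4) by auto
      from pos[OF h(1,2) this, of "- t"] False h(5,6) show ?thesis by auto
    qed
  then have "tubular q \<epsilon>" using \<epsilon>(1) unfolding tubular_def by blast
  then show ?thesis by (rule that)
qed

text \<open>Connectedness of the time axis. The propagated property is not \<open>good\<close>,
  which fails at hits, but being a limit of good times. At a regular limit, continuity of
  \<open>N\<close> and \<open>straight\<close> continue the line; at a critical limit the hit is
  orthogonal, and the tube makes all nearby times good on both sides.\<close>

lemma line_structure:
  assumes x: "G x \<noteq> 0"
  shows "(G (ray x t) \<noteq> 0 \<and> (N (ray x t) = N x \<or> N (ray x t) = - N x)) \<or>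
    (G (ray x t) = 0 \<and> (\<forall>v\<in>tang crit (ray x t). v \<bullet> N x = 0))"
proof -
  define good where "good = (\<lambda>t. G (ray x t) \<noteq> 0 \<and> (N (ray x t) = N x \<or> N (ray x t) = - N x))"
  define P where "P = (\<lambda>t. \<forall>\<epsilon>>0. \<exists>s. good s \<and> \<bar>s - t\<bar> < \<epsilon>)"
  have ray_ray: "ray (ray x t) w = ray x (t + \<sigma> * w)" if "N (ray x t) = \<sigma> *\<^sub>R N x" for t w \<sigma>
    using that unfolding ray_def[of "ray x t"] by (simp add: ray_def algebra_simps)
  have c_cont: "isCont (ray x) t" for t unfolding ray_def by (intro continuous_intros)
  have reg: "good t" if P: "P t" and G: "G (ray x t) \<noteq> 0" for t
  proof (rule ccontr)
    assume "\<not> good t"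
    then have ne: "N (ray x t) \<noteq> N x" "N (ray x t) \<noteq> - N x" using G by (auto simp: good_def)
    have "isCont (\<lambda>s. N (ray x s)) t" by (rule isCont_o2[OF c_cont N_isCont[OF G]])
    then obtain d where d: "d > 0" "\<And>s. dist s t < d \<Longrightarrow> N (ray x s) \<in> - {N x, - N x}"
      by (rule isCont_near_in_open[where S="- {N x, - N x}"]) (use ne in auto)
    obtain s where "good s" "\<bar>s - t\<bar> < d" using P d(1) unfolding P_def by blast
    then show False using d(2)[of s] by (auto simp: good_def dist_real_def)
  qed
  have reg_nbhd: "\<exists>\<epsilon>>0. \<forall>s. \<bar>s - t\<bar> < \<epsilon> \<longrightarrow> good s" if g: "good t" for t
  proof -
    have G: "G (ray x t) \<noteq> 0" using g by (simp add: good_def)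
    obtain \<sigma> where \<sigma>: "N (ray x t) = \<sigma> *\<^sub>R N x" "\<sigma> = 1 \<or> \<sigma> = -1"
      using g unfolding good_def by (metis scaleR_minus1_left scaleR_one)
    have "isCont (\<lambda>s. G (ray x s)) t"
      using isCont_o2[OF c_cont] G_deriv has_derivative_continuous by blast
    then obtain d where d0: "d > 0" "\<And>s. dist s t < d \<Longrightarrow> G (ray x s) \<in> - {0}"
      by (rule isCont_near_in_open[where S="- {0}"]) (use G in auto)
    have d: "d > 0" "\<And>s. dist s t < d \<Longrightarrow> G (ray x s) \<noteq> 0" using d0 by auto
    have "good s" if s: "\<bar>s - t\<bar> < d" for s
    proof -
      define w where "w = \<sigma> * (s - t)"
      have sw: "t + \<sigma> * w = s" using \<sigma>(2) by (auto simp: w_def)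
      have "G (ray (ray x t) w') \<noteq> 0" if w': "w' \<in> closed_segment 0 w" for w'
      proof -
        have "\<bar>w'\<bar> \<le> \<bar>w\<bar>" using w' by (auto simp: closed_segment_eq_real_ivl split: if_splits)
        moreover have "\<bar>w\<bar> = \<bar>s - t\<bar>" "\<bar>\<sigma> * w'\<bar> = \<bar>w'\<bar>" using \<sigma>(2) by (auto simp: w_def)
        ultimately show ?thesis unfolding ray_ray[OF \<sigma>(1)] using s by (intro d(2)) (simp add: dist_real_def)
      qed
      from straight[of w "ray x t" w, OF this] have "N (ray x s) = N (ray x t)" using ray_ray[OF \<sigma>(1), of w] sw by simp
      then show ?thesis using g d(2)[of s] s by (simp add: good_def dist_real_def)
    qed
    then show ?thesis using d(1) by blast
  qed
  have crit_case: "(\<forall>v\<in>tang crit (ray x t). v \<bullet> N x = 0) \<and> (\<exists>\<epsilon>>0. \<forall>s. 0 < \<bar>s - t\<bar> \<and> \<bar>s - t\<bar> < \<epsilon> \<longrightarrow> good s)"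
    if P: "P t" and G: "G (ray x t) = 0" for t
  proof (rule hit_is_normal[OF G])
    fix \<epsilon> assume \<epsilon>: "\<epsilon> > 0" "\<And>e u v. norm e = 1 \<Longrightarrow> 0 < u \<Longrightarrow> u < \<epsilon> \<Longrightarrow> G (ray x t - u *\<^sub>R e) \<noteq> 0 \<Longrightarrow>
      N (ray x t - u *\<^sub>R e) = e \<or> N (ray x t - u *\<^sub>R e) = - e \<Longrightarrow> v \<in> tang crit (ray x t) \<Longrightarrow> v \<bullet> e = 0"
    obtain s where s: "good s" "\<bar>s - t\<bar> < \<epsilon>" using P \<epsilon>(1) unfolding P_def by blast
    have st: "s \<noteq> t" using s(1) G by (auto simp: good_def)
    define e where "e = sgn (t - s) *\<^sub>R N x"
    have eq: "ray x t - \<bar>s - t\<bar> *\<^sub>R e = ray x s"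
    proof -
      have "t - \<bar>s - t\<bar> * sgn (t - s) = s" by (auto simp: sgn_if abs_if)
      moreover have "ray x t - \<bar>s - t\<bar> *\<^sub>R e = x + (t - \<bar>s - t\<bar> * sgn (t - s)) *\<^sub>R N x"
        by (simp add: e_def ray_def scaleR_diff_left)
      ultimately show ?thesis by (simp add: ray_def)
    qed
    have eN: "e = N x \<or> e = - N x" using st by (auto simp: e_def sgn_if)
    have n: "v \<bullet> N x = 0" if v: "v \<in> tang crit (ray x t)" for v
    proof -
      have "v \<bullet> e = 0"
      proof (rule \<epsilon>(2)[of e "\<bar>s - t\<bar>", OF _ _ s(2) _ _ v])
        show "norm e = 1" using eN x by auto
        show "0 < \<bar>s - t\<bar>" using st by simp
        show "G (ray x t - \<bar>s - t\<bar> *\<^sub>R e) \<noteq> 0" unfolding eq using s(1) by (simp add: good_def)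
        show "N (ray x t - \<bar>s - t\<bar> *\<^sub>R e) = e \<or> N (ray x t - \<bar>s - t\<bar> *\<^sub>R e) = - e"
          unfolding eq using s(1) eN by (auto simp: good_def)
      qed
      then show ?thesis using eN by auto
    qed
    show ?thesis
    proof (rule tubular_exists[OF G])
      fix \<epsilon> assume "tubular (ray x t) \<epsilon>"
      note \<epsilon> = tubularD[OF this]
      have "good s" if s: "0 < \<bar>s - t\<bar>" "\<bar>s - t\<bar> < \<epsilon>" for s
      proof -
        have "ray x t + (s - t) *\<^sub>R N x = ray x s" by (simp add: ray_def algebra_simps)
        then show ?thesis using \<epsilon>(2)[OF G _ _ n s] \<epsilon>(1) x by (simp add: good_def)
      qed
      then show ?thesis using n \<epsilon>(1) by blast
    qed
  qed
  have "P t"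
  proof (rule connected_clopen_induct[of UNIV 0 P t])
    have "good 0" using x by (simp add: good_def ray_def)
    then show "P 0" unfolding P_def by (metis abs_zero diff_self)
  next
    fix r assume P: "P r"
    have "\<exists>\<epsilon>>0. \<forall>s. 0 < \<bar>s - r\<bar> \<and> \<bar>s - r\<bar> < \<epsilon> \<longrightarrow> good s"
    proof (cases "G (ray x r) = 0")
      case True
      then show ?thesis using crit_case[OF P] by blast
    next
      case False
      then show ?thesis using reg_nbhd[OF reg[OF P]] by blast
    qed
    then obtain \<epsilon> where e: "\<epsilon> > 0" "\<And>s. 0 < \<bar>s - r\<bar> \<Longrightarrow> \<bar>s - r\<bar> < \<epsilon> \<Longrightarrow> good s" by blast
    have "P z" if "dist z r < \<epsilon>" for z
    proof (cases "z = r")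
      case False
      then have "good z" using e(2)[of z] that by (simp add: dist_real_def)
      then show ?thesis unfolding P_def by (metis abs_zero diff_self)
    qed (use P in simp)
    then show "\<exists>\<epsilon>>0. \<forall>z\<in>UNIV. dist z r < \<epsilon> \<longrightarrow> P z" using e(1) by blast
  next
    fix r :: real assume cl: "\<And>\<epsilon>. \<epsilon> > 0 \<Longrightarrow> \<exists>z\<in>UNIV. P z \<and> dist z r < \<epsilon>"
    show "P r" unfolding P_def
    proof (intro allI impI)
      fix \<epsilon> :: real assume "\<epsilon> > 0"
      then obtain z where z: "P z" "dist z r < \<epsilon> / 2" using cl[of "\<epsilon> / 2"] by auto
      then obtain s where "good s" "\<bar>s - z\<bar> < \<epsilon> / 2" using \<open>\<epsilon> > 0\<close> half_gt_zero unfolding P_def by blast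
      moreover from this have "\<bar>s - r\<bar> < \<epsilon>" using z(2) unfolding dist_real_def by linarith
      ultimately show "\<exists>s. good s \<and> \<bar>s - r\<bar> < \<epsilon>" by blast
    qed
  qed auto
  then show ?thesis
    using reg crit_case unfolding good_def by blast
qed

lemma ray_reg_isolated:
  assumes x: "G x \<noteq> 0"
  obtains \<epsilon> where "\<epsilon> > 0" "\<And>s. 0 < \<bar>s - t\<bar> \<Longrightarrow> \<bar>s - t\<bar> < \<epsilon> \<Longrightarrow> G (ray x s) \<noteq> 0"
proof (cases "G (ray x t) = 0")
  case True
  then have n: "\<And>v. v \<in> tang crit (ray x t) \<Longrightarrow> v \<bullet> N x = 0" using line_structure[OF x, of t] by blast
  show ?thesis
  proof (rule tubular_exists[OF True])
    fix \<epsilon> assume "tubular (ray x t) \<epsilon>"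
    note \<epsilon> = tubularD[OF this]
    show ?thesis
    proof (rule that[OF \<epsilon>(1)])
      fix s assume s: "0 < \<bar>s - t\<bar>" "\<bar>s - t\<bar> < \<epsilon>"
      have "ray x t + (s - t) *\<^sub>R N x = ray x s" by (simp add: ray_def algebra_simps)
      then show "G (ray x s) \<noteq> 0" using \<epsilon>(2)[OF True _ _ n s] \<epsilon>(1) x by simp
    qed
  qed
next
  case False
  have "isCont (ray x) t" unfolding ray_def by (intro continuous_intros)
  then have "isCont (\<lambda>s. G (ray x s)) t"
    using isCont_o2 G_deriv has_derivative_continuous by blast
  then obtain d where d0: "d > 0" "\<And>s. dist s t < d \<Longrightarrow> G (ray x s) \<in> - {0}"
    by (rule isCont_near_in_open[where S="- {0}"]) (use False in auto)
  have d: "d > 0" "\<And>s. dist s t < d \<Longrightarrow> G (ray x s) \<noteq> 0" using d0 by auto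
  then show ?thesis using that by (simp add: dist_real_def)
qed

text \<open>\<open>line_structure\<close> provides the parallelism that \<open>transport\<close>
  needs for a single time, so critical points may lie in between.\<close>

lemma transport_all:
  assumes "G x \<noteq> 0" "G (ray x t) \<noteq> 0" "y \<in> leaf x"
  shows "G (ray y t) \<noteq> 0" "ray y t \<in> leaf (ray x t)" "N (ray y t) \<bullet> N y = N (ray x t) \<bullet> N x"
proof -
  have "\<forall>z. G z \<noteq> 0 \<and> (\<forall>u\<in>{t}. G (ray z u) \<noteq> 0) \<longrightarrow> (\<forall>u\<in>{t}. N (ray z u) = N z \<or> N (ray z u) = - N z)"
    using line_structure by blast
  from transport[OF _ this assms(1) _ assms(3)] assms(2)
  show "G (ray y t) \<noteq> 0" "ray y t \<in> leaf (ray x t)" "N (ray y t) \<bullet> N y = N (ray x t) \<bullet> N x" by auto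
qed

lemma leaf_sym: "y \<in> leaf x \<Longrightarrow> x \<in> leaf y"
  using leaf_eq leaf_refl by blast

text \<open>A regular \<open>ray y t\<close> could be transported back along the leaf to show that
  \<open>ray x t\<close> is regular. Connectedness of the leaf keeps all images in one
  component.\<close>

lemma transport_crit:
  assumes "G x \<noteq> 0" "G (ray x t) = 0" "y \<in> leaf x"
  shows "G (ray y t) = 0" "ray y t \<in> ccomp (ray x t)"
proof -
  have crit0: "G (ray z t) = 0" if z: "z \<in> leaf x" for z
    using transport_all(1)[OF _ _ leaf_sym[OF z], of t] assms(1,2) leaf_reg[OF z] by blast
  then show "G (ray y t) = 0" using assms(3) by blast
  have "continuous_on (leaf x) (\<lambda>z. ray z t)"
    using ray_isCont leaf_reg assms(1) continuous_at_imp_continuous_on by blast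
  then have "connected ((\<lambda>z. ray z t) ` leaf x)" using leaf_connected connected_continuous_image by blast
  then have "(\<lambda>z. ray z t) ` leaf x \<subseteq> ccomp (ray x t)"
    unfolding ccomp_def by (rule connected_component_maximal[rotated]) (use crit0 in auto)
  then show "ray y t \<in> ccomp (ray x t)" using assms(3) by blast
qed

end

section \<open>Focal points\<close>

lemma finite_positive_lower_bound:
  assumes "finite (K :: real set)" "\<And>k. k \<in> K \<Longrightarrow> 0 < k"
  shows "\<exists>s>0. \<forall>k\<in>K. s < k"
  using assms
proof (induction K rule: finite_induct)
  case empty
  show ?case by (rule exI[of _ 1]) simp
next
  case (insert k K)
  then obtain s where s: "s > 0" "\<forall>k\<in>K. s < k" by blast
  have "0 < k" using insert by blast
  then show ?case using s by (intro exI[of _ "min s (k / 2)"]) auto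
qed

context metric_critical
begin

text \<open>Near \<open>x\<close> the normals satisfy
  \<open>N (ray z t) = \<sigma> *\<^sub>R N z\<close> with a fixed sign. Differentiating in
  direction \<open>v\<close> gives \<open>A (ray x t) ((1 + t * \<mu>) *\<^sub>R v) = (\<sigma> *
  \<mu>) *\<^sub>R v\<close>, whose right side is nonzero.\<close>

lemma regular_not_focal:
  assumes x: "G x \<noteq> 0" and t: "G (ray x t) \<noteq> 0" and v: "A x v = \<mu> *\<^sub>R v" "\<mu> \<noteq> 0" "v \<noteq> 0"
  shows "1 + t * \<mu> \<noteq> 0"
proof
  assume 0: "1 + t * \<mu> = 0"
  obtain \<sigma> where \<sigma>: "N (ray x t) = \<sigma> *\<^sub>R N x" "\<sigma> = 1 \<or> \<sigma> = -1"
    using line_structure[OF x, of t] t by (metis scaleR_minus1_left scaleR_one)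
  define h where "h = (\<lambda>z. N (ray z t) - \<sigma> *\<^sub>R N z)"
  have hd: "(h has_derivative (\<lambda>v. A (ray x t) (v + t *\<^sub>R A x v) - \<sigma> *\<^sub>R A x v)) (at x)"
    unfolding h_def
    by (intro has_derivative_diff has_derivative_scaleR_right has_derivative_compose[OF ray_deriv[OF x] N_deriv[OF t]] N_deriv[OF x])
  have hx: "h x = 0" by (simp add: h_def \<sigma>)
  \<comment> \<open>The opposite sign would give \<open>norm (h z) = 2\<close>, so staying in
    \<open>ball 0 2\<close> fixes the sign near \<open>x\<close>.\<close>
  obtain d1 where d1: "d1 > 0" "\<And>z. dist z x < d1 \<Longrightarrow> h z \<in> ball 0 2"
    by (rule isCont_near_in_open[OF has_derivative_continuous[OF hd], of "ball 0 2"]) (auto simp: hx)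
  have op: "open {z. G z \<noteq> 0 \<and> (\<forall>u\<in>{t}. G (ray z u) \<noteq> 0)}" by (rule open_ray_reg) simp
  have "(h has_derivative (\<lambda>v. 0)) (at x)"
  proof (rule has_derivative_transform_within_open[OF has_derivative_const])
    let ?W = "ball x d1 \<inter> {z. G z \<noteq> 0 \<and> (\<forall>u\<in>{t}. G (ray z u) \<noteq> 0)}"
    show "open ?W" using op by blast
    show "x \<in> ?W" using x t d1(1) by simp
    fix z assume z: "z \<in> ?W"
    then have Gz: "G z \<noteq> 0" "G (ray z t) \<noteq> 0" by auto
    then have "N (ray z t) = N z \<or> N (ray z t) = - N z" using line_structure by blast
    then have "h z = 0 \<or> norm (h z) = 2"
    proof (elim disjE)
      assume "N (ray z t) = N z"
      then have "h z = (1 - \<sigma>) *\<^sub>R N z" by (simp add: h_def scaleR_diff_left)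
      then show ?thesis using \<sigma>(2) Gz by auto
    next
      assume "N (ray z t) = - N z"
      then have "h z = (- 1 - \<sigma>) *\<^sub>R N z" by (simp add: h_def scaleR_diff_left)
      then show ?thesis using \<sigma>(2) Gz by auto
    qed
    moreover have "norm (h z) < 2" using d1(2)[of z] z by (auto simp: dist_commute)
    ultimately show "0 = h z" by auto
  qed
  then have "(\<lambda>v. A (ray x t) (v + t *\<^sub>R A x v) - \<sigma> *\<^sub>R A x v) = (\<lambda>v. 0)"
    using has_derivative_unique[OF hd] by blast
  from fun_cong[OF this, of v] have "A (ray x t) ((1 + t * \<mu>) *\<^sub>R v) = (\<sigma> * \<mu>) *\<^sub>R v"
    by (simp add: v(1) scaleR_add_left)
  then show False using 0 \<sigma>(2) v(2,3) by (auto simp: A_simps)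
qed

lemma ray_leaf_curve:
  assumes x: "G x \<noteq> 0" and q: "G (ray x t) = 0" and v: "v \<bullet> N x = 0"
  obtains \<gamma> \<delta> where "\<delta> > 0" "\<gamma> 0 = x" "(\<gamma> has_vector_derivative v) (at 0)"
    "((\<lambda>r. ray (\<gamma> r) t) has_vector_derivative (v + t *\<^sub>R A x v)) (at 0)"
    "((\<lambda>r. N (\<gamma> r)) has_vector_derivative A x v) (at 0)"
    "\<And>r. \<bar>r\<bar> < \<delta> \<Longrightarrow> G (\<gamma> r) \<noteq> 0 \<and> G (ray (\<gamma> r) t) = 0"
proof -
  have v': "v \<bullet> G x = 0" using perp_N_iff[OF x] v by blast
  show ?thesis
  proof (rule level_curve[OF x v' open_UNIV UNIV_I])
    fix \<delta> \<gamma> assume \<delta>: "(0::real) < \<delta>" and \<gamma>: "\<gamma> 0 = x" "(\<gamma> has_vector_derivative v) (at 0)"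
      "\<And>s. \<bar>s\<bar> < \<delta> \<Longrightarrow> \<gamma> s \<in> UNIV \<and> \<gamma> s \<in> leaf x \<and> isCont \<gamma> s"
    note g = \<gamma>(2)[unfolded has_vector_derivative_def]
    have 1: "((\<lambda>r. ray (\<gamma> r) t) has_derivative (\<lambda>h. h *\<^sub>R v + t *\<^sub>R A x (h *\<^sub>R v))) (at 0)"
      by (rule has_derivative_compose[OF g]) (use ray_deriv[OF x] \<gamma>(1) in simp)
    have 2: "((\<lambda>r. N (\<gamma> r)) has_derivative (\<lambda>h. A x (h *\<^sub>R v))) (at 0)"
      by (rule has_derivative_compose[OF g]) (use N_deriv[OF x] \<gamma>(1) in simp)
    show ?thesis
    proof (rule that[OF \<delta> \<gamma>(1,2)])
      show "((\<lambda>r. ray (\<gamma> r) t) has_vector_derivative (v + t *\<^sub>R A x v)) (at 0)"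
        using 1 by (simp add: has_vector_derivative_def A_simps scaleR_add_right mult.commute)
      show "((\<lambda>r. N (\<gamma> r)) has_vector_derivative A x v) (at 0)"
        using 2 by (simp add: has_vector_derivative_def A_simps)
      fix r assume "\<bar>r\<bar> < \<delta>"
      then have l: "\<gamma> r \<in> leaf x" using \<gamma>(3) by blast
      then show "G (\<gamma> r) \<noteq> 0 \<and> G (ray (\<gamma> r) t) = 0" using transport_crit(1)[OF x q l] leaf_reg x by blast
    qed
  qed
qed

text \<open>The leaf of \<open>x\<close> is carried into the critical set at time \<open>t\<close>,
  so the derivative of this map takes tangential vectors to tangent vectors of
  \<open>crit\<close>.\<close>

lemma ray_tang:
  assumes x: "G x \<noteq> 0" and q: "G (ray x t) = 0" and v: "v \<bullet> N x = 0"
  shows "v + t *\<^sub>R A x v \<in> tang crit (ray x t)"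
proof (rule ray_leaf_curve[OF x q v])
  fix \<gamma> \<delta> assume g: "(\<delta>::real) > 0" "\<gamma> 0 = x"
    "((\<lambda>r. ray (\<gamma> r) t) has_vector_derivative (v + t *\<^sub>R A x v)) (at 0)"
    "\<And>r. \<bar>r\<bar> < \<delta> \<Longrightarrow> G (\<gamma> r) \<noteq> 0 \<and> G (ray (\<gamma> r) t) = 0"
  have "\<forall>\<^sub>F r in at 0. ray (\<gamma> r) t \<in> crit"
    unfolding eventually_at using g(1,4) by (intro exI[of _ \<delta>]) (auto simp: dist_real_def)
  then show ?thesis unfolding tang_def using g(2,3) by (intro CollectI exI[of _ "\<lambda>r. ray (\<gamma> r) t"]) simp
qed

text \<open>Dimension count: the hyperplane orthogonal to \<open>N x\<close> is mapped linearly into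
  a tangent space of dimension at most \<open>DIM('a) - 2\<close>, so the map has a kernel.\<close>

lemma singular_is_focal:
  assumes x: "G x \<noteq> 0" and q: "G (ray x t) = 0" and d: "regular_surface d (ccomp (ray x t))" "d + 2 \<le> DIM('a)"
  shows "\<exists>v. v \<noteq> 0 \<and> v + t *\<^sub>R A x v = 0"
proof (rule ccontr)
  assume no: "\<not> ?thesis"
  interpret B: bounded_linear "A x" by (rule A_linear)
  let ?B = "\<lambda>v. v + t *\<^sub>R A x v"
  let ?P = "{v. N x \<bullet> v = 0}"
  have lin: "linear ?B" by (intro linear_compose_add linear_ident linear_compose_scale_right B.linear)
  have "inj ?B" using linear_injective_0[OF lin] no by blast
  then have "dim (?B ` ?P) = dim ?P" by (intro dim_image_eq[OF lin]) (auto intro: inj_on_subset)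
  also have "\<dots> = DIM('a) - 1" using x by (intro dim_hyperplane) simp
  finally have 1: "dim (?B ` ?P) = DIM('a) - 1" .
  have "?B ` ?P \<subseteq> tang (ccomp (ray x t)) (ray x t)"
    using ray_tang[OF x q] tang_crit[OF q] by (auto simp: inner_commute)
  then have "dim (?B ` ?P) \<le> d" using dim_subset surface_tang(2)[OF d(1) comp_refl[OF q]] by metis
  then show False using 1 d(2) by linarith
qed

text \<open>The segment from \<open>a\<close> to \<open>b\<close> crosses the zero set of
  \<open>\<xi>\<close>, and the critical point found there is at least \<open>\<delta>\<close> away
  from both ends.\<close>

lemma ball_side_distance:
  assumes U: "ball q r \<subseteq> U" "continuous_on U \<xi>" "\<And>z. z \<in> U \<Longrightarrow> \<xi> z = (0::real) \<Longrightarrow> G z = 0"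
    and ab: "a \<in> ball q r" "b \<in> ball q r" "\<xi> a * \<xi> b < 0" and inf: "infdist a crit = \<delta>" "infdist b crit = \<delta>"
  shows "2 * \<delta> \<le> norm (a - b)"
proof -
  have sub: "closed_segment a b \<subseteq> U" using ab U(1) closed_segment_subset[OF ab(1,2) convex_ball] by blast
  have c: "continuous_on {0..1} (\<lambda>u. \<xi> ((1 - u) *\<^sub>R a + u *\<^sub>R b))"
  proof (rule continuous_on_compose2[OF U(2)])
    show "(\<lambda>u. (1 - u) *\<^sub>R a + u *\<^sub>R b) ` {0..1} \<subseteq> U"
    proof (rule image_subsetI)
      fix u :: real assume "u \<in> {0..1}"
      then have "(1 - u) *\<^sub>R a + u *\<^sub>R b \<in> closed_segment a b" unfolding closed_segment_def by auto
      then show "(1 - u) *\<^sub>R a + u *\<^sub>R b \<in> U" using sub by blast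
    qed
  qed (intro continuous_intros)
  have "\<exists>u. 0 \<le> u \<and> u \<le> 1 \<and> \<xi> ((1 - u) *\<^sub>R a + u *\<^sub>R b) = 0"
  proof (cases "\<xi> a < 0")
    case True
    then have "\<xi> b > 0" using ab(3) by (simp add: mult_less_0_iff)
    then show ?thesis using IVT'[of "\<lambda>u. \<xi> ((1 - u) *\<^sub>R a + u *\<^sub>R b)" 0 0 1] c True by auto
  next
    case False
    then have "\<xi> a > 0" "\<xi> b < 0" using ab(3) by (auto simp: mult_less_0_iff)
    then show ?thesis using IVT2'[of "\<lambda>u. \<xi> ((1 - u) *\<^sub>R a + u *\<^sub>R b)" 1 0 0] c by auto
  qed
  then obtain u where u: "0 \<le> u" "u \<le> 1" "\<xi> ((1 - u) *\<^sub>R a + u *\<^sub>R b) = 0" by blast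
  define k where "k = (1 - u) *\<^sub>R a + u *\<^sub>R b"
  have "k \<in> closed_segment a b" using u unfolding k_def closed_segment_def by blast
  then have "k \<in> crit" using U(3) sub u(3) by (auto simp: k_def)
  then have "\<delta> \<le> dist a k" "\<delta> \<le> dist b k" using inf infdist_le by metis+
  moreover have "dist a k = u * norm (a - b)"
  proof -
    have "a - k = u *\<^sub>R (a - b)" by (simp add: k_def algebra_simps)
    then show ?thesis using u by (simp add: dist_norm)
  qed
  moreover have "dist b k = (1 - u) * norm (a - b)"
  proof -
    have "b - k = - ((1 - u) *\<^sub>R (a - b))" by (simp add: k_def algebra_simps)
    then show ?thesis using u by (simp add: dist_norm)
  qed
  ultimately show ?thesis by (simp add: algebra_simps)
qed

text \<open>With \<open>b = \<delta> *\<^sub>R n + \<delta> *\<^sub>R e\<close>, the parallelogram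
  law for \<open>p\<close> and \<open>b\<close> gives
  \<open>4 * \<delta>\<^sup>2 \<le> p \<bullet> p + b \<bullet> b\<close>, while
  \<open>b \<bullet> b\<close> falls short of \<open>4 * \<delta>\<^sup>2\<close> by exactly the
  square of \<open>\<delta> * norm (n - e)\<close>.\<close>

lemma parallelogram_gap:
  fixes p e n :: "'b::real_inner"
  assumes e: "norm e = 1" "norm n = 1" and d: "\<delta> > 0"
    and 1: "2 * \<delta> \<le> norm (p + \<delta> *\<^sub>R n + \<delta> *\<^sub>R e)" and 2: "2 * \<delta> \<le> norm (p - \<delta> *\<^sub>R n - \<delta> *\<^sub>R e)"
  shows "\<delta> * norm (n - e) \<le> norm p"
proof -
  have ee: "e \<bullet> e = 1" "n \<bullet> n = 1" using e norm_eq_1 by blast+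
  define b where "b = \<delta> *\<^sub>R n + \<delta> *\<^sub>R e"
  have "2 * \<delta> \<le> norm (p + b)" "2 * \<delta> \<le> norm (p - b)"
    using 1 2 by (simp_all add: b_def add.assoc diff_diff_add)
  then have "(2 * \<delta>)\<^sup>2 \<le> (norm (p + b))\<^sup>2" "(2 * \<delta>)\<^sup>2 \<le> (norm (p - b))\<^sup>2"
    using power_mono[of "2 * \<delta>" "norm (p + b)" 2] power_mono[of "2 * \<delta>" "norm (p - b)" 2] d by simp_all
  moreover have "(norm (p + b))\<^sup>2 + (norm (p - b))\<^sup>2 = 2 * (p \<bullet> p) + 2 * (b \<bullet> b)"
    unfolding power2_norm_eq_inner by (simp add: inner_add_left inner_add_right inner_diff_left inner_diff_right)
  ultimately have "4 * \<delta>\<^sup>2 \<le> p \<bullet> p + b \<bullet> b" by (simp add: power_mult_distrib)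
  moreover have "b \<bullet> b + \<delta>\<^sup>2 * ((n - e) \<bullet> (n - e)) = 4 * \<delta>\<^sup>2"
    by (simp add: b_def inner_add_left inner_add_right inner_diff_left inner_diff_right ee inner_commute[of e n] power2_eq_square algebra_simps)
  ultimately have "(\<delta> * norm (n - e))\<^sup>2 \<le> (norm p)\<^sup>2"
    by (simp add: power_mult_distrib power2_norm_eq_inner)
  then show ?thesis by (rule power2_le_imp_le) simp
qed

text \<open>Move along the leaf with velocity \<open>v\<close>. At a focal time the hit
  \<open>Q s\<close> has zero velocity, while the normal \<open>n s\<close> turns with velocity
  \<open>\<mu> *\<^sub>R v\<close>. The points \<open>Q s + \<delta> *\<^sub>R n s\<close> and
  \<open>q - \<delta> *\<^sub>R e\<close> lie on opposite sides of the hypersurface at distance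
  \<open>\<delta>\<close> from it, and so does the pair with the signs exchanged. Hence
  \<open>\<delta> * norm (n s - e) \<le> norm (Q s - q)\<close>, which bounds a term of order
  \<open>s\<close> by one of smaller order.\<close>

lemma hypersurface_not_focal:
  assumes x: "G x \<noteq> 0" and Gq: "G (ray x t) = 0" and d: "regular_surface (DIM('a) - 1) (ccomp (ray x t))"
    and v: "A x v = \<mu> *\<^sub>R v" "\<mu> \<noteq> 0" "v \<noteq> 0"
  shows "1 + t * \<mu> \<noteq> 0"
proof
  assume 0: "1 + t * \<mu> = 0"
  define q where "q = ray x t"
  define e where "e = N x"
  note Gq = Gq[folded q_def]
  have e: "norm e = 1" using x by (simp add: e_def)
  have vN: "v \<bullet> N x = 0" using A_perp[OF x, of v] v by simp
  have v0: "v + t *\<^sub>R A x v = 0"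
  proof -
    have "v + t *\<^sub>R A x v = (1 + t * \<mu>) *\<^sub>R v" by (simp add: v(1) scaleR_add_left)
    then show ?thesis using 0 by simp
  qed
  have perp: "w \<bullet> N z = 0" if "G z \<noteq> 0" "G (ray z t) = 0" "w \<in> tang crit (ray z t)" for z w
    using line_structure[OF that(1), of t] that(2,3) by blast
  have "e \<notin> tang crit q"
  proof
    assume "e \<in> tang crit q"
    then have "e \<bullet> e = 0" using perp[OF x] Gq unfolding q_def e_def by blast
    then show False using e by simp
  qed
  then have et: "e \<notin> tang (ccomp q) q" using tang_crit[OF Gq] by simp
  show False
  proof (rule hypersurface_side[OF d[folded q_def] comp_refl[OF Gq] et])
    fix U \<xi> \<xi>' assume U: "open U" "q \<in> U" "continuous_on U \<xi>" "\<And>z. z \<in> U \<Longrightarrow> (\<xi> z = (0::real)) = (z \<in> ccomp q)"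
      "(\<xi> has_derivative \<xi>') (at q)" "\<xi>' e \<noteq> 0"
    have Ucrit: "G z = 0" if "z \<in> U" "\<xi> z = 0" for z
    proof -
      have "z \<in> ccomp q" using U(4)[OF that(1)] that(2) by blast
      then show ?thesis using comp_subset[of q] by auto
    qed
    interpret X: bounded_linear \<xi>' using U(5) has_derivative_bounded_linear by blast
    have \<xi>q: "\<xi> q = 0" using U(2,4) comp_refl[OF Gq] by blast
    obtain r where r: "r > 0" "ball q r \<subseteq> U" using U(1,2) open_contains_ball by blast
    have "\<bar>\<xi>' e\<bar> / 2 > 0" using U(6) by simp
    then obtain d1 where d1: "d1 > 0" "\<And>z. norm (z - q) < d1 \<Longrightarrow> norm (\<xi> z - \<xi> q - \<xi>' (z - q)) \<le> \<bar>\<xi>' e\<bar> / 2 * norm (z - q)"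
      using U(5) unfolding has_derivative_at_alt by blast
    show False
    proof (rule tubular_exists[OF Gq])
      fix \<epsilon> assume "tubular q \<epsilon>"
      note \<epsilon> = tubularD[OF this]
      define \<delta> where "\<delta> = min \<epsilon> (min r d1) / 2"
      have \<delta>: "\<delta> > 0" "\<delta> < \<epsilon>" "\<delta> < r" "\<delta> < d1" using \<epsilon>(1) r(1) d1(1) by (auto simp: \<delta>_def)
      define P where "P = q + \<delta> *\<^sub>R e"
      define M where "M = q - \<delta> *\<^sub>R e"
      have PM: "P \<in> ball q r" "M \<in> ball q r" using e \<delta> by (auto simp: P_def M_def dist_norm)
      have sP: "\<bar>\<xi> P - \<delta> * \<xi>' e\<bar> \<le> \<bar>\<xi>' e\<bar> / 2 * \<delta>" using d1(2)[of P] e \<delta> \<xi>q by (simp add: P_def X.scaleR)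
      have sM: "\<bar>\<xi> M + \<delta> * \<xi>' e\<bar> \<le> \<bar>\<xi>' e\<bar> / 2 * \<delta>" using d1(2)[of M] e \<delta> \<xi>q by (simp add: M_def X.scaleR X.neg)
      \<comment> \<open>The linear prediction for \<open>\<xi>\<close> at \<open>P\<close>, and its
        negative at \<open>M\<close>; the errors are at most half of it, so the two values have
        opposite signs.\<close>
      define k where "k = \<delta> * \<xi>' e"
      have k: "k \<noteq> 0" "\<bar>\<xi>' e\<bar> / 2 * \<delta> = \<bar>k\<bar> / 2" using \<delta>(1) U(6) by (auto simp: k_def abs_mult)
      have sign: "\<xi> P * \<xi> M < 0"
        using sP sM k unfolding k(2) k_def[symmetric] mult_less_0_iff by linarith
      show False
      proof (rule ray_leaf_curve[OF x Gq[unfolded q_def] vN])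
        fix \<gamma> \<eta> assume g: "(\<eta>::real) > 0" "\<gamma> 0 = x" "(\<gamma> has_vector_derivative v) (at 0)"
          "((\<lambda>r. ray (\<gamma> r) t) has_vector_derivative (v + t *\<^sub>R A x v)) (at 0)"
          "((\<lambda>r. N (\<gamma> r)) has_vector_derivative A x v) (at 0)"
          "\<And>r. \<bar>r\<bar> < \<eta> \<Longrightarrow> G (\<gamma> r) \<noteq> 0 \<and> G (ray (\<gamma> r) t) = 0"
        define Q where "Q = (\<lambda>r. ray (\<gamma> r) t)"
        define n where "n = (\<lambda>r. N (\<gamma> r))"
        have Q0: "Q 0 = q" and n0: "n 0 = e" using g(2) by (auto simp: Q_def n_def q_def e_def)
        have Qd: "(Q has_derivative (\<lambda>h. 0)) (at 0)" using g(4) v0 by (simp add: Q_def has_vector_derivative_def)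
        have nd: "(n has_derivative (\<lambda>h. h *\<^sub>R \<mu> *\<^sub>R v)) (at 0)" using g(5) v(1) by (simp add: n_def has_vector_derivative_def)
        have contP: "isCont (\<lambda>s. Q s + \<delta> *\<^sub>R n s) 0" and contM: "isCont (\<lambda>s. Q s - \<delta> *\<^sub>R n s) 0"
          using has_derivative_continuous[OF Qd] has_derivative_continuous[OF nd] by (auto intro!: continuous_intros)
        have cx: "isCont \<xi> z" if "z \<in> ball q r" for z
          using U(1,3) r(2) that continuous_on_eq_continuous_at by blast
        have "isCont (\<lambda>s. \<xi> (Q s + \<delta> *\<^sub>R n s)) 0" "isCont (\<lambda>s. \<xi> (Q s - \<delta> *\<^sub>R n s)) 0"
          using isCont_o2[OF contP, of \<xi>] isCont_o2[OF contM, of \<xi>] cx PM by (auto simp: Q0 n0 P_def M_def)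
        then have c3: "isCont (\<lambda>s. \<xi> (Q s + \<delta> *\<^sub>R n s) * \<xi> M) 0" "isCont (\<lambda>s. \<xi> (Q s - \<delta> *\<^sub>R n s) * \<xi> P) 0"
          by (auto intro!: continuous_intros)
        obtain k1 where k1: "k1 > 0" "\<And>s. dist s 0 < k1 \<Longrightarrow> \<xi> (Q s + \<delta> *\<^sub>R n s) * \<xi> M \<in> {..<0}"
          by (rule isCont_near_in_open[OF c3(1), of "{..<0}"]) (use sign in \<open>auto simp: Q0 n0 P_def\<close>)
        obtain k2 where k2: "k2 > 0" "\<And>s. dist s 0 < k2 \<Longrightarrow> \<xi> (Q s - \<delta> *\<^sub>R n s) * \<xi> P \<in> {..<0}"
          by (rule isCont_near_in_open[OF c3(2), of "{..<0}"]) (use sign in \<open>auto simp: Q0 n0 M_def mult.commute\<close>)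
        obtain k3 where k3: "k3 > 0" "\<And>s. dist s 0 < k3 \<Longrightarrow> Q s + \<delta> *\<^sub>R n s \<in> ball q r"
          by (rule isCont_near_in_open[OF contP, of "ball q r"]) (use PM in \<open>auto simp: Q0 n0 P_def\<close>)
        obtain k4 where k4: "k4 > 0" "\<And>s. dist s 0 < k4 \<Longrightarrow> Q s - \<delta> *\<^sub>R n s \<in> ball q r"
          by (rule isCont_near_in_open[OF contM, of "ball q r"]) (use PM in \<open>auto simp: Q0 n0 M_def\<close>)
        obtain k5 where k5: "k5 > 0" "\<And>s. dist s 0 < k5 \<Longrightarrow> Q s \<in> ball q \<epsilon>"
          by (rule isCont_near_in_open[OF has_derivative_continuous[OF Qd], of "ball q \<epsilon>"]) (use \<epsilon>(1) in \<open>auto simp: Q0\<close>)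
        \<comment> \<open>Makes \<open>\<kappa> * (1 + \<delta>)\<close> half of
          \<open>\<delta> * norm (\<mu> *\<^sub>R v)\<close>, so that the remainders of
          \<open>Q\<close> and \<open>n\<close> together cannot absorb the turning of the
          normal.\<close>
        define \<kappa> where "\<kappa> = \<delta> * norm (\<mu> *\<^sub>R v) / (2 * (1 + \<delta>))"
        have \<kappa>: "\<kappa> > 0" using \<delta>(1) v(2,3) by (simp add: \<kappa>_def)
        obtain k6 where k6: "k6 > 0" "\<And>s. norm (s - 0) < k6 \<Longrightarrow> norm (Q s - Q 0 - 0) \<le> \<kappa> * norm (s - 0)"
          using Qd \<kappa> unfolding has_derivative_at_alt by blast
        obtain k7 where k7: "k7 > 0" "\<And>s. norm (s - 0) < k7 \<Longrightarrow> norm (n s - n 0 - (s - 0) *\<^sub>R \<mu> *\<^sub>R v) \<le> \<kappa> * norm (s - 0)"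
          using nd \<kappa> unfolding has_derivative_at_alt by blast
        have "\<exists>s>0. \<forall>k\<in>{\<eta>, k1, k2, k3, k4, k5, k6, k7}. s < k"
          by (rule finite_positive_lower_bound) (use g(1) k1(1) k2(1) k3(1) k4(1) k5(1) k6(1) k7(1) in blast)+
        then obtain s where "s > 0" "\<forall>k\<in>{\<eta>, k1, k2, k3, k4, k5, k6, k7}. s < k" by blast
        then have s: "s > 0" "s < \<eta>" "s < k1" "s < k2" "s < k3" "s < k4" "s < k5" "s < k6" "s < k7"
          by simp_all
        have Gs: "G (\<gamma> s) \<noteq> 0" "G (Q s) = 0" using g(6)[of s] s by (auto simp: Q_def)
        have ns: "norm (n s) = 1" using Gs by (simp add: n_def)
        have perps: "w \<bullet> n s = 0" if "w \<in> tang crit (Q s)" for w using perp[of "\<gamma> s" w] Gs that by (simp add: Q_def n_def)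
        have perpq: "w \<bullet> e = 0" if "w \<in> tang crit q" for w using perp[OF x, of w] Gq that by (simp add: q_def e_def)
        have dQ: "dist (Q s) q < \<epsilon>" using k5(2)[of s] s by (simp add: dist_commute)
        have i1: "infdist (Q s + \<delta> *\<^sub>R n s) crit = \<delta>" using \<epsilon>(2)[OF Gs(2) dQ ns perps, of \<delta>] \<delta> by simp
        have i2: "infdist (Q s - \<delta> *\<^sub>R n s) crit = \<delta>" using \<epsilon>(2)[OF Gs(2) dQ ns perps, of "- \<delta>"] \<delta> by simp
        have i3: "infdist P crit = \<delta>" using \<epsilon>(2)[OF Gq _ e perpq, of \<delta>] \<delta> \<epsilon>(1) by (simp add: P_def)
        have i4: "infdist M crit = \<delta>" using \<epsilon>(2)[OF Gq _ e perpq, of "- \<delta>"] \<delta> \<epsilon>(1) by (simp add: M_def)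
        have "2 * \<delta> \<le> norm ((Q s + \<delta> *\<^sub>R n s) - M)"
          by (rule ball_side_distance[OF r(2) U(3) Ucrit _ PM(2) _ i1 i4]) (use k3(2)[of s] k1(2)[of s] s in auto)
        then have 1: "2 * \<delta> \<le> norm ((Q s - q) + \<delta> *\<^sub>R n s + \<delta> *\<^sub>R e)" by (simp add: M_def algebra_simps)
        have "2 * \<delta> \<le> norm ((Q s - \<delta> *\<^sub>R n s) - P)"
          by (rule ball_side_distance[OF r(2) U(3) Ucrit _ PM(1) _ i2 i3]) (use k4(2)[of s] k2(2)[of s] s in auto)
        then have 2: "2 * \<delta> \<le> norm ((Q s - q) - \<delta> *\<^sub>R n s - \<delta> *\<^sub>R e)" by (simp add: P_def algebra_simps)
        have gap: "\<delta> * norm (n s - e) \<le> norm (Q s - q)" by (rule parallelogram_gap[OF e ns \<delta>(1) 1 2])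
        have a: "norm (Q s - q) \<le> \<kappa> * s" using k6(2)[of s] s by (simp add: Q0)
        have b: "norm (n s - e - s *\<^sub>R \<mu> *\<^sub>R v) \<le> \<kappa> * s" using k7(2)[of s] s by (simp add: n0)
        have "s * norm (\<mu> *\<^sub>R v) - \<kappa> * s \<le> norm (n s - e)"
        proof -
          define X where "X = s *\<^sub>R \<mu> *\<^sub>R v"
          have "norm X = s * norm (\<mu> *\<^sub>R v)" using s(1) by (simp add: X_def abs_mult)
          moreover have "norm X - norm (X - (n s - e)) \<le> norm (n s - e)"
            using norm_triangle_ineq2[of X "X - (n s - e)"] by simp
          moreover have "norm (X - (n s - e)) \<le> \<kappa> * s" using b unfolding X_def by (subst norm_minus_commute)
          ultimately show ?thesis by linarith
        qed
        then have "\<delta> * (s * norm (\<mu> *\<^sub>R v) - \<kappa> * s) \<le> \<kappa> * s"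
          using gap a \<delta>(1) by (meson mult_left_mono less_imp_le order_trans)
        then have "s * (\<delta> * norm (\<mu> *\<^sub>R v)) \<le> s * (\<kappa> * (1 + \<delta>))" by (simp add: algebra_simps)
        then have "\<delta> * norm (\<mu> *\<^sub>R v) \<le> \<kappa> * (1 + \<delta>)" using s(1) by simp
        also have "\<dots> = \<delta> * norm (\<mu> *\<^sub>R v) / 2" using \<delta>(1) by (simp add: \<kappa>_def field_simps)
        finally show False using \<delta>(1) v(2,3) by (simp add: mult_less_0_iff)
      qed
    qed
  qed
qed

end

section \<open>Metric functions without singular components\<close>

text \<open>Let \<open>v\<close> maximise \<open>norm (B v)\<close> on the unit sphere, with maximum
  \<open>l\<close>. Comparing norms forces \<open>B (B v) = l\<^sup>2 *\<^sub>R v\<close>. Either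
  \<open>B v + l *\<^sub>R v\<close> vanishes and \<open>v\<close> has eigenvalue
  \<open>- l\<close>, or it is an eigenvector for \<open>l\<close>.\<close>

lemma symmetric_nonzero_eigenvector:
  fixes B :: "'a::euclidean_space \<Rightarrow> 'a"
  assumes B: "linear B" and sym: "\<And>u v. B u \<bullet> v = u \<bullet> B v" and ne: "B w \<noteq> 0"
  obtains \<mu> v where "B v = \<mu> *\<^sub>R v" "\<mu> \<noteq> 0" "v \<noteq> 0"
proof -
  have w: "w \<noteq> 0" using ne linear_0[OF B] by auto
  have cont: "continuous_on (sphere 0 1) (\<lambda>v. norm (B v))"
    by (intro continuous_on_norm linear_continuous_on) (simp add: linear_conv_bounded_linear[symmetric] B)
  have "sgn w \<in> sphere 0 1" using w by (simp add: norm_sgn)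
  then have "sphere (0::'a) 1 \<noteq> {}" by blast
  then obtain v where v: "v \<in> sphere 0 1" "\<And>u. u \<in> sphere 0 1 \<Longrightarrow> norm (B u) \<le> norm (B v)"
    using continuous_attains_sup[OF compact_sphere _ cont] by blast
  define l where "l = norm (B v)"
  have bound: "norm (B u) \<le> l * norm u" for u
  proof (cases "u = 0")
    case False
    have "norm (B (sgn u)) \<le> l" unfolding l_def using False by (intro v(2)) (simp add: norm_sgn)
    moreover have "B (sgn u) = B u /\<^sub>R norm u" by (simp add: sgn_div_norm linear_cmul[OF B])
    ultimately show ?thesis using False by (simp add: divide_simps mult.commute)
  qed (simp add: linear_0[OF B])
  have "norm (B w) > 0" using ne by simp
  then have l: "l > 0" using bound[of w] w by (smt (verit) mult_nonpos_nonneg norm_ge_zero)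
  have nv: "norm v = 1" "v \<bullet> v = 1" using v(1) by (auto simp: norm_eq_1[symmetric])
  define z where "z = B (B v) - l\<^sup>2 *\<^sub>R v"
  have 1: "B (B v) \<bullet> v = l\<^sup>2" by (simp add: sym l_def power2_norm_eq_inner)
  have "norm (B (B v)) \<le> l\<^sup>2" using bound[of "B v"] by (simp add: l_def power2_eq_square)
  then have "B (B v) \<bullet> B (B v) \<le> l\<^sup>2 * l\<^sup>2"
    by (metis dot_square_norm power2_eq_square mult_mono norm_ge_zero zero_le_power2)
  moreover have "z \<bullet> z = B (B v) \<bullet> B (B v) - l\<^sup>2 * l\<^sup>2"
    by (simp add: z_def inner_diff_left inner_diff_right 1 nv inner_commute[of v "B (B v)"])
  ultimately have "z \<bullet> z \<le> 0" by simp
  then have "z = 0" using inner_ge_zero[of z] by (metis antisym inner_eq_zero_iff)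
  then have BB: "B (B v) = l\<^sup>2 *\<^sub>R v" by (simp add: z_def)
  show ?thesis
  proof (cases "B v + l *\<^sub>R v = 0")
    case True
    then have "B v = (- l) *\<^sub>R v" by (simp add: eq_neg_iff_add_eq_0)
    then show ?thesis using that[of v "- l"] l nv by force
  next
    case False
    have "B (B v + l *\<^sub>R v) = l *\<^sub>R (B v + l *\<^sub>R v)"
      by (simp add: linear_add[OF B] linear_cmul[OF B] BB power2_eq_square scaleR_add_right)
    then show ?thesis using that[OF _ _ False] l by blast
  qed
qed

section \<open>Quantities constant on leaves, and leaves as level sets of a known function\<close>

context c2_metric_function
begin

lemma constant_on_leaf:
  fixes \<phi> :: "'a \<Rightarrow> 'b::real_normed_vector"
  assumes x: "G x \<noteq> 0" and y: "y \<in> leaf x"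
    and d: "\<And>z. G z \<noteq> 0 \<Longrightarrow> \<exists>\<phi>'. (\<phi> has_derivative \<phi>') (at z) \<and> (\<forall>d. G z \<bullet> d = 0 \<longrightarrow> \<phi>' d = 0)"
  shows "\<phi> y = \<phi> x"
proof -
  have loc: "\<exists>\<epsilon>>0. \<forall>y. dist y z < \<epsilon> \<and> f y = f z \<longrightarrow> \<phi> y = \<phi> z" if z: "G z \<noteq> 0" for z
  proof (rule level_path[OF z open_reg])
    show "z \<in> {z. G z \<noteq> 0}" using z by simp
    fix \<epsilon> :: real
    assume e: "\<epsilon> > 0" "\<And>y. y \<in> ball z \<epsilon> \<Longrightarrow> f y = f z \<Longrightarrow> \<exists>\<gamma>. \<gamma> 0 = z \<and> \<gamma> 1 = y \<and>
       (\<forall>s\<in>{0..1::real}. \<gamma> s \<in> {z. G z \<noteq> 0} \<and> f (\<gamma> s) = f z \<and> (\<exists>d. (\<gamma> has_vector_derivative d) (at s) \<and> G (\<gamma> s) \<bullet> d = 0))"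
    show ?thesis
    proof (intro exI[of _ \<epsilon>] conjI[OF e(1)] allI impI)
      fix y assume "dist y z < \<epsilon> \<and> f y = f z"
      then have "y \<in> ball z \<epsilon>" "f y = f z" by (auto simp: dist_commute)
      from e(2)[OF this] obtain \<gamma> where \<gamma>: "\<gamma> 0 = z" "\<gamma> 1 = y"
        "\<forall>s\<in>{0..1::real}. \<gamma> s \<in> {z. G z \<noteq> 0} \<and> f (\<gamma> s) = f z \<and> (\<exists>d. (\<gamma> has_vector_derivative d) (at s) \<and> G (\<gamma> s) \<bullet> d = 0)"
        by (elim exE conjE)
      have "\<phi> (\<gamma> 1) = \<phi> (\<gamma> 0)"
      proof (rule constant_along_path[where \<gamma>=\<gamma> and \<phi>=\<phi> and a=0 and b=1])
        fix s :: real assume "s \<in> {0..1}"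
        then obtain v where v: "G (\<gamma> s) \<noteq> 0" "(\<gamma> has_vector_derivative v) (at s)" "G (\<gamma> s) \<bullet> v = 0" using \<gamma>(3) by blast
        obtain \<phi>' where "(\<phi> has_derivative \<phi>') (at (\<gamma> s))" "\<forall>d. G (\<gamma> s) \<bullet> d = 0 \<longrightarrow> \<phi>' d = 0" using d[OF v(1)] by blast
        then show "\<exists>\<phi>' d. (\<phi> has_derivative \<phi>') (at (\<gamma> s)) \<and> (\<gamma> has_vector_derivative d) (at s) \<and> \<phi>' d = 0" using v by blast
      qed auto
      then show "\<phi> y = \<phi> z" by (simp add: \<gamma>)
    qed
  qed
  show ?thesis
  proof (rule connected_clopen_induct[OF leaf_connected[of x] leaf_refl _ y, of "\<lambda>y. \<phi> y = \<phi> x"])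
    fix z assume z: "z \<in> leaf x" "\<phi> z = \<phi> x"
    from loc[of z] obtain \<epsilon> where e: "\<epsilon> > 0" "\<forall>y. dist y z < \<epsilon> \<and> f y = f z \<longrightarrow> \<phi> y = \<phi> z" using z(1) leaf_reg x by blast
    show "\<exists>\<epsilon>>0. \<forall>y\<in>leaf x. dist y z < \<epsilon> \<longrightarrow> \<phi> y = \<phi> x"
      using e leaf_f z by (intro exI[of _ \<epsilon>]) force
  next
    fix z assume z: "z \<in> leaf x" and cl: "\<And>\<epsilon>. \<epsilon> > 0 \<Longrightarrow> \<exists>y\<in>leaf x. \<phi> y = \<phi> x \<and> dist y z < \<epsilon>"
    from loc[of z] obtain \<epsilon> where e: "\<epsilon> > 0" "\<forall>y. dist y z < \<epsilon> \<and> f y = f z \<longrightarrow> \<phi> y = \<phi> z" using z(1) leaf_reg x by blast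
    obtain y where "y \<in> leaf x" "\<phi> y = \<phi> x" "dist y z < \<epsilon>" using cl[OF e(1)] by blast
    moreover have "f y = f z" using leaf_f[OF z] leaf_f[OF \<open>y \<in> leaf x\<close>] by simp
    ultimately show "\<phi> z = \<phi> x" using e(2) by metis
  qed simp
qed

lemma level_surfaces_eq: "level_surfaces f = range leaf"
proof -
  have "components (f -` {c}) = leaf ` (f -` {c})" for c
  proof -
    have "leaf x = connected_component_set (f -` {c}) x" if "x \<in> f -` {c}" for x
    proof -
      have "f -` {c} = {z. f z = f x}" using that by auto
      then show ?thesis by (simp add: leaf_def)
    qed
    then show ?thesis unfolding components_def by auto
  qed
  then show ?thesis unfolding level_surfaces_def by auto
qed

text \<open>The inclusion of levels in leaves is maximality of components. Conversely, a critical
  leaf on which \<open>D\<close> took two values would, by connectedness, meet every level of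
  \<open>D\<close> in between and swallow it. That would be an open set of critical points, against
  density.\<close>

lemma leaf_eq_level_of:
  fixes D :: "'a \<Rightarrow> real"
  assumes cont: "continuous_on UNIV D" and conn: "\<And>r. connected {z. D z = r}"
    and fD: "\<And>x y. D x = D y \<Longrightarrow> f x = f y" and Dl: "\<And>x y. G x \<noteq> 0 \<Longrightarrow> y \<in> leaf x \<Longrightarrow> D y = D x"
    and dense: "\<And>x \<epsilon>. \<epsilon> > 0 \<Longrightarrow> \<exists>z. dist z x < \<epsilon> \<and> G z \<noteq> 0"
  shows "leaf x = {z. D z = D x}"
proof
  have sub: "{z. D z = D w} \<subseteq> leaf w" for w
  proof (rule leaf_maximal[OF conn])
    show "f z = f w" if "z \<in> {z. D z = D w}" for z using that by (intro fD) simp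
  qed simp
  show "{z. D z = D x} \<subseteq> leaf x" by (rule sub)
  show "leaf x \<subseteq> {z. D z = D x}"
  proof (cases "G x = 0")
    case False
    then show ?thesis using Dl by blast
  next
    case True
    show ?thesis
    proof (rule ccontr)
      assume "\<not> ?thesis"
      then obtain y where y: "y \<in> leaf x" "D y \<noteq> D x" by blast
      have c: "connected (D ` leaf x)"
        using connected_continuous_image[OF continuous_on_subset[OF cont] leaf_connected] by blast
      define a where "a = min (D x) (D y)"
      define b where "b = max (D x) (D y)"
      have ab: "a < b" "a \<in> D ` leaf x" "b \<in> D ` leaf x" using y by (auto simp: a_def b_def min_def max_def)
      have all0: "G z = 0" if z: "D z \<in> {a<..<b}" for z
      proof -
        have "D z \<in> D ` leaf x" using connectedD_interval[OF c ab(2,3), of "D z"] z by auto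
        then obtain w where w: "w \<in> leaf x" "D z = D w" by blast
        then have "z \<in> leaf w" using sub by blast
        then show ?thesis using leaf_eq[OF w(1)] leaf_reg[of z x] True by blast
      qed
      have "(a + b) / 2 \<in> D ` leaf x" using connectedD_interval[OF c ab(2,3), of "(a + b) / 2"] ab(1) by auto
      then obtain w where w: "D w = (a + b) / 2" by auto
      have "open (D -` {a<..<b})" using open_vimage[OF open_greaterThanLessThan cont] .
      moreover have "w \<in> D -` {a<..<b}" using w ab(1) by (auto simp: field_simps)
      ultimately obtain \<epsilon> where e: "\<epsilon> > 0" "ball w \<epsilon> \<subseteq> D -` {a<..<b}" using open_contains_ball by blast
      obtain z where z: "dist z w < \<epsilon>" "G z \<noteq> 0" using dense[OF e(1)] by blast
      then have "D z \<in> {a<..<b}" using e(2) by (auto simp: dist_commute)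
      then show False using all0 z(2) by blast
    qed
  qed
qed

end

section \<open>Density of the regular points and the case without singular components\<close>

context metric_critical
begin

lemma unit_normal_exists:
  assumes q: "G q = 0"
  obtains e where "norm e = 1" "\<And>v. v \<in> tang crit q \<Longrightarrow> v \<bullet> e = 0"
proof -
  obtain d where d: "d < DIM('a)" "regular_surface d (ccomp q)" by (rule comp_surface[OF q])
  have "dim (tang crit q) < DIM('a)" using surface_tang(2)[OF d(2) comp_refl[OF q]] d(1) tang_crit[OF q] by simp
  then show ?thesis
  proof (rule orthogonal_to_subspace_exists)
    fix e assume e: "e \<noteq> 0" "\<And>y. y \<in> span (tang crit q) \<Longrightarrow> orthogonal e y"
    show ?thesis
    proof (rule that[of "sgn e"])
      show "norm (sgn e) = 1" using e(1) by (simp add: norm_sgn)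
      fix v assume "v \<in> tang crit q"
      then have "e \<bullet> v = 0" using e(2)[OF span_base] by (simp add: orthogonal_def)
      then show "v \<bullet> sgn e = 0" by (simp add: sgn_div_norm inner_commute)
    qed
  qed
qed

text \<open>A critical component has positive codimension, hence a unit normal, and the tube along
  that normal is regular.\<close>

lemma dense_regular:
  assumes "\<epsilon> > 0" shows "\<exists>z. dist z x < \<epsilon> \<and> G z \<noteq> 0"
proof (cases "G x = 0")
  case True
  obtain e where e: "norm e = 1" "\<And>v. v \<in> tang crit x \<Longrightarrow> v \<bullet> e = 0" using unit_normal_exists[OF True] by blast
  show ?thesis
  proof (rule tubular_exists[OF True])
    fix \<delta> assume "tubular x \<delta>"
    note \<delta> = tubularD[OF this]
    define t where "t = min \<epsilon> \<delta> / 2"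
    have t: "0 < t" "t < \<epsilon>" "t < \<delta>" using assms \<delta>(1) by (auto simp: t_def)
    have "G (x + t *\<^sub>R e) \<noteq> 0" using \<delta>(2)[OF True _ e, of t] t \<delta>(1) by simp
    moreover have "dist (x + t *\<^sub>R e) x < \<epsilon>" using t e(1) by (simp add: dist_norm)
    ultimately show ?thesis by blast
  qed
next
  case False
  then show ?thesis using assms by (intro exI[of _ x]) simp
qed

text \<open>For a critical point the negation means that its component is a hypersurface. In
  dimension one no point is singular, so isolated critical points there belong to the hyperplane
  case.\<close>

definition sing :: "'a \<Rightarrow> bool" where
  "sing q \<longleftrightarrow> G q = 0 \<and> (\<exists>d. d + 2 \<le> DIM('a) \<and> regular_surface d (ccomp q))"

lemma not_sing_hypersurface:
  assumes "G q = 0" "\<not> sing q" shows "regular_surface (DIM('a) - 1) (ccomp q)"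
proof -
  obtain d where d: "d < DIM('a)" "regular_surface d (ccomp q)" by (rule comp_surface[OF assms(1)])
  then have "\<not> d + 2 \<le> DIM('a)" using assms by (auto simp: sing_def)
  then have "d = DIM('a) - 1" using d(1) by linarith
  then show ?thesis using d(2) by simp
qed

lemma sing_comp: "sing p \<Longrightarrow> q \<in> ccomp p \<Longrightarrow> sing q"
  using comp_eq[of q p] comp_subset[of p] by (auto simp: sing_def)

lemma A_zero_of_no_sing:
  assumes ns: "\<And>q. \<not> sing q" and x: "G x \<noteq> 0"
  shows "A x w = 0"
proof (rule ccontr)
  assume "A x w \<noteq> 0"
  then obtain \<mu> v where v: "A x v = \<mu> *\<^sub>R v" "\<mu> \<noteq> 0" "v \<noteq> 0"
    by (rule symmetric_nonzero_eigenvector[OF bounded_linear.linear[OF A_linear] A_symmetric[OF x]])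
  define t where "t = - (1 / \<mu>)"
  have "1 + t * \<mu> = 0" using v(2) by (simp add: t_def)
  moreover have "1 + t * \<mu> \<noteq> 0"
  proof (cases "G (ray x t) = 0")
    case True
    then show ?thesis using hypersurface_not_focal[OF x True not_sing_hypersurface[OF True ns] v] by blast
  next
    case False
    then show ?thesis using regular_not_focal[OF x False v] by blast
  qed
  ultimately show False by blast
qed

text \<open>\<open>A = 0\<close> makes \<open>N\<close> constant on one regular leaf. Every point
  lies on a normal line starting on that leaf, so \<open>N\<close> is \<open>u\<close> or
  \<open>- u\<close> at all regular points, and \<open>f\<close> has zero derivative along each
  hyperplane orthogonal to \<open>u\<close>, critical points included.\<close>

lemma parallel_hyperplanes:
  assumes ns: "\<And>q. \<not> sing q"
  shows "\<exists>u::'a. u \<noteq> 0 \<and> level_surfaces f = range (\<lambda>t. {x. u \<bullet> x = t})"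
proof -
  obtain x0 where x0: "G x0 \<noteq> 0" using dense_regular[of 1] by auto
  define u where "u = N x0"
  have u: "norm u = 1" "u \<noteq> 0" using x0 by (auto simp: u_def)
  have Nl: "N y = u" if "y \<in> leaf x0" for y
    unfolding u_def
  proof (rule constant_on_leaf[OF x0 that])
    fix z assume z: "G z \<noteq> 0"
    show "\<exists>\<phi>'. (N has_derivative \<phi>') (at z) \<and> (\<forall>d. G z \<bullet> d = 0 \<longrightarrow> \<phi>' d = 0)"
      using N_deriv[OF z] A_zero_of_no_sing[OF ns z] by blast
  qed
  have Nu: "N z = u \<or> N z = - u" if z: "G z \<noteq> 0" for z
  proof -
    obtain x a where x: "x \<in> leaf x0" "z = ray x a" "\<bar>a\<bar> \<le> dist z x0" by (rule foot_on_leaf[OF x0])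
    have "G x \<noteq> 0" using leaf_reg[OF x(1)] x0 by blast
    then show ?thesis using line_structure[of x a] z x(2) Nl[OF x(1)] by auto
  qed
  have Gu: "G z \<bullet> d = 0 \<longleftrightarrow> u \<bullet> d = 0" if "G z \<noteq> 0" for z d
    using perp_N_iff[OF that, of d] Nu[OF that] by (auto simp: inner_commute)
  have leafD: "leaf x = {z. u \<bullet> z = u \<bullet> x}" for x
  proof (rule leaf_eq_level_of)
    show "continuous_on UNIV (\<lambda>z. u \<bullet> z)" by (intro continuous_intros)
    show "connected {z. u \<bullet> z = r}" for r using convex_hyperplane convex_connected by blast
    show "f x = f y" if "u \<bullet> x = u \<bullet> y" for x y
    proof -
      have "f ((\<lambda>s. x + s *\<^sub>R (y - x)) 0) = f ((\<lambda>s. x + s *\<^sub>R (y - x)) 1)"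
      proof (rule constant_along_path[where a=0 and b=1 and \<phi>=f and \<gamma>="\<lambda>s. x + s *\<^sub>R (y - x)"])
        fix s :: real
        have "((\<lambda>s. x + s *\<^sub>R (y - x)) has_vector_derivative (y - x)) (at s)"
          unfolding has_vector_derivative_def by (auto intro!: derivative_eq_intros)
        moreover have "G (x + s *\<^sub>R (y - x)) \<bullet> (y - x) = 0"
          using Gu[of "x + s *\<^sub>R (y - x)" "y - x"] that by (cases "G (x + s *\<^sub>R (y - x)) = 0") (auto simp: inner_diff_right)
        ultimately show "\<exists>\<phi>' d. (f has_derivative \<phi>') (at (x + s *\<^sub>R (y - x))) \<and>
            ((\<lambda>s. x + s *\<^sub>R (y - x)) has_vector_derivative d) (at s) \<and> \<phi>' d = 0" using f_deriv by blast
      qed auto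
      then show ?thesis by simp
    qed
    show "u \<bullet> y = u \<bullet> x" if "G x \<noteq> 0" "y \<in> leaf x" for x y
    proof (rule constant_on_leaf[OF that])
      fix z assume z: "G z \<noteq> 0"
      show "\<exists>\<phi>'. ((\<bullet>) u has_derivative \<phi>') (at z) \<and> (\<forall>d. G z \<bullet> d = 0 \<longrightarrow> \<phi>' d = 0)"
        using Gu[OF z] by (intro exI[of _ "(\<bullet>) u"]) (auto intro!: derivative_eq_intros)
    qed
  qed (rule dense_regular)
  have "level_surfaces f = range (\<lambda>t. {x. u \<bullet> x = t})"
  proof -
    have "range leaf = range (\<lambda>t. {x. u \<bullet> x = t})"
    proof
      show "range leaf \<subseteq> range (\<lambda>t. {x. u \<bullet> x = t})" using leafD by auto
      show "range (\<lambda>t. {x. u \<bullet> x = t}) \<subseteq> range leaf"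
      proof clarify
        fix t
        have "u \<bullet> u = 1" using u(1) norm_eq_1 by blast
        then have ut: "u \<bullet> (t *\<^sub>R u) = t" by simp
        have "{x. u \<bullet> x = t} = leaf (t *\<^sub>R u)" unfolding leafD ut ..
        then show "{x. u \<bullet> x = t} \<in> range leaf" by simp
      qed
    qed
    then show ?thesis by (simp add: level_surfaces_eq)
  qed
  then show ?thesis using u(2) by blast
qed

section \<open>Singular components\<close>


lemma ray_shift: "N (ray x t) = \<sigma> *\<^sub>R N x \<Longrightarrow> ray (ray x t) w = ray x (t + \<sigma> * w)"
  unfolding ray_def[of "ray x t"] by (simp add: ray_def algebra_simps)

lemma N_ray_sign:
  assumes "G x \<noteq> 0" "G (ray x t) \<noteq> 0"
  obtains \<sigma> :: real where "N (ray x t) = \<sigma> *\<^sub>R N x" "\<sigma> = 1 \<or> \<sigma> = -1"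
proof -
  have "N (ray x t) = 1 *\<^sub>R N x \<or> N (ray x t) = (-1) *\<^sub>R N x" using line_structure[of x t] assms by auto
  then show ?thesis using that by blast
qed

lemma sing_crit: "sing q \<Longrightarrow> G q = 0"
  by (simp add: sing_def)

lemma sing_transport:
  assumes "G x \<noteq> 0" "y \<in> leaf x" "sing (ray x t)" shows "sing (ray y t)"
  using sing_comp[OF assms(3) transport_crit(2)[OF assms(1) sing_crit[OF assms(3)] assms(2)]] .

text \<open>The unit normals at a point of a critical component of codimension at least two form a
  connected sphere, so both ends of a short normal segment lie on one leaf.\<close>

lemma opposite_points_same_leaf:
  assumes q: "sing q" and e: "norm e = 1" "\<And>v. v \<in> tang crit q \<Longrightarrow> v \<bullet> e = 0"
  obtains \<delta> \<sigma> where "\<delta> > 0" "G (q + \<delta> *\<^sub>R e) \<noteq> 0" "q - \<delta> *\<^sub>R e \<in> leaf (q + \<delta> *\<^sub>R e)"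
    "N (q + \<delta> *\<^sub>R e) = \<sigma> *\<^sub>R e" "N (q - \<delta> *\<^sub>R e) = - (\<sigma> *\<^sub>R e)" "\<sigma> = 1 \<or> \<sigma> = (-1::real)"
proof -
  note Gq = sing_crit[OF q]
  obtain d where d: "d + 2 \<le> DIM('a)" "regular_surface d (ccomp q)" using q by (auto simp: sing_def)
  have "dim (tang crit q) = d" using surface_tang(2)[OF d(2) comp_refl[OF Gq]] tang_crit[OF Gq] by simp
  \<comment> \<open>Codimension two enters here: besides \<open>e\<close> there is a unit normal
    \<open>w\<close> orthogonal to it, so a half circle of unit normals leads from \<open>e\<close>
    to \<open>- e\<close>.\<close>
  then have "dim (insert e (tang crit q)) < DIM('a)" using d(1) by (simp add: dim_insert)
  then show ?thesis
  proof (rule orthogonal_to_subspace_exists)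
    fix w' assume w': "w' \<noteq> 0" "\<And>y. y \<in> span (insert e (tang crit q)) \<Longrightarrow> orthogonal w' y"
    define w where "w = sgn w'"
    have w: "norm w = 1" using w' by (simp add: w_def norm_sgn)
    have wo: "w \<bullet> y = 0" if "y \<in> insert e (tang crit q)" for y
      using w'(2)[OF span_base[OF that]] by (simp add: w_def sgn_div_norm orthogonal_def)
    have ww: "w \<bullet> w = 1" and ee: "e \<bullet> e = 1" and we: "w \<bullet> e = 0" "e \<bullet> w = 0"
      using w e wo norm_eq_1[of w] norm_eq_1[of e] by (auto simp: inner_commute[of e w])
    show ?thesis
    proof (rule tubular_exists[OF Gq])
      fix \<epsilon> assume "tubular q \<epsilon>"
      note \<epsilon> = tubularD[OF this]
      define \<delta> where "\<delta> = \<epsilon> / 2"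
      have \<delta>: "0 < \<delta>" "\<delta> < \<epsilon>" using \<epsilon>(1) by (auto simp: \<delta>_def)
      define n where "n = (\<lambda>\<theta>. cos \<theta> *\<^sub>R e + sin \<theta> *\<^sub>R w)"
      define n' where "n' = (\<lambda>\<theta>. - sin \<theta> *\<^sub>R e + cos \<theta> *\<^sub>R w)"
      define g where "g = (\<lambda>\<theta>. q + \<delta> *\<^sub>R n \<theta>)"
      have nn: "n \<theta> \<bullet> n \<theta> = 1" for \<theta>
        using sin_cos_squared_add[of \<theta>]
        by (simp add: n_def inner_add_left inner_add_right ww ee we power2_eq_square add.commute)
      have nn': "n \<theta> \<bullet> n' \<theta> = 0" for \<theta>
        by (simp add: n_def n'_def inner_add_left inner_add_right inner_diff_right ww ee we)
      have nperp: "v \<bullet> n \<theta> = 0" if "v \<in> tang crit q" for v \<theta>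
        using e(2)[OF that] wo[of v] that by (simp add: n_def inner_add_right inner_commute[of v w])
      have reg: "G (g \<theta>) \<noteq> 0" "N (g \<theta>) = n \<theta> \<or> N (g \<theta>) = - n \<theta>" for \<theta>
        using \<epsilon>(2)[OF Gq _ _ nperp[of _ \<theta>], of \<delta>] \<delta> \<epsilon>(1) nn[of \<theta>] norm_eq_1[of "n \<theta>"] by (auto simp: g_def)
      have nd: "(n has_vector_derivative n' \<theta>) (at \<theta>)" for \<theta>
        unfolding n_def n'_def has_vector_derivative_def by (auto intro!: derivative_eq_intros simp: algebra_simps)
      have gd: "(g has_vector_derivative \<delta> *\<^sub>R n' \<theta>) (at \<theta>)" for \<theta>
      proof -
        have "(g has_derivative (\<lambda>h. \<delta> *\<^sub>R (h *\<^sub>R n' \<theta>))) (at \<theta>)" unfolding g_def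
          using nd[of \<theta>, unfolded has_vector_derivative_def]
          by (auto intro!: derivative_eq_intros)
        then show ?thesis by (simp add: has_vector_derivative_def mult.commute)
      qed
      have Nn': "N (g \<theta>) \<bullet> n' \<theta> = 0" for \<theta> using reg(2)[of \<theta>] nn'[of \<theta>] by auto
      have fc: "f (g \<theta>) = f (g 0)" if "\<theta> \<in> {0..pi}" for \<theta>
      proof (rule constant_along_path[where \<gamma>=g and \<phi>=f and a=0 and b=pi, OF _ that])
        fix s :: real
        have "G (g s) \<bullet> (\<delta> *\<^sub>R n' s) = 0" using Nn'[of s] by (subst G_eq_N) simp
        then show "\<exists>\<phi>' d. (f has_derivative \<phi>') (at (g s)) \<and> (g has_vector_derivative d) (at s) \<and> \<phi>' d = 0"
          using f_deriv gd by blast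
      qed auto
      have lf: "g pi \<in> leaf (g 0)"
      proof (rule path_in_leaf[where a=0 and b=pi and s=pi and t=0 and \<gamma>=g])
        fix \<theta> assume "\<theta> \<in> {0..pi}"
        then show "f (g \<theta>) = f (g 0) \<and> isCont g \<theta>"
          using fc has_vector_derivative_continuous[OF gd] by blast
      qed auto
      \<comment> \<open>The sign of \<open>N\<close> relative to the radial direction is constant
        along the half circle: \<open>N\<close> points outwards at both ends or inwards at both.
        Equal times from the two ends therefore lead to mirror images.\<close>
      have "(\<lambda>\<theta>. N (g \<theta>) \<bullet> n \<theta>) pi = (\<lambda>\<theta>. N (g \<theta>) \<bullet> n \<theta>) 0"
      proof (rule constant_along_path[where \<gamma>="\<lambda>s. s" and \<phi>="\<lambda>\<theta>. N (g \<theta>) \<bullet> n \<theta>" and a=0 and b=pi])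
        fix s :: real
        have D: "((\<lambda>\<theta>. N (g \<theta>) \<bullet> n \<theta>) has_derivative
            (\<lambda>h. N (g s) \<bullet> (h *\<^sub>R n' s) + A (g s) (h *\<^sub>R (\<delta> *\<^sub>R n' s)) \<bullet> n s)) (at s)"
          by (rule has_derivative_inner[OF has_derivative_compose[OF gd[unfolded has_vector_derivative_def] N_deriv[OF reg(1)]]
                nd[unfolded has_vector_derivative_def]])
        have "A (g s) v \<bullet> n s = 0" for v using A_perp[OF reg(1), of s v] reg(2)[of s] by auto
        then have "N (g s) \<bullet> (1 *\<^sub>R n' s) + A (g s) (1 *\<^sub>R (\<delta> *\<^sub>R n' s)) \<bullet> n s = 0" using Nn'[of s] by simp
        moreover have "((\<lambda>s. s) has_vector_derivative 1) (at s)" by (simp add: has_vector_derivative_def)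
        ultimately show "\<exists>\<phi>' d. ((\<lambda>\<theta>. N (g \<theta>) \<bullet> n \<theta>) has_derivative \<phi>') (at s) \<and>
            ((\<lambda>s. s) has_vector_derivative d) (at s) \<and> \<phi>' d = 0" using D by blast
      qed auto
      then have sg: "N (g pi) \<bullet> n pi = N (g 0) \<bullet> n 0" .
      define \<sigma> where "\<sigma> = N (g 0) \<bullet> n 0"
      have s0: "N (g 0) = \<sigma> *\<^sub>R n 0" "\<sigma> = 1 \<or> \<sigma> = -1" using reg(2)[of 0] nn[of 0] by (auto simp: \<sigma>_def)
      have s1: "N (g pi) = \<sigma> *\<^sub>R n pi" 
      proof -
        have "\<sigma> = N (g pi) \<bullet> n pi" using sg by (simp add: \<sigma>_def)
        then show ?thesis using reg(2)[of pi] nn[of pi] by auto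
      qed
      have n0: "n 0 = e" "n pi = - e" by (auto simp: n_def)
      have g0: "g 0 = q + \<delta> *\<^sub>R e" "g pi = q - \<delta> *\<^sub>R e" by (auto simp: g_def n0)
      show ?thesis
        by (rule that[OF \<delta>(1), of \<sigma>]) (use reg(1)[of 0] lf s0 s1 in \<open>auto simp: g0 n0\<close>)
    qed
  qed
qed

text \<open>The two points on either side of the hit \<open>q = ray x T\<close> share a leaf and
  have opposite normals. Moving both for the same time gives points symmetric about
  \<open>q\<close>, and transport along the leaf carries a singular hit of one to a singular hit of
  the other.\<close>

lemma sing_reflect:
  assumes x: "G x \<noteq> 0" and T: "sing (ray x T)" and s: "sing (ray x s)"
  shows "sing (ray x (2 * T - s))"
proof -
  define q where "q = ray x T"
  define e where "e = N x"
  have e: "norm e = 1" using x by (simp add: e_def)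
  have perp: "v \<bullet> e = 0" if "v \<in> tang crit q" for v
    using line_structure[OF x, of T] sing_crit[OF T] that by (simp add: q_def e_def)
  show ?thesis
  proof (rule opposite_points_same_leaf[OF T[folded q_def] e perp])
    fix \<delta> \<sigma> assume h: "(0::real) < \<delta>" "G (q + \<delta> *\<^sub>R e) \<noteq> 0" "q - \<delta> *\<^sub>R e \<in> leaf (q + \<delta> *\<^sub>R e)"
      "N (q + \<delta> *\<^sub>R e) = \<sigma> *\<^sub>R e" "N (q - \<delta> *\<^sub>R e) = - (\<sigma> *\<^sub>R e)" "\<sigma> = 1 \<or> \<sigma> = (-1::real)"
    have ss: "\<sigma> * \<sigma> = 1" using h(6) by auto
    define r where "r = \<sigma> * (s - T - \<delta>)"
    have r: "r * \<sigma> = s - T - \<delta>"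
    proof -
      have "r * \<sigma> = (\<sigma> * \<sigma>) * (s - T - \<delta>)" unfolding r_def by (simp only: ac_simps)
      then show ?thesis using ss by simp
    qed
    have 1: "ray (q + \<delta> *\<^sub>R e) r = ray x s"
    proof -
      have "ray (q + \<delta> *\<^sub>R e) r = q + (\<delta> + r * \<sigma>) *\<^sub>R e" unfolding ray_def[of "q + \<delta> *\<^sub>R e"] h(4) by (simp add: scaleR_add_left)
      also have "\<dots> = ray x s" unfolding r q_def e_def ray_def by (simp add: algebra_simps)
      finally show ?thesis .
    qed
    have 2: "ray (q - \<delta> *\<^sub>R e) r = ray x (2 * T - s)"
    proof -
      have "ray (q - \<delta> *\<^sub>R e) r = q - (\<delta> + r * \<sigma>) *\<^sub>R e" unfolding ray_def[of "q - \<delta> *\<^sub>R e"] h(5) by (simp add: scaleR_add_left)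
      also have "\<dots> = x + (T - (\<delta> + r * \<sigma>)) *\<^sub>R e" unfolding q_def e_def ray_def by (simp add: scaleR_diff_left)
      also have "T - (\<delta> + r * \<sigma>) = 2 * T - s" unfolding r by simp
      finally show ?thesis by (simp add: ray_def e_def)
    qed
    show ?thesis using sing_transport[OF h(2,3), of r] s unfolding 1 2 by blast
  qed
qed

text \<open>Repeated reflection puts a singular hit at every time \<open>a k\<close> of an
  arithmetic progression, none of them \<open>0\<close> because \<open>x\<close> is regular. Each
  hit is focal, so \<open>- 1 / a k\<close> is an eigenvalue of the symmetric \<open>A x\<close>.
  Eigenvectors for distinct eigenvalues are orthogonal, and there would be infinitely many.\<close>

lemma sing_unique:
  assumes x: "G x \<noteq> 0" and s: "sing (ray x s)" and t: "sing (ray x t)"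
  shows "s = t"
proof (rule ccontr)
  assume ne: "s \<noteq> t"
  define a where "a = (\<lambda>k::nat. s + real k * (t - s))"
  have "sing (ray x (a k)) \<and> sing (ray x (a (Suc k)))" for k
  proof (induction k)
    case 0
    show ?case using s t by (simp add: a_def)
  next
    case (Suc k)
    have "2 * a (Suc k) - a k = a (Suc (Suc k))" by (simp add: a_def algebra_simps)
    then show ?case using sing_reflect[OF x, of "a (Suc k)" "a k"] Suc by auto
  qed
  then have sing_a: "sing (ray x (a k))" for k by blast
  have "\<exists>v. v \<noteq> 0 \<and> v + a k *\<^sub>R A x v = 0" for k
    using singular_is_focal[OF x sing_crit[OF sing_a]] sing_a[of k] unfolding sing_def by blast
  then obtain v where v: "\<And>k. v k \<noteq> 0" "\<And>k. v k + a k *\<^sub>R A x (v k) = 0" by metis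
  have a0: "a k \<noteq> 0" for k
  proof
    assume "a k = 0"
    then show False using sing_crit[OF sing_a[of k]] x by (simp add: ray_def)
  qed
  have ainj: "a j \<noteq> a k" if "j \<noteq> k" for j k using that ne by (simp add: a_def)
  have Av: "a k * (A x (v k) \<bullet> w) = - (v k \<bullet> w)" for k w
  proof -
    have "a k *\<^sub>R A x (v k) = - v k" using v(2)[of k] by (simp add: eq_neg_iff_add_eq_0 add.commute)
    then have "(a k *\<^sub>R A x (v k)) \<bullet> w = - (v k \<bullet> w)" by simp
    then show ?thesis by simp
  qed
  have orth: "v j \<bullet> v k = 0" if "j \<noteq> k" for j k
  proof -
    have "A x (v k) \<bullet> v j = A x (v j) \<bullet> v k" using A_symmetric[OF x] by (simp add: inner_commute)
    then have "a j * (a k * (A x (v k) \<bullet> v j)) = a k * (a j * (A x (v j) \<bullet> v k))" by simp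
    then have "a j * (v k \<bullet> v j) = a k * (v j \<bullet> v k)" unfolding Av by simp
    then have "(a j - a k) * (v j \<bullet> v k) = 0" by (simp add: inner_commute left_diff_distrib)
    then show ?thesis using ainj[OF that] by simp
  qed
  have "pairwise orthogonal (range v)"
    unfolding pairwise_def orthogonal_def
  proof (intro ballI impI)
    fix y z assume "y \<in> range v" "z \<in> range v" "y \<noteq> z"
    then obtain j k where "y = v j" "z = v k" "j \<noteq> k" by blast
    then show "y \<bullet> z = 0" using orth by blast
  qed
  moreover have "0 \<notin> range v" using v(1) by auto
  ultimately have "independent (range v)" by (rule pairwise_orthogonal_independent)
  then have "finite (range v)" by (rule independent_imp_finite)
  moreover have "inj v"
  proof (rule injI, rule ccontr)
    fix j k assume "v j = v k" "j \<noteq> k"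
    then have "v j \<bullet> v j = 0" using orth[of j k] by simp
    then show False using v(1) by simp
  qed
  ultimately show False using range_inj_infinite by blast
qed

text \<open>A regular point \<open>z0\<close> close to \<open>p\<close> has a critical point on its
  own line close to \<open>p\<close>, hence in the component of \<open>p\<close>. The foot of
  \<open>z\<close> on \<open>leaf z0\<close> inherits this hit by transport, and the normal line of
  the foot is also that of \<open>z\<close>.\<close>

lemma every_line_sing:
  assumes p: "sing p" and z: "G z \<noteq> 0"
  obtains t where "sing (ray z t)"
proof -
  note Gp = sing_crit[OF p]
  obtain \<epsilon> where e: "\<epsilon> > 0" "\<And>y. dist y p < \<epsilon> \<Longrightarrow> G y = 0 \<Longrightarrow> y \<in> ccomp p" using comp_near[OF Gp] by blast
  obtain z0 where z0: "dist z0 p < \<epsilon> / 2" "G z0 \<noteq> 0" using dense_regular[of "\<epsilon> / 2" p] e(1) by auto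
  obtain u where u: "\<bar>u\<bar> \<le> dist p z0" "G (ray z0 u) = 0" by (rule critical_on_ray[OF z0(2) Gp])
  have "dist (ray z0 u) z0 = \<bar>u\<bar>" using z0(2) by (simp add: ray_def dist_norm)
  then have "dist (ray z0 u) p < \<epsilon>" using dist_triangle[of "ray z0 u" p z0] u(1) z0(1) by (simp add: dist_commute)
  then have su: "sing (ray z0 u)" using sing_comp[OF p e(2)] u(2) by blast
  obtain x a where x: "x \<in> leaf z0" "z = ray x a" "\<bar>a\<bar> \<le> dist z z0" by (rule foot_on_leaf[OF z0(2)])
  have Gx: "G x \<noteq> 0" using leaf_reg[OF x(1)] z0(2) by blast
  have sx: "sing (ray x u)" by (rule sing_transport[OF z0(2) x(1) su])
  obtain \<sigma> :: real where s: "N (ray x a) = \<sigma> *\<^sub>R N x" "\<sigma> = 1 \<or> \<sigma> = -1" using N_ray_sign[OF Gx] z x(2) by blast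
  have "ray z (\<sigma> * (u - a)) = ray x (a + \<sigma> * (\<sigma> * (u - a)))" unfolding x(2) by (rule ray_shift[OF s(1)])
  also have "a + \<sigma> * (\<sigma> * (u - a)) = u" using s(2) by auto
  finally have "ray z (\<sigma> * (u - a)) = ray x u" .
  with sx that show ?thesis by metis
qed

section \<open>The distance to the singular set\<close>

definition Sg :: "'a set" where "Sg = {p. sing p}"

text \<open>A singular point \<open>s\<close> is reached from a foot \<open>x\<close> on
  \<open>leaf z\<close> at some time \<open>a\<close> with
  \<open>\<bar>a\<bar> \<le> dist s z\<close>. Transport gives \<open>z\<close> itself a singular
  hit at time \<open>a\<close>, and uniqueness yields \<open>a = t\<close>.\<close>

lemma dist_Sg:
  assumes z: "G z \<noteq> 0" and t: "sing (ray z t)"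
  shows "infdist z Sg = \<bar>t\<bar>"
proof (rule antisym)
  have "dist z (ray z t) = \<bar>t\<bar>" using z by (simp add: ray_def dist_norm)
  then show "infdist z Sg \<le> \<bar>t\<bar>" using infdist_le[of "ray z t" Sg z] t by (simp add: Sg_def)
  have "\<bar>t\<bar> \<le> dist z s" if s: "s \<in> Sg" for s
  proof -
    obtain x a where x: "x \<in> leaf z" "s = ray x a" "\<bar>a\<bar> \<le> dist s z" by (rule foot_on_leaf[OF z])
    have Gx: "G x \<noteq> 0" using leaf_reg[OF x(1)] z by blast
    have "sing (ray z a)" by (rule sing_transport[OF Gx leaf_sym[OF x(1)]]) (use s x(2) in \<open>simp add: Sg_def\<close>)
    then have "a = t" using sing_unique[OF z _ t] by blast
    then show ?thesis using x(3) by (simp add: dist_commute)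
  qed
  moreover have "Sg \<noteq> {}" using t by (auto simp: Sg_def)
  ultimately show "\<bar>t\<bar> \<le> infdist z Sg" unfolding infdist_def by (auto intro: cINF_greatest)
qed

text \<open>Near a limit point all critical points lie in its own component, and being singular is a
  property of the component.\<close>

lemma closed_Sg: "closed Sg"
proof (rule closed_sequential_limits[THEN iffD2], intro allI impI, elim conjE)
  fix X s assume X: "\<forall>n. X n \<in> Sg" "X \<longlonglongrightarrow> s"
  have "\<forall>n. X n \<in> crit" using X(1) sing_crit by (simp add: Sg_def)
  then have Gs: "G s = 0" using closed_sequentially[OF closed_crit _ X(2)] by simp
  obtain \<epsilon> where e: "\<epsilon> > 0" "\<And>y. dist y s < \<epsilon> \<Longrightarrow> G y = 0 \<Longrightarrow> y \<in> ccomp s" using comp_near[OF Gs] by blast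
  obtain n where n: "dist (X n) s < \<epsilon>" using X(2) e(1) unfolding lim_sequentially by blast
  have sX: "sing (X n)" using X(1) by (simp add: Sg_def)
  then have "X n \<in> ccomp s" using e(2)[OF n] sing_crit by blast
  then have "ccomp (X n) = ccomp s" by (rule comp_eq)
  then have "s \<in> ccomp (X n)" using comp_refl[OF Gs] by simp
  then show "s \<in> Sg" using sing_comp[OF sX] by (simp add: Sg_def)
qed

text \<open>Walking away from the only singular hit of the line, the distance at regular points is
  the time elapsed since that hit. The end point may lie on a critical hypersurface; regular times
  just beyond it and the Lipschitz property of the distance cover this case.\<close>

lemma outward_ray:
  assumes p: "sing p" and z: "G z \<noteq> 0" and u: "u \<ge> 0"
  shows "\<exists>\<nu>. norm \<nu> = 1 \<and> infdist z Sg + u \<le> infdist (z + u *\<^sub>R \<nu>) Sg"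
proof -
  obtain t where t: "sing (ray z t)" by (rule every_line_sing[OF p z])
  have t0: "t \<noteq> 0" using sing_crit[OF t] z by (auto simp: ray_def)
  define \<sigma> where "\<sigma> = - sgn t"
  have \<sigma>1: "\<sigma> = 1 \<or> \<sigma> = -1" using t0 by (auto simp: \<sigma>_def sgn_if)
  have \<sigma>2: "\<bar>t - \<sigma> * w\<bar> = \<bar>t\<bar> + w" if "w \<ge> 0" for w
    using t0 that by (auto simp: \<sigma>_def sgn_if abs_if)
  have Dr: "infdist (ray z r) Sg = \<bar>t - r\<bar>" if r: "G (ray z r) \<noteq> 0" for r
  proof -
    obtain \<tau> :: real where s: "N (ray z r) = \<tau> *\<^sub>R N z" "\<tau> = 1 \<or> \<tau> = -1" using N_ray_sign[OF z r] by blast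
    have "ray (ray z r) (\<tau> * (t - r)) = ray z (r + \<tau> * (\<tau> * (t - r)))" by (rule ray_shift[OF s(1)])
    also have "r + \<tau> * (\<tau> * (t - r)) = t" using s(2) by auto
    finally have "infdist (ray z r) Sg = \<bar>\<tau> * (t - r)\<bar>" using dist_Sg[OF r] t by metis
    then show ?thesis using s(2) by auto
  qed
  have "\<bar>t\<bar> + u \<le> infdist (ray z (\<sigma> * u)) Sg + \<eta>" if \<eta>: "\<eta> > 0" for \<eta>
  proof (rule ray_reg_isolated[OF z, of "\<sigma> * u"])
    fix \<epsilon> assume \<epsilon>: "\<epsilon> > 0" "\<And>s. 0 < \<bar>s - \<sigma> * u\<bar> \<Longrightarrow> \<bar>s - \<sigma> * u\<bar> < \<epsilon> \<Longrightarrow> G (ray z s) \<noteq> 0"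
    define h where "h = min \<epsilon> \<eta> / 2"
    have h: "0 < h" "h < \<epsilon>" "h \<le> \<eta>" using \<epsilon>(1) \<eta> by (auto simp: h_def)
    have diff: "\<bar>\<sigma> * (u + h) - \<sigma> * u\<bar> = h" using \<sigma>1 h(1) by (auto simp: algebra_simps)
    have "0 < \<bar>\<sigma> * (u + h) - \<sigma> * u\<bar>" "\<bar>\<sigma> * (u + h) - \<sigma> * u\<bar> < \<epsilon>" unfolding diff using h by auto
    from Dr[OF \<epsilon>(2)[OF this]] have "infdist (ray z (\<sigma> * (u + h))) Sg = \<bar>t\<bar> + (u + h)"
      using \<sigma>2[of "u + h"] h u by linarith
    moreover have "dist (ray z (\<sigma> * (u + h))) (ray z (\<sigma> * u)) = h"
    proof -
      have "ray z (\<sigma> * (u + h)) - ray z (\<sigma> * u) = (\<sigma> * (u + h) - \<sigma> * u) *\<^sub>R N z" by (simp add: ray_def scaleR_diff_left)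
      then show ?thesis using diff z by (simp add: dist_norm)
    qed
    ultimately show ?thesis using infdist_triangle[of "ray z (\<sigma> * (u + h))" Sg "ray z (\<sigma> * u)"] h by simp
  qed
  then have "\<bar>t\<bar> + u \<le> infdist (ray z (\<sigma> * u)) Sg" by (rule field_le_epsilon)
  moreover have "ray z (\<sigma> * u) = z + u *\<^sub>R (\<sigma> *\<^sub>R N z)" by (simp add: ray_def mult.commute)
  moreover have "norm (\<sigma> *\<^sub>R N z) = 1" using \<sigma>1 z by auto
  ultimately show ?thesis using dist_Sg[OF z t] by metis
qed

end

text \<open>If a 1-Lipschitz function increases at unit speed along some ray from every point, comparing with
  far away points on that ray, whose distance to nearby points is affine up to a vanishing error,
  makes it convex.\<close>

lemma convex_of_outward_rays:
  fixes D :: "'a::real_inner \<Rightarrow> real"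
  assumes lip: "\<And>x y. D x \<le> D y + dist x y"
    and ray: "\<And>z u. z \<in> R \<Longrightarrow> u \<ge> 0 \<Longrightarrow> \<exists>\<nu>. norm \<nu> = 1 \<and> D z + u \<le> D (z + u *\<^sub>R \<nu>)"
    and dense: "\<And>x \<epsilon>. \<epsilon> > 0 \<Longrightarrow> \<exists>z\<in>R. dist z x < \<epsilon>"
  shows "convex_on UNIV D"
proof (rule convex_onI)
  fix a :: real and x y :: 'a assume a: "0 < a" "a < 1"
  have reg: "D m \<le> (1 - a) * D x + a * D y" if m: "m = (1 - a) *\<^sub>R x + a *\<^sub>R y" "m \<in> R" for m x y
  proof -
    define C where "C = (1 - a) * (norm (x - m))\<^sup>2 + a * (norm (y - m))\<^sup>2"
    have C: "C \<ge> 0" using a by (simp add: C_def)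
    have main: "D m \<le> (1 - a) * D x + a * D y + C / (2 * u)" if u: "u > 0" for u
    proof -
      obtain \<nu> where \<nu>: "norm \<nu> = 1" "D m + u \<le> D (m + u *\<^sub>R \<nu>)" using ray[OF m(2), of u] u by auto
      have nn: "\<nu> \<bullet> \<nu> = 1" using \<nu>(1) norm_eq_1 by blast
      \<comment> \<open>The distance \<open>b\<close> from the far point to \<open>w\<close> is
        bounded through \<open>2 * u * b \<le> u\<^sup>2 + b\<^sup>2\<close>: affine in
        \<open>w\<close> up to an error of order \<open>1 / u\<close>.\<close>
      have est: "D (m + u *\<^sub>R \<nu>) \<le> D w + (u - \<nu> \<bullet> (w - m) + (norm (w - m))\<^sup>2 / (2 * u))" for w
      proof -
        define v where "v = w - m"
        define b where "b = norm (u *\<^sub>R \<nu> - v)"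
        have "b\<^sup>2 = u\<^sup>2 - 2 * u * (\<nu> \<bullet> v) + (norm v)\<^sup>2"
          unfolding b_def power2_norm_eq_inner
          by (simp add: inner_diff_left inner_diff_right nn inner_commute[of v \<nu>] power2_eq_square right_diff_distrib)
        moreover have "2 * u * b \<le> u\<^sup>2 + b\<^sup>2" using sum_squares_bound[of u b] by simp
        ultimately have "2 * u * b \<le> 2 * u\<^sup>2 - 2 * u * (\<nu> \<bullet> v) + (norm v)\<^sup>2" by linarith
        also have "\<dots> = 2 * u * (u - \<nu> \<bullet> v) + (norm v)\<^sup>2" by (simp only: right_diff_distrib mult.assoc power2_eq_square)
        also have "\<dots> = 2 * u * (u - \<nu> \<bullet> v) + 2 * u * ((norm v)\<^sup>2 / (2 * u))" using u by simp
        also have "\<dots> = 2 * u * (u - \<nu> \<bullet> v + (norm v)\<^sup>2 / (2 * u))" by (rule distrib_left[symmetric])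
        finally have "b \<le> u - \<nu> \<bullet> v + (norm v)\<^sup>2 / (2 * u)" using u by simp
        moreover have "dist (m + u *\<^sub>R \<nu>) w = b" by (simp add: b_def v_def dist_norm algebra_simps)
        ultimately show ?thesis using lip[of "m + u *\<^sub>R \<nu>" w] unfolding v_def by linarith
      qed
      \<comment> \<open>Since \<open>m\<close> is the weighted mean of \<open>x\<close> and
        \<open>y\<close>, the affine terms of the two estimates cancel.\<close>
      have "(1 - a) *\<^sub>R (x - m) + a *\<^sub>R (y - m) = 0" by (simp add: m(1) algebra_simps)
      then have "\<nu> \<bullet> ((1 - a) *\<^sub>R (x - m) + a *\<^sub>R (y - m)) = 0" by simp
      then have z: "(1 - a) * (\<nu> \<bullet> (x - m)) + a * (\<nu> \<bullet> (y - m)) = 0" by (simp only: inner_add_right inner_scaleR_right)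
      have "D m + u \<le> (1 - a) * D (m + u *\<^sub>R \<nu>) + a * D (m + u *\<^sub>R \<nu>)" using \<nu>(2) by (simp add: algebra_simps)
      also have "\<dots> \<le> (1 - a) * (D x + (u - \<nu> \<bullet> (x - m) + (norm (x - m))\<^sup>2 / (2 * u))) +
          a * (D y + (u - \<nu> \<bullet> (y - m) + (norm (y - m))\<^sup>2 / (2 * u)))"
        using a by (intro add_mono mult_left_mono est) auto
      also have "\<dots> = (1 - a) * D x + a * D y + u - ((1 - a) * (\<nu> \<bullet> (x - m)) + a * (\<nu> \<bullet> (y - m))) + C / (2 * u)"
        by (simp add: C_def add_divide_distrib diff_divide_distrib algebra_simps)
      finally show ?thesis using z by simp
    qed
    show ?thesis
    proof (rule field_le_epsilon)
      fix \<eta> :: real assume \<eta>: "\<eta> > 0"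
      define u where "u = (C + 1) / \<eta>"
      have u: "u > 0" using C \<eta> by (simp add: u_def)
      have "C / (2 * u) \<le> \<eta>"
      proof -
        have "u * \<eta> = C + 1" using \<eta> by (simp add: u_def)
        then have "C \<le> \<eta> * (2 * u)" using C by (simp add: mult.commute)
        then show ?thesis using u by (simp add: pos_divide_le_eq)
      qed
      then show "D m \<le> (1 - a) * D x + a * D y + \<eta>" using main[OF u] by linarith
    qed
  qed
  show "D ((1 - a) *\<^sub>R x + a *\<^sub>R y) \<le> (1 - a) * D x + a * D y"
  proof (rule field_le_epsilon)
    fix \<eta> :: real assume "\<eta> > 0"
    then obtain m where m: "m \<in> R" "dist m ((1 - a) *\<^sub>R x + a *\<^sub>R y) < \<eta> / 2" using dense[of "\<eta> / 2"] by auto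
    \<comment> \<open>Shifting both end points by the same small \<open>w\<close> moves their
      combination to a point of \<open>R\<close>, where the inequality is already known.\<close>
    define w where "w = m - ((1 - a) *\<^sub>R x + a *\<^sub>R y)"
    have nw: "norm w < \<eta> / 2" using m(2) by (simp add: w_def dist_norm)
    have "m = (1 - a) *\<^sub>R (x + w) + a *\<^sub>R (y + w)" by (simp add: w_def algebra_simps)
    then have "D m \<le> (1 - a) * D (x + w) + a * D (y + w)" using reg m(1) by blast
    also have "\<dots> \<le> (1 - a) * (D x + norm w) + a * (D y + norm w)"
      using a lip[of "x + w" x] lip[of "y + w" y] by (intro add_mono mult_left_mono) (auto simp: dist_norm)
    also have "\<dots> = (1 - a) * D x + a * D y + norm w" by (simp add: algebra_simps)
    finally have "D m \<le> (1 - a) * D x + a * D y + norm w" .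
    moreover have "D ((1 - a) *\<^sub>R x + a *\<^sub>R y) \<le> D m + norm w"
      using lip[of "(1 - a) *\<^sub>R x + a *\<^sub>R y" m] by (simp add: w_def dist_norm norm_minus_commute)
    ultimately show "D ((1 - a) *\<^sub>R x + a *\<^sub>R y) \<le> (1 - a) * D x + a * D y + \<eta>" using nw by linarith
  qed
qed simp

section \<open>The singular set is an affine subspace\<close>

lemma infdist_affine_decomp:
  fixes L :: "'a::euclidean_space set"
  assumes L: "subspace L" and l: "l \<in> L" and m: "\<And>l. l \<in> L \<Longrightarrow> m \<bullet> l = 0"
  shows "infdist (p + l + m) ((+) p ` L) = norm m"
proof (rule antisym)
  have "infdist (p + l + m) ((+) p ` L) \<le> dist (p + l + m) (p + l)" using l by (intro infdist_le) auto
  then show "infdist (p + l + m) ((+) p ` L) \<le> norm m" by (simp add: dist_norm)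
  have "norm m \<le> dist (p + l + m) s" if s: "s \<in> (+) p ` L" for s
  proof -
    obtain l' where l': "l' \<in> L" "s = p + l'" using s by blast
    have "m \<bullet> (l - l') = 0" using m subspace_diff[OF L l l'(1)] by blast
    then have "(norm ((l - l') + m))\<^sup>2 = (norm (l - l'))\<^sup>2 + (norm m)\<^sup>2"
      by (simp add: power2_norm_eq_inner inner_add_left inner_add_right inner_commute)
    then have "(norm m)\<^sup>2 \<le> (norm ((l - l') + m))\<^sup>2" by simp
    then have "norm m \<le> norm ((l - l') + m)" by (rule power2_le_imp_le) simp
    then show ?thesis by (simp add: l'(2) dist_norm algebra_simps)
  qed
  moreover have "(+) p ` L \<noteq> {}" using l by blast
  ultimately show "norm m \<le> infdist (p + l + m) ((+) p ` L)" unfolding infdist_def by (auto intro: cINF_greatest)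
qed

lemma affine_decomp:
  fixes L :: "'a::euclidean_space set"
  assumes L: "subspace L"
  obtains l m where "z = p + l + m" "l \<in> L" "\<And>l'. l' \<in> L \<Longrightarrow> m \<bullet> l' = 0"
proof (rule orthogonal_subspace_decomp_exists[of L "z - p"])
  fix y w assume h: "y \<in> span L" "\<And>v. v \<in> span L \<Longrightarrow> orthogonal w v" "z - p = y + w"
  show ?thesis
  proof (rule that[of y w])
    show "z = p + y + w" using h(3) by (simp add: algebra_simps)
    show "y \<in> L" using h(1) L span_eq_iff by blast
    show "w \<bullet> l' = 0" if "l' \<in> L" for l' using h(2)[OF span_base[OF that]] by (simp add: orthogonal_def)
  qed
qed

lemma unit_perp_subspace:
  fixes L :: "'a::euclidean_space set"
  assumes "dim L < DIM('a)"
  shows "\<exists>c. norm c = 1 \<and> (\<forall>l\<in>L. c \<bullet> l = 0)"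
  using assms
proof (rule orthogonal_to_subspace_exists)
  fix x assume x: "x \<noteq> 0" "\<And>y. y \<in> span L \<Longrightarrow> orthogonal x y"
  have "sgn x \<bullet> l = 0" if "l \<in> L" for l
    using x(2)[OF span_base[OF that]] by (simp add: orthogonal_def sgn_div_norm)
  moreover have "norm (sgn x) = 1" using x(1) by (simp add: norm_sgn)
  ultimately show ?thesis by blast
qed

text \<open>A rotation in the orthogonal complement of \<open>L\<close> takes \<open>a\<close> to
  \<open>b\<close>. When \<open>b\<close> is \<open>a\<close> or \<open>- a\<close> the plane of
  rotation is not determined, and codimension two is what provides one.\<close>

lemma great_circle:
  fixes L :: "'a::euclidean_space set"
  assumes dim: "dim L + 2 \<le> DIM('a)" and a: "norm a = 1" "\<And>l. l \<in> L \<Longrightarrow> a \<bullet> l = 0"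
    and b: "norm b = 1" "\<And>l. l \<in> L \<Longrightarrow> b \<bullet> l = 0"
  obtains c \<alpha> where "norm c = 1" "a \<bullet> c = 0" "\<And>l. l \<in> L \<Longrightarrow> c \<bullet> l = 0" "0 \<le> \<alpha>" "b = cos \<alpha> *\<^sub>R a + sin \<alpha> *\<^sub>R c"
proof -
  have aa: "a \<bullet> a = 1" and bb: "b \<bullet> b = 1" using a(1) b(1) norm_eq_1 by blast+
  define w where "w = b - (a \<bullet> b) *\<^sub>R a"
  have aw: "a \<bullet> w = 0" by (simp add: w_def inner_diff_right aa)
  have wL: "w \<bullet> l = 0" if "l \<in> L" for l using a(2)[OF that] b(2)[OF that] by (simp add: w_def inner_diff_left)
  have bw: "b = (a \<bullet> b) *\<^sub>R a + w" by (simp add: w_def)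
  have "b \<bullet> b = ((a \<bullet> b) *\<^sub>R a + w) \<bullet> ((a \<bullet> b) *\<^sub>R a + w)" using bw by simp
  then have "(a \<bullet> b)\<^sup>2 + (norm w)\<^sup>2 = 1"
    unfolding power2_norm_eq_inner
    by (simp add: bb aa aw inner_add_left inner_add_right inner_commute[of w a] power2_eq_square)
  from sincos_total_pi[OF norm_ge_zero this]
  obtain \<alpha> where \<alpha>: "0 \<le> \<alpha>" "a \<bullet> b = cos \<alpha>" "norm w = sin \<alpha>" by blast
  have "\<exists>c. norm c = 1 \<and> a \<bullet> c = 0 \<and> (\<forall>l\<in>L. c \<bullet> l = 0) \<and> w = norm w *\<^sub>R c"
  proof (cases "w = 0")
    case True
    have "dim (insert a L) < DIM('a)" using dim by (simp add: dim_insert)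
    from unit_perp_subspace[OF this] obtain c where "norm c = 1" "\<forall>l\<in>insert a L. c \<bullet> l = 0" by blast
    then show ?thesis using True by (intro exI[of _ c]) (auto simp: inner_commute)
  next
    case False
    then show ?thesis using aw wL by (intro exI[of _ "sgn w"]) (auto simp: norm_sgn sgn_div_norm)
  qed
  then obtain c where c: "norm c = 1" "a \<bullet> c = 0" "\<forall>l\<in>L. c \<bullet> l = 0" "w = norm w *\<^sub>R c" by blast
  have "b = cos \<alpha> *\<^sub>R a + sin \<alpha> *\<^sub>R c" using bw c(4) \<alpha>(2,3) by metis
  then show ?thesis using that c(1-3) \<alpha>(1) by blast
qed

lemma regular_surface_affine:
  fixes L :: "'a::euclidean_space set"
  assumes "subspace L" shows "regular_surface (dim L) ((+) p ` L)"
  unfolding regular_surface_def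
proof
  fix q
  show "\<exists>U (V::'a set) \<psi> \<psi>' M. open U \<and> q \<in> U \<and> open V \<and> homeomorphism U V \<psi> \<psi>'
        \<and> C1_on U \<psi> \<and> C1_on V \<psi>' \<and> subspace M \<and> dim M = dim L \<and> \<psi> ` ((+) p ` L \<inter> U) = V \<inter> M"
  proof (intro exI conjI)
    show "homeomorphism UNIV UNIV (\<lambda>x. x - p) (\<lambda>x. p + x)"
      by (auto simp: homeomorphism_def intro!: continuous_intros)
    show "C1_on UNIV (\<lambda>x. x - p)" "C1_on UNIV (\<lambda>x. p + x)"
      unfolding C1_on_def by (auto intro!: exI[of _ "\<lambda>x v. v"] derivative_eq_intros)
    show "(\<lambda>x. x - p) ` ((+) p ` L \<inter> UNIV) = UNIV \<inter> L" by (auto simp: image_image)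
  qed (use assms in auto)
qed

lemma flat_in_tang:
  assumes "\<And>s::real. z + s *\<^sub>R l \<in> S" shows "l \<in> tang S z"
  unfolding tang_def
proof (intro CollectI exI conjI)
  show "((\<lambda>s::real. z + s *\<^sub>R l) has_vector_derivative l) (at 0)"
    unfolding has_vector_derivative_def by (auto intro!: derivative_eq_intros)
qed (use assms in auto)

text \<open>All lines through \<open>z\<close> with direction in \<open>L\<close> stay in
  \<open>S\<close>, so \<open>L\<close> is contained in the tangent space at
  \<open>z\<close>.\<close>

lemma flat_dim_le:
  fixes S :: "'a::euclidean_space set"
  assumes "regular_surface d S" "z \<in> S" "subspace L" "\<And>l. l \<in> L \<Longrightarrow> z + l \<in> S"
  shows "dim L \<le> d"
proof -
  have "L \<subseteq> tang S z" using flat_in_tang[of z _ S] assms(3,4) subspace_scale by blast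
  then show ?thesis using dim_subset surface_tang(2)[OF assms(1,2)] by metis
qed

context metric_critical
begin

text \<open>Convexity of the distance makes \<open>Sg\<close> convex, hence connected, hence a
  single critical component. For \<open>z\<close> in the affine hull but outside \<open>Sg\<close>,
  the direction \<open>e\<close> from the closest point \<open>k\<close> to \<open>z\<close> is
  normal at \<open>k\<close>. The tube supports \<open>Sg\<close> from the opposite side too, so
  \<open>Sg\<close> lies in the hyperplane through \<open>k\<close> orthogonal to \<open>e\<close>,
  and its affine hull cannot contain \<open>z\<close>.\<close>

lemma Sg_affine:
  assumes p: "sing p"
  obtains L d where "subspace L" "Sg = (+) p ` L" "dim L \<le> d" "d + 2 \<le> DIM('a)"
proof -
  have pS: "p \<in> Sg" using p by (simp add: Sg_def)
  have "convex_on UNIV (\<lambda>z. infdist z Sg)"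
  proof (rule convex_of_outward_rays[where R="{z. G z \<noteq> 0}"])
    show "infdist x Sg \<le> infdist y Sg + dist x y" for x y by (rule infdist_triangle)
    show "\<exists>\<nu>. norm \<nu> = 1 \<and> infdist z Sg + u \<le> infdist (z + u *\<^sub>R \<nu>) Sg" if "z \<in> {z. G z \<noteq> 0}" "0 \<le> u" for z u
      using outward_ray[OF p] that by simp
    show "\<exists>z\<in>{z. G z \<noteq> 0}. dist z x < \<epsilon>" if "0 < \<epsilon>" for x \<epsilon> using dense_regular[OF that, of x] by blast
  qed
  then have conv: "infdist (u *\<^sub>R x + v *\<^sub>R y) Sg \<le> u * infdist x Sg + v * infdist y Sg"
    if "0 \<le> u" "0 \<le> v" "u + v = 1" for x y u v using that unfolding convex_on_def by blast
  have Sg0: "z \<in> Sg \<longleftrightarrow> infdist z Sg = 0" for z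
    using in_closed_iff_infdist_zero[OF closed_Sg] pS by blast
  have cS: "convex Sg"
  proof (rule convexI)
    fix x y u v assume h: "x \<in> Sg" "y \<in> Sg" "(0::real) \<le> u" "0 \<le> v" "u + v = 1"
    have "infdist x Sg = 0" "infdist y Sg = 0" using h(1,2) Sg0 by blast+
    then have "infdist (u *\<^sub>R x + v *\<^sub>R y) Sg \<le> 0" using conv[OF h(3-5), of x y] by simp
    then have "infdist (u *\<^sub>R x + v *\<^sub>R y) Sg = 0" using infdist_nonneg[of "u *\<^sub>R x + v *\<^sub>R y" Sg] by linarith
    then show "u *\<^sub>R x + v *\<^sub>R y \<in> Sg" using Sg0 by blast
  qed
  have Sc: "Sg = ccomp p"
  proof
    show "Sg \<subseteq> ccomp p" unfolding ccomp_def
      by (rule connected_component_maximal[OF pS convex_connected[OF cS]]) (auto simp: Sg_def sing_def)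
    show "ccomp p \<subseteq> Sg" using sing_comp[OF p] by (auto simp: Sg_def)
  qed
  obtain d where d: "d + 2 \<le> DIM('a)" "regular_surface d Sg" using p Sc by (auto simp: sing_def)
  have crit_local: "tang crit k = tang Sg k" if "k \<in> Sg" for k
  proof -
    have "k \<in> ccomp p" using that Sc by blast
    then have "G k = 0" "ccomp k = ccomp p" using comp_subset[of p] comp_eq by auto
    then show ?thesis using tang_crit[of k] Sc by simp
  qed
  have "affine hull Sg \<subseteq> Sg"
  proof
    fix z assume z: "z \<in> affine hull Sg"
    show "z \<in> Sg"
    proof (rule ccontr)
      assume nz: "z \<notin> Sg"
      define k where "k = closest_point Sg z"
      have ne: "Sg \<noteq> {}" using pS by blast
      have kS: "k \<in> Sg" unfolding k_def by (rule closest_point_in_set[OF closed_Sg ne])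
      have Gk: "G k = 0" using kS sing_crit by (simp add: Sg_def)
      have zk: "z \<noteq> k" using kS nz by blast
      define s where "s = norm (z - k)"
      define e where "e = (z - k) /\<^sub>R s"
      have s: "s > 0" using zk by (simp add: s_def)
      have e: "norm e = 1" using s by (simp add: e_def s_def)
      have ze: "z = k + s *\<^sub>R e" using s by (simp add: e_def)
      have le: "(z - k) \<bullet> (x - k) \<le> 0" if "x \<in> Sg" for x
        unfolding k_def by (rule closest_point_dot[OF cS closed_Sg that])
      have perp: "v \<bullet> e = 0" if v: "v \<in> tang crit k" for v
      proof -
        have "v \<in> tang Sg k" using v crit_local[OF kS] by simp
        then obtain \<gamma> where g: "\<gamma> 0 = k" "(\<gamma> has_vector_derivative v) (at 0)" "\<forall>\<^sub>F r in at (0::real). \<gamma> r \<in> Sg"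
          unfolding tang_def by blast
        have d: "((\<lambda>r. e \<bullet> (\<gamma> r - k)) has_derivative (\<lambda>h. e \<bullet> (h *\<^sub>R v))) (at 0)"
          using g(2)[unfolded has_vector_derivative_def] by (auto intro!: derivative_eq_intros)
        then have d': "((\<lambda>r. - (e \<bullet> (\<gamma> r - k))) has_derivative (\<lambda>h. - (e \<bullet> (h *\<^sub>R v)))) (at 0)"
          by (rule has_derivative_minus)
        have "(\<lambda>h. - (e \<bullet> (h *\<^sub>R v))) = (\<lambda>h. 0)"
        proof (rule has_derivative_local_min[OF d'])
          show "\<forall>\<^sub>F r in at 0. - (e \<bullet> (\<gamma> 0 - k)) \<le> - (e \<bullet> (\<gamma> r - k))"
            using g(3)
          proof eventually_elim
            case (elim r)
            have "s * (e \<bullet> (\<gamma> r - k)) \<le> 0" using le[OF elim] by (simp add: ze)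
            then show ?case using s g(1) by (simp add: mult_le_0_iff)
          qed
        qed
        from fun_cong[OF this, of 1] show ?thesis by (simp add: inner_commute)
      qed
      have ge: "(x - k) \<bullet> e = 0" if x: "x \<in> Sg" for x
      proof (rule tubular_exists[OF Gk])
        fix \<epsilon> assume "tubular k \<epsilon>"
        note \<epsilon> = tubularD[OF this]
        \<comment> \<open>The negative time uses the tube on the side away from \<open>z\<close>,
          where \<open>k\<close> is again the closest point of \<open>Sg\<close>.\<close>
        define t where "t = - (\<epsilon> / 2)"
        have t: "infdist (k + t *\<^sub>R e) crit = - t" using \<epsilon>(2)[OF Gk _ e perp, of t] \<epsilon>(1) by (simp add: t_def)
        have "closest_point Sg (k + t *\<^sub>R e) = k"
        proof (rule closest_point_unique[OF cS closed_Sg kS, symmetric])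
          show "\<forall>y\<in>Sg. dist (k + t *\<^sub>R e) k \<le> dist (k + t *\<^sub>R e) y"
          proof
            fix y assume "y \<in> Sg"
            then have "y \<in> crit" using sing_crit by (simp add: Sg_def)
            then have "- t \<le> dist (k + t *\<^sub>R e) y" using infdist_le[of y crit "k + t *\<^sub>R e"] t by simp
            then show "dist (k + t *\<^sub>R e) k \<le> dist (k + t *\<^sub>R e) y" using e \<epsilon>(1) by (simp add: dist_norm t_def)
          qed
        qed
        then have "(k + t *\<^sub>R e - k) \<bullet> (x - k) \<le> 0" using closest_point_dot[OF cS closed_Sg x, of "k + t *\<^sub>R e"] by simp
        then have "t * (e \<bullet> (x - k)) \<le> 0" by simp
        then have 1: "0 \<le> e \<bullet> (x - k)" using \<epsilon>(1) by (simp add: t_def zero_le_mult_iff)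
        have "s * (e \<bullet> (x - k)) \<le> 0" using le[OF x] by (simp add: ze)
        then have "e \<bullet> (x - k) \<le> 0" using s by (simp add: mult_le_0_iff)
        then have "e \<bullet> (x - k) = 0" using 1 by linarith
        then show ?thesis by (subst inner_commute)
      qed
      have "e \<bullet> x = e \<bullet> k" if "x \<in> Sg" for x
        using ge[OF that] by (simp add: inner_diff_left inner_commute[of e])
      then have "Sg \<subseteq> {x. e \<bullet> x = e \<bullet> k}" by blast
      then have "affine hull Sg \<subseteq> {x. e \<bullet> x = e \<bullet> k}" by (intro hull_minimal affine_hyperplane) auto
      then have "e \<bullet> z = e \<bullet> k" using z by blast
      moreover have "e \<bullet> e = 1" using e norm_eq_1 by blast
      ultimately have "s = 0" by (simp add: ze inner_add_right)
      then show False using s by simp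
    qed
  qed
  then have "affine hull Sg = Sg" using hull_subset[of Sg affine] by blast
  then have aff: "affine Sg" by (simp only: affine_hull_eq)
  define L where "L = (\<lambda>x. - p + x) ` Sg"
  have L: "subspace L" unfolding L_def by (rule affine_diffs_subspace[OF aff pS])
  have SL: "Sg = (+) p ` L" by (auto simp: L_def image_image)
  have "dim L \<le> d" by (rule flat_dim_le[OF d(2) pS L]) (use SL in blast)
  then show ?thesis using that L SL d(1) by blast
qed

text \<open>At \<open>p + l + m\<close>, with \<open>m\<close> orthogonal to \<open>L\<close>, the
  gradient is parallel to \<open>m\<close>. So \<open>f\<close> is constant along translations in
  \<open>L\<close> and along circles of \<open>m\<close> in the orthogonal complement. Codimension
  at least two lets these curves join any two points at equal distance from \<open>Sg\<close>, which
  makes the distance a defining function with connected levels.\<close>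

lemma singular_leaves:
  assumes p: "sing p" and L: "subspace L" and SL: "Sg = (+) p ` L" and dimL: "dim L + 2 \<le> DIM('a)"
  shows "leaf x = {z. infdist z Sg = infdist x Sg}"
proof -
  let ?D = "\<lambda>z. infdist z Sg"
  have Gperp: "G (p + l + m) \<bullet> w = 0" if l: "l \<in> L" and m: "\<And>l. l \<in> L \<Longrightarrow> m \<bullet> l = 0" and w: "m \<bullet> w = 0" for l m w
  proof (cases "G (p + l + m) = 0")
    case False
    define z where "z = p + l + m"
    have Gz: "G z \<noteq> 0" using False by (simp add: z_def)
    obtain t where t: "sing (ray z t)" by (rule every_line_sing[OF p Gz])
    have t0: "t \<noteq> 0" using sing_crit[OF t] Gz by (auto simp: ray_def)
    have "ray z t \<in> (+) p ` L" using t SL by (auto simp: Sg_def)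
    then obtain l' where l': "l' \<in> L" "ray z t = p + l'" by blast
    have "\<bar>t\<bar> = norm m" using dist_Sg[OF Gz t] infdist_affine_decomp[OF L l m, of p] by (simp add: SL z_def)
    moreover have tN: "- (t *\<^sub>R N z) = (l - l') + m" using l'(2) by (simp add: ray_def z_def algebra_simps)
    moreover have "norm (- (t *\<^sub>R N z)) = \<bar>t\<bar>" using Gz by simp
    \<comment> \<open>The singular hit \<open>p + l'\<close> on the normal line is as far from
      \<open>z\<close> as \<open>Sg\<close> itself, so by Pythagoras it is the orthogonal projection
      \<open>p + l\<close>.\<close>
    ultimately have "norm ((l - l') + m) = norm m" by metis
    then have eq: "((l - l') + m) \<bullet> ((l - l') + m) = m \<bullet> m" by (simp only: norm_eq)
    define k where "k = l - l'"
    have "m \<bullet> k = 0" unfolding k_def using m subspace_diff[OF L l l'(1)] by blast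
    then have "k \<bullet> k = 0" using eq unfolding k_def[symmetric]
      by (simp add: inner_add_left inner_add_right inner_commute[of k m])
    then have "l - l' = 0" by (simp add: k_def)
    then have "- (t *\<^sub>R N z) = m" using tN by simp
    then have "- (t * (N z \<bullet> w)) = 0" using w by (metis inner_minus_left inner_scaleR_left)
    then have "N z \<bullet> w = 0" using t0 by simp
    then show ?thesis unfolding z_def[symmetric] by (subst G_eq_N) simp
  qed simp
  have move: "f (\<gamma> a) = f (\<gamma> b) \<and> connected_component {z. ?D z = r} (\<gamma> a) (\<gamma> b)"
    if ab: "a \<le> b" and g: "\<And>s. s \<in> {a..b} \<Longrightarrow> \<exists>l m v. \<gamma> s = p + l + m \<and> l \<in> L \<and> (\<forall>l\<in>L. m \<bullet> l = 0) \<and> norm m = r \<and>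
      (\<gamma> has_vector_derivative v) (at s) \<and> m \<bullet> v = 0" for \<gamma> :: "real \<Rightarrow> 'a" and a b r
  proof
    show "f (\<gamma> a) = f (\<gamma> b)"
    proof (rule constant_along_path[where a=a and b=b and \<gamma>=\<gamma> and \<phi>=f])
      fix s assume "s \<in> {a..b}"
      from g[OF this] obtain l m v where h: "\<gamma> s = p + l + m" "l \<in> L" "\<forall>l\<in>L. m \<bullet> l = 0" "norm m = r"
        "(\<gamma> has_vector_derivative v) (at s)" "m \<bullet> v = 0" by (elim exE conjE)
      have "G (\<gamma> s) \<bullet> v = 0" unfolding h(1) by (rule Gperp[OF h(2) bspec[OF h(3)] h(6)])
      then show "\<exists>\<phi>' d. (f has_derivative \<phi>') (at (\<gamma> s)) \<and> (\<gamma> has_vector_derivative d) (at s) \<and> \<phi>' d = 0"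
        using f_deriv h(5) by blast
    qed (use ab in auto)
    have "isCont \<gamma> s" if s: "s \<in> {a..b}" for s
    proof -
      from g[OF s] obtain v where "(\<gamma> has_vector_derivative v) (at s)" by (elim exE conjE)
      then show ?thesis by (rule has_vector_derivative_continuous)
    qed
    then have "connected (\<gamma> ` {a..b})"
      by (intro connected_continuous_image connected_Icc continuous_at_imp_continuous_on) blast
    moreover have "?D (\<gamma> s) = r" if s: "s \<in> {a..b}" for s
    proof -
      from g[OF s] obtain l m where h: "\<gamma> s = p + l + m" "l \<in> L" "\<forall>l\<in>L. m \<bullet> l = 0" "norm m = r"
        by (elim exE conjE)
      show ?thesis unfolding h(1) SL using infdist_affine_decomp[OF L h(2) bspec[OF h(3)], of p] h(4) by simp
    qed
    then have "\<gamma> ` {a..b} \<subseteq> {z. ?D z = r}" by blast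
    moreover have "\<gamma> a \<in> \<gamma> ` {a..b}" "\<gamma> b \<in> \<gamma> ` {a..b}" using ab by auto
    ultimately show "connected_component {z. ?D z = r} (\<gamma> a) (\<gamma> b)" unfolding connected_component_def by blast
  qed
  have join: "f x = f y \<and> connected_component {z. ?D z = ?D x} x y" if xy: "?D x = ?D y" for x y
  proof (rule affine_decomp[OF L, of x p], rule affine_decomp[OF L, of y p])
    fix l m l' m' assume x: "x = p + l + m" "l \<in> L" "\<And>l. l \<in> L \<Longrightarrow> m \<bullet> l = 0"
      and y: "y = p + l' + m'" "l' \<in> L" "\<And>l. l \<in> L \<Longrightarrow> m' \<bullet> l = 0"
    define r where "r = norm m"
    have Dx: "?D x = r" using infdist_affine_decomp[OF L x(2,3), of p] by (simp add: SL x(1) r_def)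
    have m'r: "norm m' = r" using infdist_affine_decomp[OF L y(2,3), of p] Dx xy by (simp add: SL y(1))
    have 1: "f x = f (p + l' + m) \<and> connected_component {z. ?D z = r} x (p + l' + m)"
    proof -
      define \<gamma> where "\<gamma> = (\<lambda>s::real. p + (l + s *\<^sub>R (l' - l)) + m)"
      have "f (\<gamma> 0) = f (\<gamma> 1) \<and> connected_component {z. ?D z = r} (\<gamma> 0) (\<gamma> 1)"
      proof (rule move)
        fix s :: real
        have "(\<gamma> has_vector_derivative (l' - l)) (at s)"
          unfolding \<gamma>_def has_vector_derivative_def by (auto intro!: derivative_eq_intros)
        moreover have "l + s *\<^sub>R (l' - l) \<in> L" using x(2) y(2) L by (intro subspace_add subspace_scale subspace_diff)
        moreover have "m \<bullet> (l' - l) = 0" using x(3) subspace_diff[OF L y(2) x(2)] by blast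
        ultimately show "\<exists>la ma v. \<gamma> s = p + la + ma \<and> la \<in> L \<and> (\<forall>l\<in>L. ma \<bullet> l = 0) \<and> norm ma = r \<and>
            (\<gamma> has_vector_derivative v) (at s) \<and> ma \<bullet> v = 0"
          unfolding \<gamma>_def r_def using x(3) by blast
      qed simp
      then show ?thesis by (simp add: \<gamma>_def x(1))
    qed
    have 2: "f (p + l' + m) = f y \<and> connected_component {z. ?D z = r} (p + l' + m) y"
    proof (cases "r = 0")
      case True
      then have "m = 0" "m' = 0" using m'r by (auto simp: r_def)
      then have "p + l' + m = y" by (simp add: y(1))
      moreover have "?D y = r" using Dx xy by simp
      ultimately show ?thesis by simp
    next
      case False
      then have r: "r > 0" by (simp add: r_def)
      define a where "a = m /\<^sub>R r"
      define b where "b = m' /\<^sub>R r"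
      have a: "norm a = 1" "\<And>l. l \<in> L \<Longrightarrow> a \<bullet> l = 0" "m = r *\<^sub>R a" using r x(3) by (auto simp: a_def r_def)
      have b: "norm b = 1" "\<And>l. l \<in> L \<Longrightarrow> b \<bullet> l = 0" "m' = r *\<^sub>R b" using r y(3) m'r by (auto simp: b_def)
      show ?thesis
      proof (rule great_circle[OF dimL a(1,2) b(1,2)])
        fix c \<alpha> assume c: "norm c = 1" "a \<bullet> c = 0" "\<And>l. l \<in> L \<Longrightarrow> c \<bullet> l = 0" "0 \<le> \<alpha>" "b = cos \<alpha> *\<^sub>R a + sin \<alpha> *\<^sub>R c"
        have aa: "a \<bullet> a = 1" and cc: "c \<bullet> c = 1" and ca: "c \<bullet> a = 0"
          using a(1) c(1,2) norm_eq_1 by (blast, blast, simp add: inner_commute)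
        define n where "n = (\<lambda>\<theta>. cos \<theta> *\<^sub>R a + sin \<theta> *\<^sub>R c)"
        define n' where "n' = (\<lambda>\<theta>. - sin \<theta> *\<^sub>R a + cos \<theta> *\<^sub>R c)"
        define \<gamma> where "\<gamma> = (\<lambda>\<theta>. p + l' + r *\<^sub>R n \<theta>)"
        have "f (\<gamma> 0) = f (\<gamma> \<alpha>) \<and> connected_component {z. ?D z = r} (\<gamma> 0) (\<gamma> \<alpha>)"
        proof (rule move[OF c(4)])
          fix s :: real
          have "n s \<bullet> n s = 1" using sin_cos_squared_add[of s]
            by (simp add: n_def inner_add_left inner_add_right aa cc ca c(2) power2_eq_square add.commute)
          then have "norm (r *\<^sub>R n s) = r" using r by (simp add: norm_eq_1[symmetric])
          moreover have "n s \<bullet> n' s = 0"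
            by (simp add: n_def n'_def inner_add_left inner_add_right inner_diff_right aa cc ca c(2))
          then have "(r *\<^sub>R n s) \<bullet> (r *\<^sub>R n' s) = 0" by simp
          moreover have "(\<gamma> has_vector_derivative r *\<^sub>R n' s) (at s)"
            unfolding \<gamma>_def n_def n'_def has_vector_derivative_def
            by (auto intro!: derivative_eq_intros simp: algebra_simps)
          moreover have "\<forall>l\<in>L. (r *\<^sub>R n s) \<bullet> l = 0" using a(2) c(3) by (simp add: n_def inner_add_left)
          ultimately show "\<exists>l m v. \<gamma> s = p + l + m \<and> l \<in> L \<and> (\<forall>l\<in>L. m \<bullet> l = 0) \<and> norm m = r \<and>
              (\<gamma> has_vector_derivative v) (at s) \<and> m \<bullet> v = 0"
            using y(2) unfolding \<gamma>_def by blast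
        qed
        moreover have "\<gamma> 0 = p + l' + m" by (simp add: \<gamma>_def n_def a(3))
        moreover have "\<gamma> \<alpha> = y" by (simp add: \<gamma>_def n_def y(1) b(3) c(5))
        ultimately show ?thesis by simp
      qed
    qed
    show ?thesis using 1 2 connected_component_trans unfolding Dx by metis
  qed
  show ?thesis
  proof (rule leaf_eq_level_of)
    show "continuous_on UNIV ?D" by (intro continuous_on_infdist continuous_on_id)
    show "connected {z. ?D z = r}" for r
      unfolding connected_iff_connected_component
    proof (intro ballI)
      fix x y assume "x \<in> {z. ?D z = r}" "y \<in> {z. ?D z = r}"
      then show "connected_component {z. ?D z = r} x y" using join[of x y] by simp
    qed
    show "f x = f y" if "?D x = ?D y" for x y using join[OF that] by blast
    show "?D y = ?D x" if x: "G x \<noteq> 0" and y: "y \<in> leaf x" for x y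
    proof -
      obtain t where t: "sing (ray x t)" by (rule every_line_sing[OF p x])
      have Gy: "G y \<noteq> 0" using leaf_reg[OF y] x by blast
      show ?thesis using dist_Sg[OF x t] dist_Sg[OF Gy sing_transport[OF x y t]] by simp
    qed
  qed (rule dense_regular)
qed

lemma singular_level_surfaces:
  assumes p: "sing p"
  obtains L where "subspace L" "dim L + 2 \<le> DIM('a)" "G p = 0"
    "level_surfaces f = insert ((+) p ` L) ((\<lambda>r. {x. infdist x ((+) p ` L) = r}) ` {0<..})"
proof (rule Sg_affine[OF p])
  fix L d assume L: "subspace L" and SL: "Sg = (+) p ` L" and d: "dim L \<le> d" "d + 2 \<le> DIM('a)"
  have dimL: "dim L + 2 \<le> DIM('a)" using d by simp
  note leaves = singular_leaves[OF p L SL dimL]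
  have ne: "Sg \<noteq> {}" using p by (auto simp: Sg_def)
  have Sg0: "Sg = {z. infdist z Sg = 0}" using in_closed_iff_infdist_zero[OF closed_Sg ne] by blast
  have "dim L < DIM('a)" using dimL by simp
  from unit_perp_subspace[OF this] obtain c where c: "norm c = 1" "\<forall>l\<in>L. c \<bullet> l = 0" by blast
  have ex: "\<exists>z. infdist z Sg = r" if r: "r \<ge> 0" for r
  proof -
    have "infdist (p + 0 + r *\<^sub>R c) ((+) p ` L) = norm (r *\<^sub>R c)"
      by (rule infdist_affine_decomp[OF L subspace_0[OF L]]) (simp add: c(2))
    then show ?thesis using r c(1) SL by auto
  qed
  have "range leaf = insert Sg ((\<lambda>r. {x. infdist x Sg = r}) ` {0<..})"
  proof
    show "range leaf \<subseteq> insert Sg ((\<lambda>r. {x. infdist x Sg = r}) ` {0<..})"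
    proof clarify
      fix x assume no: "leaf x \<notin> (\<lambda>r. {x. infdist x Sg = r}) ` {0<..}"
      have "infdist x Sg \<le> 0"
      proof (rule ccontr)
        assume "\<not> infdist x Sg \<le> 0"
        then show False using no leaves[of x] by auto
      qed
      then have "infdist x Sg = 0" using infdist_nonneg[of x Sg] by simp
      then show "leaf x = Sg" using leaves[of x] Sg0 by simp
    qed
    have lev: "{x. infdist x Sg = r} \<in> range leaf" if "r \<ge> 0" for r
    proof -
      obtain z where "infdist z Sg = r" using ex \<open>r \<ge> 0\<close> by blast
      then have "leaf z = {x. infdist x Sg = r}" using leaves[of z] by simp
      then show ?thesis by blast
    qed
    show "insert Sg ((\<lambda>r. {x. infdist x Sg = r}) ` {0<..}) \<subseteq> range leaf"
      using lev lev[of 0] Sg0 by auto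
  qed
  then show ?thesis using that[OF L dimL sing_crit[OF p]] unfolding level_surfaces_eq SL by blast
qed

end

section \<open>The dimension of the axis and the classification\<close>

lemma regular_surface_singleton: "regular_surface 0 {p::'a::euclidean_space}"
  using regular_surface_affine[OF subspace_single_0, of p] by simp

text \<open>The axis is a critical level surface of dimension \<open>dim L\<close>. Every level
  surface is invariant under translations by \<open>L\<close>, so a regular surface among them has
  dimension at least \<open>dim L\<close>.\<close>

lemma least_critical_dimension:
  fixes f :: "'a::euclidean_space \<Rightarrow> real"
  assumes L: "subspace L" and p: "p \<in> critical_set f"
    and ls: "level_surfaces f = insert ((+) p ` L) ((\<lambda>r. {x. infdist x ((+) p ` L) = r}) ` {0<..})"
    and ne: "\<And>S. S \<in> level_surfaces f \<Longrightarrow> S \<noteq> {}"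
  shows "dim L = (LEAST d. \<exists>S \<in> level_surfaces f. S \<inter> critical_set f \<noteq> {} \<and> regular_surface d S)"
proof (rule Least_equality[symmetric])
  have "p \<in> (+) p ` L" using subspace_0[OF L] by force
  then show "\<exists>S \<in> level_surfaces f. S \<inter> critical_set f \<noteq> {} \<and> regular_surface (dim L) S"
    using ls p regular_surface_affine[OF L, of p] by (intro bexI[of _ "(+) p ` L"]) auto
  fix d assume "\<exists>S \<in> level_surfaces f. S \<inter> critical_set f \<noteq> {} \<and> regular_surface d S"
  then obtain S where S: "S \<in> level_surfaces f" "regular_surface d S" by blast
  obtain z where z: "z \<in> S" using ne[OF S(1)] by blast
  have "z + l \<in> S" if l: "l \<in> L" for l
  proof -
    consider "S = (+) p ` L" | r where "S = {x. infdist x ((+) p ` L) = r}" using S(1) ls by auto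
    then show ?thesis
    proof cases
      case 1
      then obtain l' where "l' \<in> L" "z = p + l'" using z by blast
      then show ?thesis using 1 subspace_add[OF L _ l] by (auto simp: add.assoc)
    next
      case 2
      show ?thesis
      proof (rule affine_decomp[OF L, of z p])
        fix l' m assume h: "z = p + l' + m" "l' \<in> L" "\<And>l'. l' \<in> L \<Longrightarrow> m \<bullet> l' = 0"
        have "z + l = p + (l' + l) + m" by (simp add: h(1))
        then have "infdist (z + l) ((+) p ` L) = infdist (p + (l' + l) + m) ((+) p ` L)" by (rule arg_cong)
        also have "\<dots> = norm m"
          by (rule infdist_affine_decomp[OF L subspace_add[OF L h(2) l] h(3)])
        also have "\<dots> = infdist z ((+) p ` L)" using infdist_affine_decomp[OF L h(2,3), of p] h(1) by simp
        finally show ?thesis using z 2 by simp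
      qed
    qed
  qed
  then show "dim L \<le> d" by (rule flat_dim_le[OF S(2) z L])
qed

text \<open>\<open>gradient\<close> is a choice, so a representing vector, read off from the
  derivative on the basis, has to be exhibited before the choice is known to be the
  gradient.\<close>

lemma metric_critical_gradient:
  fixes f :: "'a::euclidean_space \<Rightarrow> real"
  assumes metric: "metric_function f"
    and comps: "\<forall>K \<in> components (critical_set f).
                  (\<exists>p. K = {p}) \<or> (\<exists>d < DIM('a). regular_surface d K)"
    and isolated: "\<forall>K \<in> components (critical_set f).
                  \<exists>U. open U \<and> K \<subseteq> U \<and> U \<inter> critical_set f \<subseteq> K"
  obtains H where "metric_critical f (gradient f) H"
proof -
  have C2: "\<forall>x. f differentiable (at x)" "C1_on UNIV (gradient f)"
    using metric unfolding metric_function_def C2_fun_def by blast+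
  obtain H where H: "\<forall>x\<in>UNIV. (gradient f has_derivative H x) (at x)" "\<forall>i\<in>Basis. continuous_on UNIV (\<lambda>x. H x i)"
    using C2(2) unfolding C1_on_def by blast
  have GD: "GDERIV f x :> gradient f x" for x
  proof -
    obtain D where D: "(f has_derivative D) (at x)" using C2(1) unfolding differentiable_def by blast
    interpret bounded_linear D using D has_derivative_bounded_linear by blast
    have "D h = h \<bullet> (\<Sum>b\<in>Basis. D b *\<^sub>R b)" for h
    proof -
      have "D h = D (\<Sum>b\<in>Basis. (h \<bullet> b) *\<^sub>R b)" by (simp add: euclidean_representation)
      also have "\<dots> = (\<Sum>b\<in>Basis. (h \<bullet> b) * D b)" by (simp add: sum scaleR)
      also have "\<dots> = h \<bullet> (\<Sum>b\<in>Basis. D b *\<^sub>R b)" by (simp add: inner_sum_right mult.commute)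
      finally show ?thesis .
    qed
    then have "D = (\<lambda>h. h \<bullet> (\<Sum>b\<in>Basis. D b *\<^sub>R b))" by blast
    then have "GDERIV f x :> (\<Sum>b\<in>Basis. D b *\<^sub>R b)" unfolding gderiv_def using D by simp
    then show ?thesis unfolding gradient_def by (rule someI)
  qed
  interpret c2_function f "gradient f" H
  proof
    show "(f has_derivative (\<lambda>v. gradient f x \<bullet> v)) (at x)" for x
      using GD[of x] by (simp add: gderiv_def inner_commute)
    show "(gradient f has_derivative H x) (at x)" for x using H(1) by blast
    show "continuous_on UNIV (\<lambda>x. H x v)" for v
    proof -
      have "H x v = (\<Sum>b\<in>Basis. (v \<bullet> b) *\<^sub>R H x b)" for x
      proof -
        interpret bounded_linear "H x" using H(1) has_derivative_bounded_linear by blast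
        have "H x v = H x (\<Sum>b\<in>Basis. (v \<bullet> b) *\<^sub>R b)" by (simp add: euclidean_representation)
        then show ?thesis by (simp add: sum scaleR)
      qed
      then show ?thesis using H(2) by (simp add: continuous_intros)
    qed
  qed
  have crit: "critical_set f = {z. gradient f z = 0}" by (simp add: critical_set_def)
  have "metric_critical f (gradient f) H"
  proof
    show "norm (gradient f y) = norm (gradient f x)" if y: "y \<in> leaf x" for x y
    proof -
      have "f -` {f x} = {z. f z = f x}" by auto
      then have "leaf x \<in> components (f -` {f x})" unfolding components_def leaf_def by auto
      then show ?thesis using metric y leaf_refl unfolding metric_function_def by blast
    qed
    fix x assume x: "gradient f x = 0"
    let ?K = "connected_component_set {z. gradient f z = 0} x"
    have K: "?K \<in> components (critical_set f)" using x unfolding components_def crit by auto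
    show "\<exists>d<DIM('a). regular_surface d ?K"
      using comps[rule_format, OF K] regular_surface_singleton DIM_positive by metis
    show "\<exists>U. open U \<and> ?K \<subseteq> U \<and> U \<inter> {z. gradient f z = 0} \<subseteq> ?K"
      using isolated[rule_format, OF K] unfolding crit .
  qed
  then show ?thesis using that by blast
qed

theorem theorem1p15:
  fixes f :: "'a::euclidean_space \<Rightarrow> real"
  assumes metric: "metric_function f"
    and comps: "\<forall>K \<in> components (critical_set f).
                  (\<exists>p. K = {p}) \<or> (\<exists>d < DIM('a). regular_surface d K)"
    and isolated: "\<forall>K \<in> components (critical_set f).
                  \<exists>U. open U \<and> K \<subseteq> U \<and> U \<inter> critical_set f \<subseteq> K"
  shows "(\<exists>u::'a. u \<noteq> 0 \<and> level_surfaces f = range (\<lambda>t. {x. u \<bullet> x = t}))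
       \<or> (\<exists>p::'a. level_surfaces f = insert {p} ((\<lambda>r. sphere p r) ` {0<..}))
       \<or> (\<exists>k L (p::'a). 1 \<le> k \<and> k + 2 \<le> DIM('a) \<and> subspace L \<and> dim L = k
            \<and> level_surfaces f =
                insert ((+) p ` L) ((\<lambda>r. {x. infdist x ((+) p ` L) = r}) ` {0<..})
            \<and> k = (LEAST d. \<exists>S \<in> level_surfaces f. S \<inter> critical_set f \<noteq> {}
                                \<and> regular_surface d S))"
proof (rule metric_critical_gradient[OF metric comps isolated])
  fix H assume "metric_critical f (gradient f) H"
  then interpret metric_critical f "gradient f" H .
  show ?thesis
  proof (cases "\<exists>p. sing p")
    case False
    then have "\<And>q. \<not> sing q" by blast
    from parallel_hyperplanes[OF this] show ?thesis by (rule disjI1)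
  next
    case True
    then obtain p where p: "sing p" by blast
    show ?thesis
    proof (rule singular_level_surfaces[OF p])
      fix L assume L: "subspace L" "dim L + 2 \<le> DIM('a)" "gradient f p = 0"
        "level_surfaces f = insert ((+) p ` L) ((\<lambda>r. {x. infdist x ((+) p ` L) = r}) ` {0<..})"
      show ?thesis
      proof (cases "dim L = 0")
        case True
        then have "L = {0}" using subspace_0[OF L(1)] by auto
        then have "level_surfaces f = insert {p} ((\<lambda>r. {x. infdist x {p} = r}) ` {0<..})" using L(4) by simp
        moreover have "{x. infdist x {p} = r} = sphere p r" for r by (auto simp: dist_commute)
        ultimately have "level_surfaces f = insert {p} ((\<lambda>r. sphere p r) ` {0<..})" by simp
        then show ?thesis by (intro disjI2 disjI1 exI)
      next
        case False
        have "p \<in> critical_set f" using L(3) by (simp add: critical_set_def)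
        moreover have "S \<noteq> {}" if "S \<in> level_surfaces f" for S
          using that leaf_refl unfolding level_surfaces_eq by blast
        ultimately have "dim L = (LEAST d. \<exists>S \<in> level_surfaces f. S \<inter> critical_set f \<noteq> {} \<and> regular_surface d S)"
          by (intro least_critical_dimension[OF L(1) _ L(4)]) auto
        moreover have "1 \<le> dim L" using False by linarith
        ultimately show ?thesis using L by (intro disjI2 exI[of _ "dim L"] exI[of _ L] exI[of _ p] conjI refl)
      qed
    qed
  qed
qed

end
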